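(* Let $n\ge1$, let $D\subset\mathbb{R}^n$ be an open connected set, $\xi\in D$, and let $u,v$ be real-valued harmonic functions on $D$ such that $u$ is non-negative and $v$ is differentially subordinate to $u$. Then: (i) for $0<p<1$, $\|v\|_{p,\infty}\le 2\|u\|_p$, and this inequality is sharp (the constant $2$ cannot be replaced by a smaller one); (ii) for $p\ge2$, $\|v\|_{p,\infty}\le \frac p2(p-1)^{-1/p}\|u\|_p$.
   Context: $v$ is differentially subordinate to $u$ if $|v(\xi)|\le|u(\xi)|$ and $|\nabla v(x)|\le|\nabla u(x)|$ for all $x\in D$. For a bounded domain $D_0$ with $\xi\in D_0\subset \overline{D_0}\subset D$, let $\mu^\xi_{D_0}$ be the harmonic measure on $\partial D_0$ corresponding to $\xi$. Define $\|u\|_{p,\infty}=\sup_{\lambda>0}\sup_{D_0}[\lambda^p\mu^\xi_{D_0}(\{x\in\partial D_0:|u(x)|\ge\lambda\})]^{1/p}$ and $\|u\|_p=\sup_{D_0}[\int_{\partial D_0}|u(x)|^p\,d\mu^\xi_{D_0}(x)]^{1/p}$, the suprema over $D_0$ being over all such bounded subdomains. *)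

theory Defs
  imports "HOL-Analysis.Analysis"
begin

definition grad :: "('a::euclidean_space \<Rightarrow> real) \<Rightarrow> 'a \<Rightarrow> 'a" where
  "grad f x = (\<Sum>i\<in>Basis. frechet_derivative f (at x) i *\<^sub>R i)"

definition harmonic_on :: "'a::euclidean_space set \<Rightarrow> ('a \<Rightarrow> real) \<Rightarrow> bool" where
  "harmonic_on D f \<longleftrightarrow> open D \<and> f differentiable_on D \<and>
     (\<forall>x\<in>D. grad f differentiable (at x)) \<and>
     (\<forall>i\<in>Basis. \<forall>j\<in>Basis. continuous_on D (\<lambda>x. frechet_derivative (grad f) (at x) i \<bullet> j)) \<and>
     (\<forall>x\<in>D. (\<Sum>i\<in>Basis. frechet_derivative (grad f) (at x) i \<bullet> i) = 0)"

definition diff_subordinate :: "'a::euclidean_space set \<Rightarrow> 'a \<Rightarrow> ('a \<Rightarrow> real) \<Rightarrow> ('a \<Rightarrow> real) \<Rightarrow> bool" where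
  "diff_subordinate D \<xi> v u \<longleftrightarrow> \<bar>v \<xi>\<bar> \<le> \<bar>u \<xi>\<bar> \<and> (\<forall>x\<in>D. norm (grad v x) \<le> norm (grad u x))"

definition cont_superharmonic_on :: "'a::euclidean_space set \<Rightarrow> ('a \<Rightarrow> real) \<Rightarrow> bool" where
  "cont_superharmonic_on S w \<longleftrightarrow> continuous_on S w \<and>
     (\<forall>x r. 0 < r \<and> cball x r \<subseteq> S \<longrightarrow> integral (ball x r) w \<le> w x * measure lebesgue (ball x r))"

text \<open>Upper Perron(-Wiener-Brelot) solution of the Dirichlet problem on D0 with boundary data f, at xi.\<close>
definition perron :: "'a::euclidean_space set \<Rightarrow> ('a \<Rightarrow> real) \<Rightarrow> 'a \<Rightarrow> real" where
  "perron D0 f \<xi> = Inf {w \<xi> | w. cont_superharmonic_on D0 w \<and> bdd_below (w ` D0) \<and>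
      (\<forall>y\<in>frontier D0. \<forall>e>0. eventually (\<lambda>x. f y - e < w x) (at y within D0))}"

definition harmonic_measure_at :: "'a::euclidean_space set \<Rightarrow> 'a \<Rightarrow> 'a measure \<Rightarrow> bool" where
  "harmonic_measure_at D0 \<xi> \<mu> \<longleftrightarrow>
     sets \<mu> = sets (restrict_space borel (frontier D0)) \<and> finite_measure \<mu> \<and>
     (\<forall>f. continuous_on (frontier D0) f \<longrightarrow> integral\<^sup>L \<mu> f = perron D0 f \<xi>)"

definition admissible :: "'a::euclidean_space set \<Rightarrow> 'a \<Rightarrow> 'a set \<Rightarrow> bool" where
  "admissible D \<xi> D0 \<longleftrightarrow> open D0 \<and> connected D0 \<and> bounded D0 \<and> \<xi> \<in> D0 \<and> closure D0 \<subseteq> D"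

definition weak_norm :: "real \<Rightarrow> 'a::euclidean_space set \<Rightarrow> 'a \<Rightarrow> ('a \<Rightarrow> real) \<Rightarrow> ennreal" where
  "weak_norm p D \<xi> v = (SUP (l, D0, \<mu>) \<in> {(l, D0, \<mu>). 0 < l \<and> admissible D \<xi> D0 \<and> harmonic_measure_at D0 \<xi> \<mu>}.
      ennreal ((l powr p * measure \<mu> {x \<in> frontier D0. l \<le> \<bar>v x\<bar>}) powr (1 / p)))"

definition strong_norm :: "real \<Rightarrow> 'a::euclidean_space set \<Rightarrow> 'a \<Rightarrow> ('a \<Rightarrow> real) \<Rightarrow> ennreal" where
  "strong_norm p D \<xi> u = (SUP (D0, \<mu>) \<in> {(D0, \<mu>). admissible D \<xi> D0 \<and> harmonic_measure_at D0 \<xi> \<mu>}.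
      ennreal ((\<integral>x. \<bar>u x\<bar> powr p \<partial>\<mu>) powr (1 / p)))"


end

(*
  Let u >= 0 and v be harmonic with v subordinate to u. Each weak-type bound reduces to a function U on
  [0,oo) x R that majorizes 1_{|y| >= 1} - C x^p, satisfies U(x,y) <= 0 for |y| <= x, and makes U(u,v)
  superharmonic; integrating against harmonic measure then gives mu(|v| >= 1) <= C int u^p dmu. Superharmonicity
  is checked pointwise: near each point U(u,v) is dominated, up to a third-order error, by
  a(v^2 - u^2) + b v + c u + d with a >= 0, which is superharmonic because
  Laplace(v^2 - u^2) = 2|grad v|^2 - 2|grad u|^2 <= 0.
  For p < 1 the bound follows from the weak-type (1,1) inequality mu(|v| >= l) <= 2 u(xi)/l and from
  ||u||_p >= u(xi), which is seen on small balls around xi. Balls carry an explicit harmonic measure, namely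
  the Poisson kernel; the same measure yields the extremal example.
*)
theory Submission
  imports Defs
begin

subsection \<open>Averages over balls\<close>

text \<open>The ball mean of a smooth function differs from its centre value by a term of order
  \<open>r^2\<close>, so an error \<open>K * r^3\<close> cannot spoil a strict minimum argument.
  This lets the dominating quadratic change from point to point and spares the special functions
  second derivatives. \<open>D0\<close> may have irregular boundary points; Perron solutions are
  therefore compared only with functions that attain the boundary values in the limit. A concrete
  harmonic measure serves only to bound a norm from below, and balls suffice there. For
  \<open>p < 1\<close>, the weak-type bound and the total mass one combine through
  \<open>min 1 s \<le> s powr p\<close>. For \<open>p > 2\<close>,
  \<open>C = (p / 2) powr p / (p - 1)\<close> is the \<open>p\<close>-th power of the stated
  constant. The quadratics are dilations of a single one, which touches
  \<open>- C * x powr p\<close> at \<open>(2 / p, 1 - 2 / p)\<close> and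
  \<open>1 - C * x powr p\<close> at \<open>(2 / p, 1)\<close>. Their parameter degenerates at
  \<open>u = v = 0\<close>, so \<open>u + \<eta>\<close> replaces \<open>u\<close> until the
  end.\<close>

lemma lborel_integral_affine:
  fixes f :: "'a::euclidean_space \<Rightarrow> 'b::{banach, second_countable_topology}"
  assumes c: "c \<noteq> 0"
  shows "(\<integral>x. f x \<partial>lborel) = \<bar>c\<bar> ^ DIM('a) *\<^sub>R (\<integral>x. f (t + c *\<^sub>R x) \<partial>lborel)"
proof -
  have meas: "g \<in> borel_measurable borel"
    if "(\<lambda>x. g (s + d *\<^sub>R x)) \<in> borel_measurable borel" "d \<noteq> 0" for g :: "'a \<Rightarrow> 'b" and s d
  proof -
    have "(\<lambda>x. g (s + d *\<^sub>R ((1/d) *\<^sub>R (x - s)))) \<in> borel_measurable borel"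
      by (rule measurable_compose[OF _ that(1), where f="\<lambda>x. (1/d) *\<^sub>R (x - s)"]) measurable
    then show ?thesis using that(2) by simp
  qed
  show ?thesis
  proof (cases "f \<in> borel_measurable borel")
    case True
    note [measurable] = this
    have "(\<integral>x. f x \<partial>lborel) =
      (\<integral>x. f x \<partial>density (distr lborel borel (\<lambda>x. t + c *\<^sub>R x)) (\<lambda>_. ennreal (\<bar>c\<bar> ^ DIM('a))))"
      using lborel_affine[OF c, of t] by (simp add: ennreal_power)
    also have "\<dots> = \<bar>c\<bar> ^ DIM('a) *\<^sub>R (\<integral>x. f (t + c *\<^sub>R x) \<partial>lborel)"
      by (simp add: integral_density integral_distr)
    finally show ?thesis .
  next
    \<comment> \<open>An invertible affine substitution also preserves non-measurability, and then
      both Bochner integrals take the default value 0. Hence the formula holds for every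
      \<open>f\<close>.\<close>
    case False
    then have "(\<lambda>x. f (t + c *\<^sub>R x)) \<notin> borel_measurable borel" using meas c by blast
    with False have "\<not> integrable lborel f" "\<not> integrable lborel (\<lambda>x. f (t + c *\<^sub>R x))"
      by (auto dest: borel_measurable_integrable)
    then show ?thesis by (simp add: not_integrable_integral_eq)
  qed
qed

section \<open>Normalised Lebesgue measure on the unit ball\<close>

definition bvol :: "'a::euclidean_space itself \<Rightarrow> real" where
  "bvol _ = measure lborel (ball (0::'a) 1)"

text \<open>A probability measure on one fixed space: the mean over the ball of radius
  \<open>r\<close> around \<open>x\<close> is the integral of \<open>f (x + r *\<^sub>R y)\<close>,
  so centre and radius sit in the integrand, where they can be differentiated, sent to a limit or
  exchanged with another integral.\<close>

definition unif :: "'a::euclidean_space measure" where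
  "unif = density (restrict_space lborel (ball 0 1)) (\<lambda>_. ennreal (1 / bvol TYPE('a)))"

lemma bvol_pos: "bvol TYPE('a::euclidean_space) > 0"
  unfolding bvol_def by (rule content_ball_pos) simp

lemma space_unif [simp]: "space (unif :: 'a::euclidean_space measure) = ball 0 1"
  by (simp add: unif_def space_restrict_space)

lemma sets_unif [measurable_cong]:
  "sets (unif :: 'a::euclidean_space measure) = sets (restrict_space borel (ball 0 1))"
  by (simp add: unif_def sets_restrict_space)

lemma borel_measurable_unifI:
  fixes f :: "'a::euclidean_space \<Rightarrow> 'b::topological_space"
  assumes "continuous_on (ball 0 1) f"
  shows "f \<in> borel_measurable unif"
  using borel_measurable_continuous_on_restrict[OF assms]
    measurable_cong_sets[OF sets_unif refl] by blast

lemma borel_measurable_unif_borelI: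
  fixes f :: "'a::euclidean_space \<Rightarrow> 'b::topological_space"
  assumes "f \<in> borel_measurable borel"
  shows "f \<in> borel_measurable unif"
  using measurable_restrict_space1[OF assms]
    measurable_cong_sets[OF sets_unif refl] by blast

lemma integral_unif:
  fixes f :: "'a::euclidean_space \<Rightarrow> 'b::{banach, second_countable_topology}"
  assumes "f \<in> borel_measurable unif"
  shows "(\<integral>y. f y \<partial>unif) = (1 / bvol TYPE('a)) *\<^sub>R (\<integral>y. indicator (ball 0 1) y *\<^sub>R f y \<partial>lborel)"
proof -
  have f: "f \<in> borel_measurable (restrict_space lborel (ball 0 1))"
    using assms by (simp add: unif_def)
  show ?thesis using bvol_pos[where 'a='a] f
    by (simp add: unif_def integral_density integral_restrict_space)
qed

lemma emeasure_unif_space: "emeasure unif (ball (0::'a::euclidean_space) 1) = 1"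
proof -
  have b: "emeasure lborel (ball (0::'a) 1) = ennreal (bvol TYPE('a))"
    unfolding bvol_def using emeasure_lborel_ball_finite[of "0::'a" 1] by (intro emeasure_eq_ennreal_measure) auto
  have "emeasure unif (space (unif::'a measure)) = ennreal (1 / bvol TYPE('a)) * ennreal (bvol TYPE('a))"
    unfolding unif_def
    by (subst emeasure_density_const) (auto simp: space_restrict_space emeasure_restrict_space b sets_restrict_space)
  also have "\<dots> = 1"
    using bvol_pos[where 'a='a] by (simp add: ennreal_mult[symmetric])
  finally show ?thesis by simp
qed

lemma finite_measure_unif: "finite_measure (unif :: 'a::euclidean_space measure)"
  by (rule finite_measureI) (simp add: emeasure_unif_space)

lemma measure_unif_space [simp]: "measure unif (ball (0::'a::euclidean_space) 1) = 1"
  by (simp add: measure_def emeasure_unif_space)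

lemma integrable_unif:
  fixes f :: "'a::euclidean_space \<Rightarrow> 'b::{banach, second_countable_topology}"
  assumes "f \<in> borel_measurable unif" "\<And>y. norm y < 1 \<Longrightarrow> norm (f y) \<le> B"
  shows "integrable unif f"
proof (rule finite_measure.integrable_const_bound[OF finite_measure_unif _ assms(1)])
  show "AE y in unif. norm (f y) \<le> B"
    by (rule AE_I2) (simp add: assms(2))
qed

lemma integrable_unif_cont:
  fixes f :: "'a::euclidean_space \<Rightarrow> 'b::{banach, second_countable_topology}"
  assumes "continuous_on (cball 0 1) f"
  shows "integrable unif f"
proof -
  have "bounded (f ` cball 0 1)"
    by (rule compact_imp_bounded[OF compact_continuous_image[OF assms compact_cball]])
  then obtain B where B: "\<forall>z\<in>f ` cball 0 1. norm z \<le> B"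
    unfolding bounded_iff by blast
  show ?thesis
  proof (rule integrable_unif)
    show "f \<in> borel_measurable unif"
      by (rule borel_measurable_unifI[OF continuous_on_subset[OF assms ball_subset_cball]])
    show "norm (f y) \<le> B" if "norm y < 1" for y
      using that by (intro B[rule_format] imageI) simp
  qed
qed

lemma integral_unif_const [simp]: "(\<integral>y. c \<partial>(unif::'a::euclidean_space measure)) = (c::real)"
  by simp

lemma integral_unif_mono:
  fixes f g :: "'a::euclidean_space \<Rightarrow> real"
  assumes "integrable unif f" "integrable unif g" "\<And>y. norm y < 1 \<Longrightarrow> f y \<le> g y"
  shows "(\<integral>y. f y \<partial>unif) \<le> (\<integral>y. g y \<partial>unif)"
  using assms by (intro integral_mono) auto

lemma integral_ball_unif:
  fixes f :: "'a::euclidean_space \<Rightarrow> real"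
  assumes f: "continuous_on (cball x r) f" and r: "0 < r"
  shows "integral (ball x r) f = measure lebesgue (ball x r) * (\<integral>y. f (x + r *\<^sub>R y) \<partial>unif)"
proof -
  have "set_integrable lborel (cball x r) f"
    by (rule borel_integrable_compact[OF _ f, folded set_integrable_def]) simp
  then have si: "set_integrable lborel (ball x r) f"
    by (rule set_integrable_subset) auto
  have cont: "continuous_on (cball 0 1) (\<lambda>y. f (x + r *\<^sub>R y))"
    using r by (intro continuous_on_compose2[OF f]) (auto intro!: continuous_intros simp: dist_norm)
  have vol: "measure lebesgue (ball x r) = r ^ DIM('a) * bvol TYPE('a)"
    using r by (simp add: bvol_def content_ball_conv_unit_ball[of r x] measure_completion)
  have "integral (ball x r) f = (\<integral>z. indicator (ball x r) z *\<^sub>R f z \<partial>lborel)"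
    using set_borel_integral_eq_integral(2)[OF si] by (simp add: set_lebesgue_integral_def)
  also have "\<dots> = r ^ DIM('a) * (\<integral>y. indicator (ball x r) (x + r *\<^sub>R y) *\<^sub>R f (x + r *\<^sub>R y) \<partial>lborel)"
    using lborel_integral_affine[of r "\<lambda>z. indicator (ball x r) z *\<^sub>R f z" x] r by simp
  also have "(\<lambda>y. indicator (ball x r) (x + r *\<^sub>R y) *\<^sub>R f (x + r *\<^sub>R y)) =
      (\<lambda>y. indicator (ball 0 1) y *\<^sub>R f (x + r *\<^sub>R y))"
    using r by (auto simp: indicator_def dist_norm fun_eq_iff)
  also have "(\<integral>y. indicator (ball 0 1) y *\<^sub>R f (x + r *\<^sub>R y) \<partial>lborel) =
      bvol TYPE('a) * (\<integral>y. f (x + r *\<^sub>R y) \<partial>unif)"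
    using bvol_pos[where 'a='a]
    by (subst integral_unif[OF borel_measurable_unifI[OF continuous_on_subset[OF cont ball_subset_cball]]]) simp
  finally show ?thesis by (simp add: vol)
qed

text \<open>The bound on \<open>F'\<close> controls all difference quotients by the mean value
  inequality, so dominated convergence applies along every sequence tending to
  \<open>s\<close>.\<close>

lemma has_real_derivative_integral:
  fixes F :: "real \<Rightarrow> 'b \<Rightarrow> real"
  assumes M: "finite_measure M" and I: "open I" "convex I" "s \<in> I"
    and int: "\<And>t. t \<in> I \<Longrightarrow> integrable M (F t)"
    and meas: "F' s \<in> borel_measurable M"
    and der: "\<And>t y. t \<in> I \<Longrightarrow> y \<in> space M \<Longrightarrow> ((\<lambda>t. F t y) has_real_derivative F' t y) (at t)"
    and bnd: "\<And>t y. t \<in> I \<Longrightarrow> y \<in> space M \<Longrightarrow> \<bar>F' t y\<bar> \<le> B"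
  shows "((\<lambda>t. \<integral>y. F t y \<partial>M) has_real_derivative (\<integral>y. F' s y \<partial>M)) (at s)"
  unfolding has_field_derivative_iff tendsto_at_iff_sequentially comp_def
proof (intro allI impI)
  fix X :: "nat \<Rightarrow> real" assume X: "\<forall>i. X i \<in> UNIV - {s}" "X \<longlonglongrightarrow> s"
  have lim: "((\<lambda>t. (F t y - F s y) / (t - s)) \<longlongrightarrow> F' s y) (at s)" if "y \<in> space M" for y
    using der[OF I(3) that] by (simp add: has_field_derivative_iff)
  \<comment> \<open>The value 0 outside \<open>I\<close> makes integrability and the bound valid for
    every \<open>n\<close> and not only eventually.\<close>
  define Q where "Q n y = (if X n \<in> I then (F (X n) y - F s y) / (X n - s) else 0)" for n y
  have ev: "\<forall>\<^sub>F n in sequentially. X n \<in> I"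
    using X(2) I(1,3) topological_tendstoD by blast
  have Qint: "integrable M (Q n)" for n
    unfolding Q_def using int[of "X n"] int[OF I(3)] by (cases "X n \<in> I") auto
  have Qlim: "(\<lambda>n. Q n y) \<longlonglongrightarrow> F' s y" if "y \<in> space M" for y
  proof -
    have "(\<lambda>n. (F (X n) y - F s y) / (X n - s)) \<longlonglongrightarrow> F' s y"
      using lim[OF that] X unfolding tendsto_at_iff_sequentially comp_def by blast
    moreover have "\<forall>\<^sub>F n in sequentially. (F (X n) y - F s y) / (X n - s) = Q n y"
      using ev by eventually_elim (simp add: Q_def)
    ultimately show ?thesis by (rule Lim_transform_eventually)
  qed
  have Qbnd: "\<bar>Q n y\<bar> \<le> \<bar>B\<bar>" if y: "y \<in> space M" for n y
  proof (cases "X n \<in> I")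
    case True
    have "norm (F (X n) y - F s y) \<le> \<bar>B\<bar> * norm (X n - s)"
    proof (rule field_differentiable_bound[OF I(2), where f="\<lambda>t. F t y" and f'="\<lambda>t. F' t y"])
      show "((\<lambda>t. F t y) has_real_derivative F' z y) (at z within I)" if "z \<in> I" for z
        using der[OF that y] by (rule has_field_derivative_at_within)
      show "norm (F' z y) \<le> \<bar>B\<bar>" if "z \<in> I" for z
        using bnd[OF that y] by simp
    qed (use True I in auto)
    then show ?thesis using X(1) True by (simp add: Q_def divide_le_eq)
  qed (simp add: Q_def)
  have "(\<lambda>n. \<integral>y. Q n y \<partial>M) \<longlonglongrightarrow> (\<integral>y. F' s y \<partial>M)"
  proof (rule integral_dominated_convergence[where w="\<lambda>_. \<bar>B\<bar>"])
    show "integrable M (\<lambda>_. \<bar>B\<bar>)" using M by (simp add: finite_measure.integrable_const)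
  qed (use meas Qint Qlim Qbnd in \<open>auto intro: borel_measurable_integrable\<close>)
  moreover have "\<forall>\<^sub>F n in sequentially. (\<integral>y. Q n y \<partial>M) = ((\<integral>y. F (X n) y \<partial>M) - (\<integral>y. F s y \<partial>M)) / (X n - s)"
    using ev
  proof eventually_elim
    case (elim n)
    then show ?case using int[OF elim] int[OF I(3)] by (simp add: Q_def)
  qed
  ultimately show "(\<lambda>n. ((\<integral>y. F (X n) y \<partial>M) - (\<integral>y. F s y \<partial>M)) / (X n - s)) \<longlonglongrightarrow> (\<integral>y. F' s y \<partial>M)"
    by (rule Lim_transform_eventually)
qed

lemma cball_subset_open_enlarge:
  fixes x :: "'a::euclidean_space"
  assumes "open S" "cball x r \<subseteq> S" "0 \<le> r"
  obtains R where "r < R" "cball x R \<subseteq> S"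
proof -
  obtain e where e: "e > 0" "(\<Union>z\<in>cball x r. ball z e) \<subseteq> S"
    using compact_subset_open_imp_ball_epsilon_subset[OF compact_cball assms(1,2)] by auto
  have "cball x (r + e/2) \<subseteq> S"
  proof
    fix z assume z: "z \<in> cball x (r + e/2)"
    show "z \<in> S"
    proof (cases "z \<in> cball x r")
      case True then show ?thesis using assms by blast
    next
      case False
      define d where "d = dist x z"
      have d: "r < d" "d \<le> r + e/2" using False z by (auto simp: d_def)
      \<comment> \<open>The radial projection of \<open>z\<close> onto the sphere of radius
        \<open>r\<close>, at distance \<open>d - r\<close> from \<open>z\<close>.\<close>
      define y where "y = x + (r/d) *\<^sub>R (z - x)"
      have "dist x y = r" using d assms(3) by (auto simp: y_def dist_norm d_def norm_minus_commute)
      have "y - z = (r/d - 1) *\<^sub>R (z - x)" by (simp add: y_def algebra_simps)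
      then have "dist y z = \<bar>r/d - 1\<bar> * d" by (simp add: dist_norm d_def norm_minus_commute)
      moreover have "\<bar>r/d - 1\<bar> * d = (1 - r/d) * d" using d assms(3) by simp
      moreover have "(1 - r/d) * d = d - r" using d assms(3) by (simp add: left_diff_distrib)
      ultimately have "dist y z = d - r" by simp
      then have "z \<in> ball y e" using e d by simp
      moreover have "y \<in> cball x r" using \<open>dist x y = r\<close> by simp
      ultimately show ?thesis using e(2) by blast
    qed
  qed
  then show thesis using that[of "r + e/2"] e by auto
qed

section \<open>Integration by parts on the unit ball\<close>

lemma AE_norm_neq:
  "AE y in (lborel::'a::euclidean_space measure). norm y \<noteq> r"
proof -
  have "sphere (0::'a) r \<in> null_sets lborel"
    using negligible_sphere[of "0::'a" r] by (simp add: negligible_iff_null_sets null_sets_completion_iff)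
  then have "AE y in lborel. y \<notin> sphere (0::'a) r" by (rule AE_not_in)
  then show ?thesis by simp
qed

lemma integral_translate:
  fixes f :: "'a::euclidean_space \<Rightarrow> real"
  shows "(\<integral>y. f (y + t) \<partial>lborel) = (\<integral>y. f y \<partial>lborel)"
  using lborel_integral_affine[of 1 f t] by (simp add: add.commute)

(* The vector field vanishes on the sphere, so its extension by zero is Lipschitz along i and
   the integrals of its difference quotients vanish by translation invariance. *)
lemma integral_unif_directional_derivative:
  fixes \<phi> d\<phi> :: "'a::euclidean_space \<Rightarrow> real"
  assumes i: "norm i = 1"
    and c\<phi>: "continuous_on (cball 0 1) \<phi>" and cd: "continuous_on (cball 0 1) d\<phi>"
    and der: "\<And>y. norm y < 1 \<Longrightarrow> ((\<lambda>t. \<phi> (y + t *\<^sub>R i)) has_real_derivative d\<phi> y) (at 0)"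
  shows "(\<integral>y. (1 - y \<bullet> y) / 2 * d\<phi> y - (y \<bullet> i) * \<phi> y \<partial>unif) = 0"
proof -
  \<comment> \<open>The weight \<open>(1 - |y|^2) / 2\<close> vanishes on the unit sphere and has
    gradient \<open>- y\<close>; hence \<open>D\<close> is the derivative of \<open>g\<close> along
    \<open>i\<close>.\<close>
  define D where "D y = (1 - y \<bullet> y) / 2 * d\<phi> y - (y \<bullet> i) * \<phi> y" for y
  define g where "g y = (1 - y \<bullet> y) / 2 * \<phi> y" for y
  define h where "h y = (if y \<in> ball 0 1 then g y else 0)" for y
  have "bounded (\<phi> ` cball 0 1)" "bounded (d\<phi> ` cball 0 1)"
    by (rule compact_imp_bounded[OF compact_continuous_image[OF _ compact_cball]], fact)+
  then obtain B1 B2 where B: "\<And>y. norm y \<le> 1 \<Longrightarrow> \<bar>\<phi> y\<bar> \<le> B1" "\<And>y. norm y \<le> 1 \<Longrightarrow> \<bar>d\<phi> y\<bar> \<le> B2"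
    unfolding bounded_iff by force
  have B0: "0 \<le> B1" "0 \<le> B2" using B[of 0] abs_ge_zero order_trans by (force, force)
  define C where "C = B1 + B2"
  have nsq: "y \<bullet> y < 1" if "norm y < 1" for y :: 'a
    using that by (simp add: dot_square_norm power_less_one_iff abs_square_less_1)
  have half: "0 \<le> a \<Longrightarrow> a < 1 \<Longrightarrow> \<bar>(1 - a) / 2\<bar> \<le> 1" for a :: real by simp
  have Dbnd: "\<bar>D y\<bar> \<le> C" if y: "norm y < 1" for y
  proof -
    have "\<bar>y \<bullet> i\<bar> \<le> 1" using Cauchy_Schwarz_ineq2[of y i] i y by simp
    moreover have "\<bar>(1 - y \<bullet> y) / 2\<bar> \<le> 1" using half[OF inner_ge_zero nsq[OF y]] .
    ultimately have "\<bar>(1 - y \<bullet> y) / 2\<bar> * \<bar>d\<phi> y\<bar> \<le> 1 * B2" "\<bar>y \<bullet> i\<bar> * \<bar>\<phi> y\<bar> \<le> 1 * B1"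
      using B[of y] y by (intro mult_mono; simp)+
    then show ?thesis
      using abs_triangle_ineq4[of "(1 - y \<bullet> y) / 2 * d\<phi> y" "(y \<bullet> i) * \<phi> y"]
      unfolding D_def C_def abs_mult by linarith
  qed
  have gder0: "((\<lambda>t. g (y + t *\<^sub>R i)) has_real_derivative D y) (at 0)" if "norm y < 1" for y
    unfolding g_def D_def using der[OF that] i
    by (auto intro!: derivative_eq_intros simp: inner_add inner_commute algebra_simps) (simp add: field_simps)
  have gder: "((\<lambda>t. g (y + t *\<^sub>R i)) has_real_derivative D (y + s *\<^sub>R i)) (at s)"
    if "norm (y + s *\<^sub>R i) < 1" for y s
    using gder0[OF that] DERIV_shift[of "\<lambda>t. g (y + t *\<^sub>R i)" "D (y + s *\<^sub>R i)" 0 s]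
    by (simp add: algebra_simps)
  \<comment> \<open>A point that leaves the ball under a shift of length \<open>t\<close> lies
    within \<open>t\<close> of the sphere, and there the weight is at most the distance to the
    sphere.\<close>
  have edge: "\<bar>g y\<bar> \<le> B1 * t" if "norm y < 1" "1 \<le> norm (y + t *\<^sub>R i) \<or> 1 \<le> norm (y - t *\<^sub>R i)" "0 < t" for y t
  proof -
    have "norm (y + t *\<^sub>R i) \<le> norm y + t" "norm (y - t *\<^sub>R i) \<le> norm y + t"
      using norm_triangle_ineq[of y "t *\<^sub>R i"] norm_triangle_ineq4[of y "t *\<^sub>R i"] i that by auto
    then have "1 - norm y \<le> t" using that by auto
    moreover have "(1 - y \<bullet> y) / 2 = (1 - norm y) * ((1 + norm y) / 2)"
      by (simp add: dot_square_norm power2_eq_square algebra_simps)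
    moreover have "(1 - norm y) * ((1 + norm y) / 2) \<le> (1 - norm y) * 1"
      using that by (intro mult_left_mono) auto
    ultimately have "(1 - y \<bullet> y) / 2 \<le> t" by (metis mult_1_right order_trans)
    then have "(1 - y \<bullet> y) / 2 * \<bar>\<phi> y\<bar> \<le> t * B1"
      using B(1)[of y] that by (intro mult_mono) auto
    then show ?thesis using nsq[OF that(1)] by (simp add: g_def abs_mult mult.commute)
  qed
  have lip: "\<bar>h (y + t *\<^sub>R i) - h y\<bar> \<le> C * t" if t: "0 < t" for y t
  proof -
    consider (both) "norm y < 1" "norm (y + t *\<^sub>R i) < 1" | (out) "1 \<le> norm y" "1 \<le> norm (y + t *\<^sub>R i)"
      | (left) "norm y < 1" "1 \<le> norm (y + t *\<^sub>R i)" | (right) "1 \<le> norm y" "norm (y + t *\<^sub>R i) < 1"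
      by linarith
    then show ?thesis
    proof cases
      case both
      have inside: "norm (y + s *\<^sub>R i) < 1" if "s \<in> {0..t}" for s
      proof -
        have "y + s *\<^sub>R i = (1 - s/t) *\<^sub>R y + (s/t) *\<^sub>R (y + t *\<^sub>R i)"
          using t by (simp add: algebra_simps)
        moreover have "\<dots> \<in> ball 0 1"
          using both that t by (intro convexD_alt[OF convex_ball]) auto
        ultimately show ?thesis by simp
      qed
      have "norm (g (y + t *\<^sub>R i) - g (y + 0 *\<^sub>R i)) \<le> C * norm (t - 0)"
      proof (rule field_differentiable_bound[where S="{0..t}" and f'="\<lambda>s. D (y + s *\<^sub>R i)"])
        fix s assume "s \<in> {0..t}"
        note ns = inside[OF this]
        show "((\<lambda>a. g (y + a *\<^sub>R i)) has_real_derivative D (y + s *\<^sub>R i)) (at s within {0..t})"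
          using gder[OF ns] by (rule has_field_derivative_at_within)
        show "norm (D (y + s *\<^sub>R i)) \<le> C" using Dbnd[OF ns] by simp
      qed (use t in auto)
      then show ?thesis using both t by (simp add: h_def)
    next
      case out then show ?thesis using t B0 by (simp add: h_def C_def)
    next
      case left
      then have "\<bar>g y\<bar> \<le> B1 * t" using edge t by blast
      then show ?thesis using left B0 t by (simp add: h_def C_def distrib_right add_increasing2)
    next
      case right
      then have "\<bar>g (y + t *\<^sub>R i)\<bar> \<le> B1 * t" using edge[of "y + t *\<^sub>R i" t] t by simp
      then show ?thesis using right B0 t by (simp add: h_def C_def distrib_right add_increasing2)
    qed
  qed
  have gc: "continuous_on (ball 0 1) g" unfolding g_def
    by (intro continuous_intros continuous_on_subset[OF c\<phi> ball_subset_cball]) simp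
  have hm [measurable]: "h \<in> borel_measurable borel" unfolding h_def
    by (rule borel_measurable_continuous_on_if[OF _ gc]) (auto intro: continuous_intros)
  have Dc: "continuous_on (ball 0 1) D" unfolding D_def
    by (intro continuous_intros continuous_on_subset[OF c\<phi> ball_subset_cball]
        continuous_on_subset[OF cd ball_subset_cball]) simp
  have Dm: "(\<lambda>y. if y \<in> ball 0 1 then D y else 0) \<in> borel_measurable borel"
    by (rule borel_measurable_continuous_on_if[OF _ Dc]) (auto intro: continuous_intros)
  \<comment> \<open>Steps of length at most 1 keep the supports of all quotients \<open>q k\<close>
    inside the ball of radius 2, which gives one integrable majorant.\<close>
  define t where "t k = 1 / real (Suc k)" for k
  have t: "0 < t k" "t k \<le> 1" for k by (auto simp: t_def)
  have tlim: "t \<longlonglongrightarrow> 0" unfolding t_def by (rule LIMSEQ_Suc[OF lim_1_over_n])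
  define q where "q k y = (h (y + t k *\<^sub>R i) - h y) / t k" for k y
  have hint: "integrable lborel h"
  proof (rule Bochner_Integration.integrable_bound[where f="\<lambda>y. B1 * indicator (ball (0::'a) 1) y"])
    show "integrable lborel (\<lambda>y. B1 * indicator (ball (0::'a) 1) y)"
      using emeasure_lborel_ball_finite[of "0::'a" 1] by auto
    have "\<bar>g y\<bar> \<le> B1" if y: "norm y < 1" for y
    proof -
      have "\<bar>(1 - y \<bullet> y) / 2\<bar> \<le> 1" using half[OF inner_ge_zero nsq[OF y]] .
      then have "\<bar>(1 - y \<bullet> y) / 2\<bar> * \<bar>\<phi> y\<bar> \<le> 1 * B1" using B(1)[of y] y by (intro mult_mono) auto
      then show ?thesis by (simp only: g_def abs_mult mult_1)
    qed
    then show "AE y in lborel. norm (h y) \<le> norm (B1 * indicator (ball 0 1) y)"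
      using B0 by (intro AE_I2) (auto simp: h_def indicator_def)
  qed (use hm in simp)
  have hint': "integrable lborel (\<lambda>y. h (y + t k *\<^sub>R i))" for k
  proof (rule Bochner_Integration.integrable_bound[where f="\<lambda>y. \<bar>h y\<bar> + C * indicator (cball (0::'a) 2) y"])
    show "integrable lborel (\<lambda>y. \<bar>h y\<bar> + C * indicator (cball (0::'a) 2) y)"
      using hint emeasure_lborel_cball_finite[of "0::'a" 2] by auto
    have "\<bar>h (y + t k *\<^sub>R i)\<bar> \<le> \<bar>h y\<bar> + C * indicator (cball (0::'a) 2) y" for y
    proof (cases "norm y \<le> 2")
      case True
      have "\<bar>h (y + t k *\<^sub>R i) - h y\<bar> \<le> C * t k" by (rule lip[OF t(1)])
      also have "\<dots> \<le> C" using t(2)[of k] B0 by (simp add: C_def mult_left_le)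
      finally show ?thesis using True by (simp add: indicator_def)
    next
      case False
      have "norm y \<le> norm (y + t k *\<^sub>R i) + norm (t k *\<^sub>R i)"
        using norm_triangle_ineq4[of "y + t k *\<^sub>R i" "t k *\<^sub>R i"] by simp
      then have "1 < norm (y + t k *\<^sub>R i)" using False t[of k] i by simp
      then show ?thesis using B0 by (simp add: h_def C_def indicator_def)
    qed
    moreover have "0 \<le> C" using B0 by (simp add: C_def)
    ultimately show "AE y in lborel. norm (h (y + t k *\<^sub>R i)) \<le> norm (\<bar>h y\<bar> + C * indicator (cball 0 2) y)"
      by (intro AE_I2) (smt (verit) real_norm_def)
  qed measurable
  have qint0: "(\<integral>y. q k y \<partial>lborel) = 0" for k
    using hint hint'[of k] integral_translate[of h "t k *\<^sub>R i"] by (simp add: q_def)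
  have "(\<lambda>k. \<integral>y. q k y \<partial>lborel) \<longlonglongrightarrow> (\<integral>y. (if y \<in> ball 0 1 then D y else 0) \<partial>lborel)"
  proof (rule integral_dominated_convergence[where w="\<lambda>y. C * indicator (cball (0::'a) 2) y"])
    show "integrable lborel (\<lambda>y. C * indicator (cball (0::'a) 2) y)"
      using emeasure_lborel_cball_finite[of "0::'a" 2] by auto
    show "AE y in lborel. norm (q k y) \<le> C * indicator (cball 0 2) y" for k
    proof (rule AE_I2)
      fix y
      show "norm (q k y) \<le> C * indicator (cball 0 2) y"
      proof (cases "norm y \<le> 2")
        case True then show ?thesis using lip[OF t(1)[of k], of y] t(1)[of k] by (simp add: q_def divide_le_eq)
      next
        case False
        have "norm y \<le> norm (y + t k *\<^sub>R i) + norm (t k *\<^sub>R i)"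
          using norm_triangle_ineq4[of "y + t k *\<^sub>R i" "t k *\<^sub>R i"] by simp
        then have "1 < norm (y + t k *\<^sub>R i)" using False t[of k] i by simp
        then show ?thesis using False by (simp add: q_def h_def)
      qed
    qed
    show "AE y in lborel. (\<lambda>k. q k y) \<longlonglongrightarrow> (if y \<in> ball 0 1 then D y else 0)"
      using AE_norm_neq[of 1]
    proof eventually_elim
      case (elim y)
      have shift: "(\<lambda>k. y + t k *\<^sub>R i) \<longlonglongrightarrow> y" using tendsto_add[OF tendsto_const tendsto_scaleR[OF tlim tendsto_const[of i]], of y] by simp
      show ?case
      proof (cases "norm y < 1")
        case True
        have "(\<lambda>k. (g (y + t k *\<^sub>R i) - g y) / t k) \<longlonglongrightarrow> D y"
        proof -
          have "\<forall>k. t k \<in> UNIV - {0}" using t(1) less_imp_neq by fastforce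
          then show ?thesis using gder0[OF True] tlim
            unfolding has_field_derivative_iff tendsto_at_iff_sequentially comp_def by auto
        qed
        moreover have "\<forall>\<^sub>F k in sequentially. y + t k *\<^sub>R i \<in> ball 0 1"
          using True by (intro topological_tendstoD[OF shift]) auto
        then have "\<forall>\<^sub>F k in sequentially. (g (y + t k *\<^sub>R i) - g y) / t k = q k y"
          by eventually_elim (use True in \<open>simp add: q_def h_def\<close>)
        ultimately show ?thesis using True by (auto intro: Lim_transform_eventually)
      next
        case False
        then have "\<forall>\<^sub>F k in sequentially. y + t k *\<^sub>R i \<in> - cball 0 1"
          using elim by (intro topological_tendstoD[OF shift]) auto
        then have "\<forall>\<^sub>F k in sequentially. q k y = 0"
          by eventually_elim (use False in \<open>simp add: q_def h_def\<close>)
        then show ?thesis using False tendsto_eventually by auto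
      qed
    qed
  qed (use Dm hm in \<open>auto simp: q_def\<close>)
  then have "(\<integral>y. (if y \<in> ball 0 1 then D y else 0) \<partial>lborel) = 0"
    using qint0 by (simp add: LIMSEQ_const_iff)
  moreover have "(\<lambda>y. if y \<in> ball 0 1 then D y else 0) = (\<lambda>y. indicator (ball 0 1) y *\<^sub>R D y)"
    by (auto simp: indicator_def)
  ultimately have "(\<integral>y. D y \<partial>unif) = 0"
    using integral_unif[OF borel_measurable_unifI[OF Dc]] by simp
  then show ?thesis by (simp add: D_def)
qed

subsection \<open>The divergence identity and mean values\<close>

text \<open>The divergence theorem for the field \<open>(1 - |y|^2) / 2\<close> times
  \<open>F\<close>: the boundary term is zero because the weight vanishes on the sphere, and the
  derivative of the weight produces the radial component on the left.\<close>

lemma divergence_unif: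
  fixes F :: "'a::euclidean_space \<Rightarrow> 'a"
  assumes T: "cball 0 1 \<subseteq> T"
    and F: "\<And>y. y \<in> T \<Longrightarrow> (F has_derivative DF y) (at y)"
    and cont: "\<And>i. i \<in> Basis \<Longrightarrow> continuous_on T (\<lambda>y. DF y i \<bullet> i)"
  shows "(\<integral>y. F y \<bullet> y \<partial>unif) = (\<integral>y. (1 - y \<bullet> y) / 2 * (\<Sum>i\<in>Basis. DF y i \<bullet> i) \<partial>unif)"
proof -
  have Fc: "continuous_on (cball 0 1) F"
    using T F by (intro continuous_at_imp_continuous_on) (auto intro: has_derivative_continuous)
  have cc: "continuous_on (cball 0 1) (\<lambda>y. F y \<bullet> i)" for i
    by (intro continuous_intros Fc)
  have dc: "continuous_on (cball 0 1) (\<lambda>y. DF y i \<bullet> i)" if "i \<in> Basis" for i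
    by (rule continuous_on_subset[OF cont[OF that] T])
  have I1: "integrable unif (\<lambda>y. (y \<bullet> i) * (F y \<bullet> i))" for i
    by (intro integrable_unif_cont continuous_intros Fc)
  have I2: "integrable unif (\<lambda>y. (1 - y \<bullet> y) / 2 * (DF y i \<bullet> i))" if "i \<in> Basis" for i
    by (intro integrable_unif_cont continuous_intros dc[OF that]) simp
  have eq: "(\<integral>y. (1 - y \<bullet> y) / 2 * (DF y i \<bullet> i) \<partial>unif) = (\<integral>y. (y \<bullet> i) * (F y \<bullet> i) \<partial>unif)"
    if i: "i \<in> Basis" for i
  proof -
    have "(\<integral>y. (1 - y \<bullet> y) / 2 * (DF y i \<bullet> i) - (y \<bullet> i) * (F y \<bullet> i) \<partial>unif) = 0"
    proof (rule integral_unif_directional_derivative[OF _ cc dc[OF i]])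
      show "norm i = 1" using i by simp
      fix y :: 'a assume "norm y < 1"
      then have "y \<in> T" using T by (auto simp: subset_iff)
      then have "(F has_derivative DF y) (at (y + 0 *\<^sub>R i))" using F by simp
      note Fd = this
      have l: "((\<lambda>t. y + t *\<^sub>R i) has_derivative (\<lambda>t. t *\<^sub>R i)) (at 0)"
        by (auto intro!: derivative_eq_intros)
      have "((\<lambda>t. F (y + t *\<^sub>R i) \<bullet> i) has_derivative (\<lambda>t. DF y (t *\<^sub>R i) \<bullet> i)) (at 0)"
        by (rule has_derivative_inner_left[OF has_derivative_compose[OF l Fd]])
      moreover have "t * (DF y i \<bullet> i) = DF y (t *\<^sub>R i) \<bullet> i" for t
        using linear_scale[OF has_derivative_linear[OF Fd]] by simp
      ultimately show "((\<lambda>t. F (y + t *\<^sub>R i) \<bullet> i) has_real_derivative DF y i \<bullet> i) (at 0)"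
        by (rule has_derivative_imp_has_field_derivative)
    qed
    then show ?thesis using I1[of i] I2[OF i] by simp
  qed
  have "F y \<bullet> y = (\<Sum>i\<in>Basis. (y \<bullet> i) * (F y \<bullet> i))" for y
    by (subst euclidean_inner) (simp add: mult.commute)
  then have "(\<integral>y. F y \<bullet> y \<partial>unif) = (\<integral>y. (\<Sum>i\<in>Basis. (y \<bullet> i) * (F y \<bullet> i)) \<partial>unif)"
    by presburger
  also have "\<dots> = (\<Sum>i\<in>Basis. \<integral>y. (y \<bullet> i) * (F y \<bullet> i) \<partial>unif)"
    by (rule Bochner_Integration.integral_sum) (rule I1)
  also have "\<dots> = (\<Sum>i\<in>Basis. \<integral>y. (1 - y \<bullet> y) / 2 * (DF y i \<bullet> i) \<partial>unif)"
    by (rule sum.cong[OF refl]) (rule eq[symmetric])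
  also have "\<dots> = (\<integral>y. (\<Sum>i\<in>Basis. (1 - y \<bullet> y) / 2 * (DF y i \<bullet> i)) \<partial>unif)"
    by (rule Bochner_Integration.integral_sum[symmetric]) (rule I2)
  finally show ?thesis by (simp add: sum_distrib_left)
qed

text \<open>Gradient \<open>g\<close> and Hessian \<open>H\<close> are explicit data, so the
  Laplacian is the trace of \<open>H\<close> and can be computed algebraically for each concrete
  function.\<close>

definition C2_on :: "'a::euclidean_space set \<Rightarrow> ('a \<Rightarrow> real) \<Rightarrow> ('a \<Rightarrow> 'a) \<Rightarrow> ('a \<Rightarrow> 'a \<Rightarrow> 'a) \<Rightarrow> bool" where
  "C2_on S f g H \<longleftrightarrow> open S \<and> (\<forall>z\<in>S. (f has_derivative (\<lambda>h. g z \<bullet> h)) (at z)) \<and>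
     (\<forall>z\<in>S. (g has_derivative H z) (at z)) \<and>
     (\<forall>i\<in>Basis. \<forall>j\<in>Basis. continuous_on S (\<lambda>z. H z i \<bullet> j))"

text \<open>The derivative of the ball mean with respect to the radius is the mean of the radial
  derivative. By the divergence identity this is the mean of the Laplacian against a nonnegative
  weight, so the means decrease from their value \<open>f x\<close> at radius 0.\<close>

lemma mean_le_of_laplacian_le:
  fixes f :: "'a::euclidean_space \<Rightarrow> real"
  assumes C2: "C2_on S f g H" and r: "0 < r" "cball x r \<subseteq> S"
    and lap: "\<And>z. z \<in> S \<Longrightarrow> (\<Sum>i\<in>Basis. H z i \<bullet> i) \<le> 0"
  shows "(\<integral>y. f (x + r *\<^sub>R y) \<partial>unif) \<le> f x"
proof -
  have S: "open S" and f': "\<And>z. z \<in> S \<Longrightarrow> (f has_derivative (\<lambda>h. g z \<bullet> h)) (at z)"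
    and g': "\<And>z. z \<in> S \<Longrightarrow> (g has_derivative H z) (at z)"
    and Hc: "\<And>i. i \<in> Basis \<Longrightarrow> continuous_on S (\<lambda>z. H z i \<bullet> i)"
    using C2 by (auto simp: C2_on_def)
  \<comment> \<open>The larger radius makes both ends of \<open>{0..r}\<close> interior points of an
    open interval on which \<open>\<phi>\<close> is differentiable; negative radii take care of the
    end 0.\<close>
  obtain R where R: "r < R" "cball x R \<subseteq> S"
    using cball_subset_open_enlarge[OF S r(2)] r by auto
  have inS: "x + t *\<^sub>R y \<in> S" if "t \<in> {-R<..<R}" "norm y \<le> 1" for t y
  proof -
    have "\<bar>t\<bar> * norm y \<le> R * 1" using that R r by (intro mult_mono) auto
    then have "x + t *\<^sub>R y \<in> cball x R" by (simp add: dist_norm)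
    then show ?thesis using R by blast
  qed
  have fc: "continuous_on S f" and gc: "continuous_on S g"
    using f' g' by (auto intro!: continuous_at_imp_continuous_on intro: has_derivative_continuous)
  have line: "continuous_on (cball 0 1) (\<lambda>y. f (x + t *\<^sub>R y))" "continuous_on (cball 0 1) (\<lambda>y. g (x + t *\<^sub>R y))"
    if "t \<in> {-R<..<R}" for t
    using inS[OF that] by (auto intro!: continuous_on_compose2[OF fc] continuous_on_compose2[OF gc] continuous_intros)
  have "bounded (g ` cball x R)"
    by (intro compact_imp_bounded compact_continuous_image continuous_on_subset[OF gc R(2)] compact_cball)
  then obtain B where B: "\<And>z. z \<in> cball x R \<Longrightarrow> norm (g z) \<le> B"
    unfolding bounded_iff by blast
  define \<phi> where "\<phi> t = (\<integral>y. f (x + t *\<^sub>R y) \<partial>unif)" for t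
  have der: "(\<phi> has_real_derivative (\<integral>y. g (x + s *\<^sub>R y) \<bullet> y \<partial>unif)) (at s)" if s: "s \<in> {-R<..<R}" for s
    unfolding \<phi>_def
  proof (rule has_real_derivative_integral[OF finite_measure_unif _ _ s, where B=B and F'="\<lambda>t y. g (x + t *\<^sub>R y) \<bullet> y"])
    show "integrable unif (\<lambda>y. f (x + t *\<^sub>R y))" if "t \<in> {-R<..<R}" for t
      by (rule integrable_unif_cont[OF line(1)[OF that]])
    show "(\<lambda>y. g (x + s *\<^sub>R y) \<bullet> y) \<in> borel_measurable unif"
      by (intro borel_measurable_unifI continuous_on_inner continuous_on_id continuous_on_subset[OF line(2)[OF s] ball_subset_cball])
    fix t and y :: 'a assume t: "t \<in> {-R<..<R}" and y: "y \<in> space unif"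
    have z: "x + t *\<^sub>R y \<in> S" using inS[OF t] y by simp
    have l: "((\<lambda>t. x + t *\<^sub>R y) has_derivative (\<lambda>h. h *\<^sub>R y)) (at t)"
      by (auto intro!: derivative_eq_intros)
    show "((\<lambda>t. f (x + t *\<^sub>R y)) has_real_derivative g (x + t *\<^sub>R y) \<bullet> y) (at t)"
      by (rule has_derivative_imp_has_field_derivative[OF has_derivative_compose[OF l f'[OF z]]]) simp
    have "\<bar>t\<bar> * norm y \<le> R * 1" using t y R r by (intro mult_mono) auto
    then have "norm (g (x + t *\<^sub>R y)) \<le> B" by (intro B) (simp add: dist_norm)
    then have "norm (g (x + t *\<^sub>R y)) * norm y \<le> B * 1" using y order_trans[OF norm_ge_zero] by (intro mult_mono) auto
    then show "\<bar>g (x + t *\<^sub>R y) \<bullet> y\<bar> \<le> B"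
      using Cauchy_Schwarz_ineq2[of "g (x + t *\<^sub>R y)" y] by linarith
  qed auto
  have neg: "(\<integral>y. g (x + s *\<^sub>R y) \<bullet> y \<partial>unif) \<le> 0" if s: "0 \<le> s" "s < R" for s
  proof -
    define T where "T = (\<lambda>y. x + s *\<^sub>R y) -` S"
    have T: "cball 0 1 \<subseteq> T" using inS[of s] s by (auto simp: T_def)
    have lin: "H z (c *\<^sub>R h) = c *\<^sub>R H z h" if "z \<in> S" for z c h
      using has_derivative_linear[OF g'[OF that]] by (rule linear_scale)
    have "(\<integral>y. g (x + s *\<^sub>R y) \<bullet> y \<partial>unif) =
      (\<integral>y. (1 - y \<bullet> y) / 2 * (\<Sum>i\<in>Basis. H (x + s *\<^sub>R y) (s *\<^sub>R i) \<bullet> i) \<partial>unif)"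
    proof (rule divergence_unif[OF T])
      show "((\<lambda>y. g (x + s *\<^sub>R y)) has_derivative (\<lambda>h. H (x + s *\<^sub>R y) (s *\<^sub>R h))) (at y)" if "y \<in> T" for y
      proof (rule has_derivative_compose[OF _ g'])
        show "((\<lambda>y. x + s *\<^sub>R y) has_derivative (\<lambda>h. s *\<^sub>R h)) (at y)"
          by (auto intro!: derivative_eq_intros)
      qed (use that in \<open>simp add: T_def\<close>)
      fix i :: 'a assume i: "i \<in> Basis"
      have "continuous_on T (\<lambda>y. s * (H (x + s *\<^sub>R y) i \<bullet> i))"
        by (intro continuous_intros continuous_on_compose2[OF Hc[OF i]]) (auto simp: T_def)
      then show "continuous_on T (\<lambda>y. H (x + s *\<^sub>R y) (s *\<^sub>R i) \<bullet> i)"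
        by (rule continuous_on_eq) (simp add: T_def lin)
    qed
    also have "\<dots> \<le> (\<integral>y. 0 \<partial>(unif::'a measure))"
    proof (rule Bochner_Integration.integral_mono_AE')
      show "AE y in unif. (1 - y \<bullet> y) / 2 * (\<Sum>i\<in>Basis. H (x + s *\<^sub>R y) (s *\<^sub>R i) \<bullet> i) \<le> 0"
      proof (rule AE_I2)
        fix y :: 'a assume "y \<in> space unif"
        then have y: "norm y < 1" by simp
        have z: "x + s *\<^sub>R y \<in> S" using inS[of s y] s y by auto
        have "(\<Sum>i\<in>Basis. H (x + s *\<^sub>R y) (s *\<^sub>R i) \<bullet> i) = s * (\<Sum>i\<in>Basis. H (x + s *\<^sub>R y) i \<bullet> i)"
          by (simp add: lin[OF z] sum_distrib_left)
        also have "\<dots> \<le> 0" using lap[OF z] s by (simp add: mult_nonneg_nonpos)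
        finally show "(1 - y \<bullet> y) / 2 * (\<Sum>i\<in>Basis. H (x + s *\<^sub>R y) (s *\<^sub>R i) \<bullet> i) \<le> 0"
          using y by (intro mult_nonneg_nonpos) (auto simp: dot_square_norm power_le_one)
      qed
    qed auto
    finally show ?thesis by simp
  qed
  have "\<phi> r \<le> \<phi> 0"
    by (rule DERIV_nonpos_imp_nonincreasing[OF less_imp_le[OF r(1)]])
      (use R r in \<open>auto intro!: exI[of _ "\<integral>y. g (x + _ *\<^sub>R y) \<bullet> y \<partial>unif"] der neg\<close>)
  then show ?thesis by (simp add: \<phi>_def)
qed

lemma C2_on_minus: "C2_on S f g H \<Longrightarrow> C2_on S (\<lambda>z. c - f z) (\<lambda>z. - g z) (\<lambda>z h. - H z h)"
  unfolding C2_on_def by (auto intro!: derivative_eq_intros continuous_on_minus simp: inner_minus_left)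

lemma mean_eq_of_laplacian_eq:
  fixes f :: "'a::euclidean_space \<Rightarrow> real"
  assumes C2: "C2_on S f g H" and r: "0 < r" "cball x r \<subseteq> S"
    and lap: "\<And>z. z \<in> S \<Longrightarrow> (\<Sum>i\<in>Basis. H z i \<bullet> i) = 0"
  shows "(\<integral>y. f (x + r *\<^sub>R y) \<partial>unif) = f x"
proof (rule antisym)
  show "(\<integral>y. f (x + r *\<^sub>R y) \<partial>unif) \<le> f x"
    by (rule mean_le_of_laplacian_le[OF C2 r]) (simp add: lap)
  have "(\<integral>y. 0 - f (x + r *\<^sub>R y) \<partial>unif) \<le> 0 - f x"
    by (rule mean_le_of_laplacian_le[OF C2_on_minus[OF C2] r]) (simp add: lap sum_negf)
  then show "f x \<le> (\<integral>y. f (x + r *\<^sub>R y) \<partial>unif)" by simp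
qed

section \<open>Harmonic functions and their derivative data\<close>

lemma harmonic_onD_C2:
  assumes "harmonic_on D f"
  shows "C2_on D f (grad f) (\<lambda>x. frechet_derivative (grad f) (at x))"
    and "x \<in> D \<Longrightarrow> (\<Sum>i\<in>Basis. frechet_derivative (grad f) (at x) i \<bullet> i) = 0"
proof -
  have "open D" and fd: "f differentiable_on D" and gd: "\<forall>x\<in>D. grad f differentiable (at x)"
    using assms by (auto simp: harmonic_on_def)
  have "(f has_derivative (\<lambda>h. grad f z \<bullet> h)) (at z)" if "z \<in> D" for z
  proof -
    have "f differentiable (at z)"
      using fd that \<open>open D\<close> by (simp add: differentiable_on_eq_differentiable_at)
    then have d: "(f has_derivative frechet_derivative f (at z)) (at z)"
      by (simp add: frechet_derivative_works)
    have "frechet_derivative f (at z) = (\<lambda>h. grad f z \<bullet> h)"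
    proof
      fix h
      have "frechet_derivative f (at z) h = frechet_derivative f (at z) (\<Sum>i\<in>Basis. (h \<bullet> i) *\<^sub>R i)"
        by (simp add: euclidean_representation)
      also have "\<dots> = (\<Sum>i\<in>Basis. (h \<bullet> i) *\<^sub>R frechet_derivative f (at z) i)"
        using has_derivative_linear[OF d] by (simp add: linear_sum linear_scale)
      also have "\<dots> = grad f z \<bullet> h"
        by (simp add: grad_def inner_sum_left inner_commute[of h] mult.commute)
      finally show "frechet_derivative f (at z) h = grad f z \<bullet> h" .
    qed
    then show ?thesis using d by simp
  qed
  then show "C2_on D f (grad f) (\<lambda>x. frechet_derivative (grad f) (at x))"
    using assms \<open>open D\<close> gd by (auto simp: C2_on_def harmonic_on_def frechet_derivative_works)
  show "x \<in> D \<Longrightarrow> (\<Sum>i\<in>Basis. frechet_derivative (grad f) (at x) i \<bullet> i) = 0"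
    using assms by (simp add: harmonic_on_def)
qed

lemma grad_eqI: "(f has_derivative (\<lambda>h. g \<bullet> h)) (at x) \<Longrightarrow> grad f x = g"
  by (drule frechet_derivative_at[symmetric]) (simp add: grad_def euclidean_representation)

lemma harmonic_onI_C2:
  assumes C2: "C2_on D f g H" and lap: "\<And>z. z \<in> D \<Longrightarrow> (\<Sum>i\<in>Basis. H z i \<bullet> i) = 0"
  shows "harmonic_on D f" "\<And>z. z \<in> D \<Longrightarrow> grad f z = g z"
proof -
  have D: "open D" and f': "\<And>z. z \<in> D \<Longrightarrow> (f has_derivative (\<lambda>h. g z \<bullet> h)) (at z)"
    and g': "\<And>z. z \<in> D \<Longrightarrow> (g has_derivative H z) (at z)"
    and Hc: "\<And>i j. i \<in> Basis \<Longrightarrow> j \<in> Basis \<Longrightarrow> continuous_on D (\<lambda>z. H z i \<bullet> j)"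
    using C2 by (auto simp: C2_on_def)
  show gr: "grad f z = g z" if "z \<in> D" for z using f'[OF that] by (rule grad_eqI)
  have gd: "(grad f has_derivative H z) (at z)" if "z \<in> D" for z
    using g'[OF that] D that by (rule has_derivative_transform_within_open) (simp add: gr)
  have fr: "frechet_derivative (grad f) (at z) = H z" if "z \<in> D" for z
    using frechet_derivative_at[OF gd[OF that]] by simp
  show "harmonic_on D f"
    unfolding harmonic_on_def
  proof (intro conjI ballI)
    show "f differentiable_on D"
      using f' by (meson differentiableI differentiable_at_imp_differentiable_on)
    show "grad f differentiable at x" if "x \<in> D" for x
      using gd[OF that] by (rule differentiableI)
    show "continuous_on D (\<lambda>x. frechet_derivative (grad f) (at x) i \<bullet> j)" if "i \<in> Basis" "j \<in> Basis" for i j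
      by (rule continuous_on_eq[OF Hc[OF that]]) (simp add: fr)
  qed (simp_all add: D fr lap)
qed

subsection \<open>Poisson kernels of balls\<close>

text \<open>The sum of a dipole at \<open>y\<close> in direction \<open>b\<close> and of
  \<open>- |x - y|^(2 - n)\<close>, both harmonic off \<open>y\<close> in every dimension
  \<open>n\<close>. For \<open>b = c - y\<close> it is, up to a constant factor, the Poisson kernel
  of the ball around \<open>c\<close> whose sphere passes through \<open>y\<close>. Writing it in
  \<open>x - y\<close> alone leaves a single singularity to differentiate around.\<close>

definition pole_kernel :: "'a::euclidean_space \<Rightarrow> 'a \<Rightarrow> 'a \<Rightarrow> real" where
  "pole_kernel b y x = (2 * ((x - y) \<bullet> b) - (x - y) \<bullet> (x - y)) / norm (x - y) ^ DIM('a)"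

lemma has_derivative_inner_self_powr:
  fixes y :: "'a::euclidean_space"
  assumes "x \<noteq> y"
  shows "((\<lambda>x. ((x - y) \<bullet> (x - y)) powr a) has_derivative
    (\<lambda>h. 2 * a * ((x - y) \<bullet> (x - y)) powr (a - 1) * ((x - y) \<bullet> h))) (at x)"
proof -
  have S: "((\<lambda>x. (x - y) \<bullet> (x - y)) has_derivative (\<lambda>h. 2 * ((x - y) \<bullet> h))) (at x)"
    by (auto intro!: derivative_eq_intros simp: inner_commute)
  have P: "((\<lambda>s. s powr a) has_derivative (*) (a * ((x - y) \<bullet> (x - y)) powr (a - 1))) (at ((x - y) \<bullet> (x - y)))"
    by (rule has_field_derivative_imp_has_derivative[OF has_real_derivative_powr]) (use assms in simp)
  show ?thesis
    by (rule has_derivative_eq_rhs[OF has_derivative_compose[OF S P]]) (simp add: fun_eq_iff)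
qed

lemma trace_inner_products:
  fixes b z :: "'a::euclidean_space"
  shows "(\<Sum>i\<in>Basis. (z \<bullet> i) * (b \<bullet> i)) = z \<bullet> b" "(\<Sum>i\<in>(Basis::'a set). i \<bullet> i) = DIM('a)"
  by (simp_all add: euclidean_inner[of z b])

lemma pole_kernel_C2:
  fixes b y :: "'a::euclidean_space"
  obtains g H where "C2_on (- {y}) (pole_kernel b y) g H"
    and "\<forall>x. x \<noteq> y \<longrightarrow> (\<Sum>i\<in>Basis. H x i \<bullet> i) = 0"
proof -
  define a where "a = - real DIM('a) / 2"
  define N where "N x = 2 * ((x - y) \<bullet> b) - (x - y) \<bullet> (x - y)" for x
  define P where "P e x = ((x - y) \<bullet> (x - y)) powr e" for e x
  define g where "g x = P a x *\<^sub>R (2 *\<^sub>R b - 2 *\<^sub>R (x - y)) + (2 * a * N x * P (a - 1) x) *\<^sub>R (x - y)" for x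
  define H where "H x h = (2 * a * P (a - 1) x * ((x - y) \<bullet> h)) *\<^sub>R (2 *\<^sub>R b - 2 *\<^sub>R (x - y))
      - (2 * P a x) *\<^sub>R h
      + (2 * a * ((2 * (h \<bullet> b) - 2 * ((x - y) \<bullet> h)) * P (a - 1) x
          + N x * (2 * (a - 1) * P (a - 2) x * ((x - y) \<bullet> h)))) *\<^sub>R (x - y)
      + (2 * a * N x * P (a - 1) x) *\<^sub>R h" for x h
  have Pd: "(P e has_derivative (\<lambda>h. 2 * e * P (e - 1) x * ((x - y) \<bullet> h))) (at x)" if "x \<noteq> y" for x e
    unfolding P_def by (rule has_derivative_inner_self_powr[OF that])
  have Nd: "(N has_derivative (\<lambda>h. 2 * (h \<bullet> b) - 2 * ((x - y) \<bullet> h))) (at x)" for x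
    unfolding N_def by (auto intro!: derivative_eq_intros simp: inner_commute)
  have fe: "pole_kernel b y x = N x * P a x" if "x \<noteq> y" for x
  proof -
    have "P a x = (norm (x - y)) powr (- real DIM('a))"
      by (simp add: P_def a_def dot_square_norm powr_powr flip: powr_numeral)
    also have "\<dots> = 1 / norm (x - y) ^ DIM('a)"
      using that by (simp add: powr_minus powr_realpow divide_inverse)
    finally show ?thesis by (simp add: pole_kernel_def N_def)
  qed
  have "((\<lambda>x. N x * P a x) has_derivative (\<lambda>h. g x \<bullet> h)) (at x)" if "x \<noteq> y" for x
    by (rule has_derivative_eq_rhs[OF has_derivative_mult[OF Nd Pd[OF that]]])
      (simp add: fun_eq_iff g_def inner_diff_left inner_add_left inner_commute algebra_simps)
  then have f': "(pole_kernel b y has_derivative (\<lambda>h. g x \<bullet> h)) (at x)" if "x \<noteq> y" for x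
    by (rule has_derivative_transform_within_open[of _ _ _ UNIV "- {y}"]) (use that fe in auto)
  have g': "(g has_derivative H x) (at x)" if x: "x \<noteq> y" for x
    unfolding g_def H_def
    by (rule has_derivative_eq_rhs, (rule derivative_eq_intros Pd[OF x] Nd refl)+)
      (simp add: fun_eq_iff algebra_simps)
  have Pc: "continuous_on (- {y}) (P e)" for e
    unfolding P_def by (intro continuous_intros) auto
  have Hc: "continuous_on (- {y}) (\<lambda>x. H x i \<bullet> j)" for i j
    unfolding H_def N_def by (intro continuous_intros Pc)
  have "C2_on (- {y}) (pole_kernel b y) g H"
    unfolding C2_on_def using f' g' Hc by auto
  moreover have "(\<Sum>i\<in>Basis. H x i \<bullet> i) = 0" if x: "x \<noteq> y" for x
  proof -
    define s where "s = (x - y) \<bullet> (x - y)"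
    have s: "s > 0" using x by (simp add: s_def)
    \<comment> \<open>Reducing all powers to \<open>P (a - 2)\<close> turns the vanishing of the
      trace into a polynomial identity, in which the dimension enters through
      \<open>DIM('a) = - 2 * a\<close>.\<close>
    have P1: "P a x = s * P (a - 1) x" and P2: "P (a - 1) x = s * P (a - 2) x"
      using s powr_add[of s 1 "a - 1"] powr_add[of s 1 "a - 2"] by (simp_all add: P_def s_def)
    have "(\<Sum>i\<in>Basis. H x i \<bullet> i) =
        (\<Sum>i\<in>Basis. 2 * a * P (a - 1) x * (2 * (((x - y) \<bullet> i) * (b \<bullet> i)) - 2 * (((x - y) \<bullet> i) * ((x - y) \<bullet> i)))
          - 2 * P a x * (i \<bullet> i)
          + 2 * a * P (a - 1) x * (2 * (((x - y) \<bullet> i) * (b \<bullet> i)) - 2 * (((x - y) \<bullet> i) * ((x - y) \<bullet> i)))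
          + 2 * a * N x * (2 * (a - 1) * P (a - 2) x) * (((x - y) \<bullet> i) * ((x - y) \<bullet> i))
          + 2 * a * N x * P (a - 1) x * (i \<bullet> i))"
      by (rule sum.cong[OF refl])
        (simp add: H_def inner_diff_left inner_add_left inner_commute algebra_simps)
    also have "\<dots> = 2 * a * P (a - 1) x * (2 * ((x - y) \<bullet> b) - 2 * s) - 2 * P a x * DIM('a)
          + 2 * a * P (a - 1) x * (2 * ((x - y) \<bullet> b) - 2 * s)
          + 2 * a * N x * (2 * (a - 1) * P (a - 2) x) * s + 2 * a * N x * P (a - 1) x * DIM('a)"
      by (simp only: sum.distrib sum_subtractf sum_distrib_left[symmetric] trace_inner_products s_def)
    also have "\<dots> = 0"
    proof -
      have alg: "2 * a * (s * q) * (2 * w - 2 * s) - 2 * (s * (s * q)) * n + 2 * a * (s * q) * (2 * w - 2 * s)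
          + 2 * a * (2 * w - s) * (2 * (a - 1) * q) * s + 2 * a * (2 * w - s) * (s * q) * n = 0"
        if "n = - 2 * a" for n q w :: real
        unfolding that by algebra
      have Nx: "N x = 2 * ((x - y) \<bullet> b) - s" by (simp add: N_def s_def)
      show ?thesis unfolding P1 P2 Nx by (rule alg) (simp add: a_def)
    qed
    finally show ?thesis .
  qed
  ultimately show ?thesis using that by blast
qed

lemma pole_kernel_mean:
  fixes b y :: "'a::euclidean_space"
  assumes "0 < r" "y \<notin> cball x r"
  shows "(\<integral>z. pole_kernel b y (x + r *\<^sub>R z) \<partial>unif) = pole_kernel b y x"
proof -
  obtain g H where C2: "C2_on (- {y}) (pole_kernel b y) g H"
    and lap: "\<forall>x. x \<noteq> y \<longrightarrow> (\<Sum>i\<in>Basis. H x i \<bullet> i) = 0"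
    by (rule pole_kernel_C2[where b=b and y=y])
  show ?thesis
    by (rule mean_eq_of_laplacian_eq[OF C2 assms(1)]) (use assms lap in auto)
qed

lemma pole_kernel_harmonic:
  fixes b y :: "'a::euclidean_space"
  assumes "open D" "y \<notin> D"
  shows "harmonic_on D (pole_kernel b y)" "harmonic_on D (\<lambda>x. c - pole_kernel b y x)"
    and "x \<in> D \<Longrightarrow> grad (\<lambda>x. c - pole_kernel b y x) x = - grad (pole_kernel b y) x"
proof -
  obtain g H where "C2_on (- {y}) (pole_kernel b y) g H"
    and lap: "\<forall>x. x \<noteq> y \<longrightarrow> (\<Sum>i\<in>Basis. H x i \<bullet> i) = 0"
    by (rule pole_kernel_C2[where b=b and y=y])
  then have C2: "C2_on D (pole_kernel b y) g H"
    using assms unfolding C2_on_def by (auto intro: continuous_on_subset[of "- {y}" _ D])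
  have lap': "z \<in> D \<Longrightarrow> (\<Sum>i\<in>Basis. H z i \<bullet> i) = 0" for z using lap assms(2) by (cases "z = y") auto
  have lap'': "z \<in> D \<Longrightarrow> (\<Sum>i\<in>Basis. - H z i \<bullet> i) = 0" for z using lap' by (simp add: sum_negf)
  note a = harmonic_onI_C2[OF C2 lap'] and b = harmonic_onI_C2[OF C2_on_minus[OF C2] lap'']
  show "harmonic_on D (pole_kernel b y)" "harmonic_on D (\<lambda>x. c - pole_kernel b y x)"
    using a(1) b(1) by auto
  show "x \<in> D \<Longrightarrow> grad (\<lambda>x. c - pole_kernel b y x) x = - grad (pole_kernel b y) x"
    using a(2) b(2) by simp
qed

lemma pole_kernel_sphere:
  fixes c x y :: "'a::euclidean_space"
  assumes "dist c y = \<rho>"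
  shows "pole_kernel (c - y) y x = (\<rho>\<^sup>2 - (dist c x)\<^sup>2) / dist x y ^ DIM('a)"
proof -
  have "2 * ((x - y) \<bullet> (c - y)) - (x - y) \<bullet> (x - y) = (c - y) \<bullet> (c - y) - (c - x) \<bullet> (c - x)"
    by (simp add: algebra_simps inner_commute)
  then show ?thesis using assms by (simp add: pole_kernel_def dist_norm dot_square_norm)
qed

lemma continuous_on_pole_kernel: "continuous_on (- {y}) (pole_kernel b y)"
  unfolding pole_kernel_def by (intro continuous_intros) auto

subsection \<open>Averages over spheres\<close>

text \<open>The default unit vector at 0 makes \<open>dirn\<close> take values in the sphere
  everywhere. The image of \<open>unif\<close> under \<open>dirn\<close> plays the role of
  normalised surface measure; in dimension one it is the mean over the two end points.\<close>

definition dirn :: "'a::euclidean_space \<Rightarrow> 'a" where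
  "dirn y = (if y = 0 then (SOME i. i \<in> Basis) else sgn y)"

lemma norm_dirn [simp]: "norm (dirn y) = 1"
proof (cases "y = 0")
  case True
  have "(SOME i. i \<in> (Basis::'a set)) \<in> Basis" by (rule someI_ex) (use nonempty_Basis in blast)
  then show ?thesis using True by (simp add: dirn_def)
qed (simp add: dirn_def norm_sgn)

lemma dirn_scale: "0 < s \<Longrightarrow> dirn (s *\<^sub>R y) = dirn y"
  by (simp add: dirn_def sgn_scaleR)

lemma norm_scale_dirn: "norm y *\<^sub>R dirn y = y"
  by (simp add: dirn_def sgn_div_norm)

lemma dirn_measurable [measurable]: "dirn \<in> borel_measurable borel"
  unfolding dirn_def sgn_div_norm by measurable

lemma borel_measurable_dirn_comp:
  fixes \<phi> :: "'a::euclidean_space \<Rightarrow> 'b::topological_space"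
  assumes "continuous_on (sphere 0 1) \<phi>"
  shows "(\<lambda>y. \<phi> (dirn y)) \<in> borel_measurable borel"
proof -
  have "dirn \<in> measurable borel (restrict_space borel (sphere (0::'a) 1))"
    by (intro measurable_restrict_space2) auto
  from measurable_compose[OF this borel_measurable_continuous_on_restrict[OF assms]] show ?thesis .
qed

lemma integrable_dirn_comp:
  fixes \<phi> :: "'a::euclidean_space \<Rightarrow> real"
  assumes "continuous_on (sphere 0 1) \<phi>"
  shows "integrable unif (\<lambda>y. \<phi> (dirn y))"
proof -
  have "bounded (\<phi> ` sphere 0 1)"
    by (intro compact_imp_bounded compact_continuous_image assms) simp
  then obtain B where "\<forall>z\<in>\<phi> ` sphere 0 1. norm z \<le> B" unfolding bounded_iff by blast
  then show ?thesis
    by (intro integrable_unif[where B=B] borel_measurable_unif_borelI borel_measurable_dirn_comp assms) auto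
qed

lemma borel_measurable_indicator_unif:
  "(\<lambda>y::'a::euclidean_space. indicator (ball 0 s) y :: real) \<in> borel_measurable unif"
  "(\<lambda>y::'a::euclidean_space. indicator {p..<q} (norm y) :: real) \<in> borel_measurable unif"
  by (rule borel_measurable_unif_borelI, measurable, simp)
    (rule borel_measurable_unif_borelI, measurable)

lemma integrable_unif_const [simp]: "integrable unif (\<lambda>_::'a::euclidean_space. c::real)"
  by (rule finite_measure.integrable_const[OF finite_measure_unif])

lemma integrable_unif_mult:
  fixes G b :: "'a::euclidean_space \<Rightarrow> real"
  assumes G: "integrable unif G" and b: "b \<in> borel_measurable unif" "\<And>y. \<bar>b y\<bar> \<le> 1"
  shows "integrable unif (\<lambda>y. b y * G y)"
proof (rule Bochner_Integration.integrable_bound[OF G])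
  show "(\<lambda>y. b y * G y) \<in> borel_measurable unif"
    by (rule borel_measurable_times[OF b(1) borel_measurable_integrable[OF G]])
  show "AE y in unif. norm (b y * G y) \<le> norm (G y)"
    using b(2) by (intro AE_I2) (simp add: abs_mult mult_le_cancel_right1 mult_left_le_one_le)
qed

lemma integral_unif_subball:
  fixes G :: "'a::euclidean_space \<Rightarrow> real"
  assumes G: "G \<in> borel_measurable unif" and s: "0 < s" "s \<le> 1"
  shows "(\<integral>y. indicator (ball 0 s) y * G y \<partial>unif) = s ^ DIM('a) * (\<integral>y. G (s *\<^sub>R y) \<partial>unif)"
proof -
  have "(\<lambda>y. s *\<^sub>R y) \<in> measurable unif (unif :: 'a measure)"
    unfolding measurable_cong_sets[OF sets_unif sets_unif]
  proof (rule measurable_restrict_space3)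
    show "(\<lambda>y. s *\<^sub>R y) \<in> ball 0 1 \<rightarrow> ball (0::'a) 1"
      using s by (auto simp: Pi_def intro: le_less_trans[OF mult_right_mono[of s 1]])
  qed measurable
  then have m1: "(\<lambda>y. G (s *\<^sub>R y)) \<in> borel_measurable unif"
    using G by (rule measurable_compose)
  have m2: "(\<lambda>y. indicator (ball 0 s) y * G y) \<in> borel_measurable unif"
    by (intro borel_measurable_times borel_measurable_indicator_unif G)
  have "(\<integral>y. indicator (ball 0 s) y * G y \<partial>unif) =
      1 / bvol TYPE('a) * (\<integral>y. indicator (ball 0 1) y * (indicator (ball 0 s) y * G y) \<partial>lborel)"
    using integral_unif[OF m2] by simp
  also have "\<dots> = 1 / bvol TYPE('a) * (s ^ DIM('a) *
      (\<integral>y. indicator (ball 0 1) (s *\<^sub>R y) * (indicator (ball 0 s) (s *\<^sub>R y) * G (s *\<^sub>R y)) \<partial>lborel))"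
    using lborel_integral_affine[of s "\<lambda>y. indicator (ball 0 1) y * (indicator (ball 0 s) y * G y)" 0] s by simp
  also have "(\<lambda>y. indicator (ball 0 1) (s *\<^sub>R y) * (indicator (ball 0 s) (s *\<^sub>R y) * G (s *\<^sub>R y))) =
      (\<lambda>y. indicator (ball 0 1) y *\<^sub>R G (s *\<^sub>R y))"
  proof
    fix y :: 'a
    have "s * norm y < 1" if "norm y < 1" using that s by (auto intro: le_less_trans[OF mult_right_mono[of s 1]])
    then show "indicator (ball 0 1) (s *\<^sub>R y) * (indicator (ball 0 s) (s *\<^sub>R y) * G (s *\<^sub>R y)) = indicator (ball 0 1) y *\<^sub>R G (s *\<^sub>R y)"
      using s by (auto simp: indicator_def)
  qed
  finally show ?thesis using integral_unif[OF m1] by simp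
qed

text \<open>Polar coordinates in a weak form: a function of \<open>dirn y\<close> is invariant under
  scaling, so it sees every centred ball through its volume fraction alone, and a shell is a
  difference of two balls.\<close>

lemma integral_unif_shell:
  fixes \<phi> :: "'a::euclidean_space \<Rightarrow> real"
  assumes \<phi>: "continuous_on (sphere 0 1) \<phi>" and pq: "0 \<le> p" "p \<le> q" "0 < q" "q \<le> 1"
  shows "(\<integral>y. indicator {p..<q} (norm y) * \<phi> (dirn y) \<partial>unif) =
    (q ^ DIM('a) - p ^ DIM('a)) * (\<integral>y. \<phi> (dirn y) \<partial>unif)"
proof -
  note m = borel_measurable_unif_borelI[OF borel_measurable_dirn_comp[OF \<phi>]]
  note int = integrable_dirn_comp[OF \<phi>]
  have sub: "(\<integral>y. indicator (ball 0 s) y * \<phi> (dirn y) \<partial>unif) = s ^ DIM('a) * (\<integral>y. \<phi> (dirn y) \<partial>unif)"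
    if "0 \<le> s" "s \<le> 1" for s
  proof (cases "s = 0")
    case False
    then show ?thesis using integral_unif_subball[OF m, of s] that by (simp add: dirn_scale)
  qed simp
  have I: "integrable unif (\<lambda>y. indicator (ball 0 s) y * \<phi> (dirn y))" for s
    by (rule integrable_unif_mult[OF int borel_measurable_indicator_unif(1)]) (simp add: indicator_def)
  have "indicator {p..<q} (norm y) * \<phi> (dirn y) =
      indicator (ball 0 q) y * \<phi> (dirn y) - indicator (ball 0 p) y * \<phi> (dirn y)" for y :: 'a
    using pq by (auto simp: indicator_def)
  then have "(\<integral>y. indicator {p..<q} (norm y) * \<phi> (dirn y) \<partial>unif) =
      (\<integral>y. indicator (ball 0 q) y * \<phi> (dirn y) \<partial>unif) - (\<integral>y. indicator (ball 0 p) y * \<phi> (dirn y) \<partial>unif)"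
    using I by simp
  then show ?thesis using sub[of q] sub[of p] pq by (simp add: left_diff_distrib)
qed

lemma continuous_on_cball_dirn:
  fixes f :: "'a::euclidean_space \<Rightarrow> real"
  assumes f: "continuous_on (cball x t) f" and s: "0 \<le> s" "s \<le> t"
  shows "continuous_on (sphere 0 1) (\<lambda>\<theta>. f (x + s *\<^sub>R \<theta>))" "continuous_on (cball 0 1) (\<lambda>y. f (x + s *\<^sub>R y))"
  using s by (auto intro!: continuous_on_compose2[OF f] continuous_intros simp: dist_norm
      intro: order_trans[OF mult_left_le])

text \<open>On a thin shell below the unit sphere, \<open>y\<close> and \<open>dirn y\<close> are so
  close that uniform continuity makes the two integrands differ by at most \<open>e\<close>. The
  integrals over the shell are explicit, \<open>(1 - q ^ n) * a\<close> from the ball means and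
  \<open>(1 - q ^ n) * m\<close> by scaling, so the factor cancels.\<close>

lemma sphere_mean_eq_of_ball_means:
  fixes f :: "'a::euclidean_space \<Rightarrow> real"
  assumes f: "continuous_on (cball x t) f" and t: "0 < t"
    and ball: "\<And>s. 0 < s \<Longrightarrow> s \<le> t \<Longrightarrow> (\<integral>y. f (x + s *\<^sub>R y) \<partial>unif) = a"
  shows "(\<integral>y. f (x + t *\<^sub>R dirn y) \<partial>unif) = a"
proof -
  define m where "m = (\<integral>y. f (x + t *\<^sub>R dirn y) \<partial>unif)"
  note c = continuous_on_cball_dirn[OF f less_imp_le[OF t] order_refl]
  note I1 = integrable_dirn_comp[OF c(1)] and I2 = integrable_unif_cont[OF c(2)]
  note m1 = borel_measurable_integrable[OF I1] and m2 = borel_measurable_integrable[OF I2]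
  have le: "\<bar>a - m\<bar> \<le> e" if e: "0 < e" for e
  proof -
    have "uniformly_continuous_on (cball x t) f"
      by (rule compact_uniformly_continuous[OF f]) simp
    then obtain d where d: "d > 0"
      "\<And>z w. z \<in> cball x t \<Longrightarrow> w \<in> cball x t \<Longrightarrow> dist w z < d \<Longrightarrow> dist (f w) (f z) < e"
      unfolding uniformly_continuous_on_def using e by metis
    \<comment> \<open>The second entry gives \<open>t * (1 - q) \<le> d / 2\<close>; the first keeps
      \<open>q\<close> positive when \<open>d\<close> is large.\<close>
    define q where "q = max (1/2) (1 - d / (2 * t))"
    have q: "0 < q" "q < 1" "t * (1 - q) < d"
      using d t by (auto simp: q_def max_def field_simps)
    define n where "n = DIM('a)"
    have qn: "q ^ n < 1" using q by (simp add: n_def power_less_one_iff)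
    have close: "\<bar>f (x + t *\<^sub>R y) - f (x + t *\<^sub>R dirn y)\<bar> \<le> e" if y: "q \<le> norm y" "norm y < 1" for y
    proof -
      have "(x + t *\<^sub>R y) - (x + t *\<^sub>R dirn y) = (t * (norm y - 1)) *\<^sub>R dirn y"
        using norm_scale_dirn[of y] by (simp add: algebra_simps flip: scaleR_scaleR)
      then have "dist (x + t *\<^sub>R y) (x + t *\<^sub>R dirn y) = t * (1 - norm y)"
        using t y by (simp add: dist_norm abs_mult)
      also have "\<dots> \<le> t * (1 - q)" using t y by (intro mult_left_mono) auto
      finally have "dist (x + t *\<^sub>R y) (x + t *\<^sub>R dirn y) < d" using q by simp
      then have "dist (f (x + t *\<^sub>R y)) (f (x + t *\<^sub>R dirn y)) < e"
        using t y by (intro d(2)) (auto simp: dist_norm)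
      then show ?thesis by (simp add: dist_real_def)
    qed
    define b where "b y = (indicator (ball 0 q) y :: real)" for y :: 'a
    have bm: "b \<in> borel_measurable unif" unfolding b_def by (rule borel_measurable_indicator_unif)
    have b01: "0 \<le> b y" "b y \<le> 1" for y by (auto simp: b_def indicator_def)
    have Ib: "integrable unif b"
      by (rule integrable_unif[OF bm, of 1]) (simp add: b_def indicator_def)
    have IbG: "integrable unif (\<lambda>y. b y * G y)" if "integrable unif G" for G
      by (rule integrable_unif_mult[OF that bm]) (simp add: b_def indicator_def)
    have E1: "(\<integral>y. b y * f (x + t *\<^sub>R dirn y) \<partial>unif) = q ^ n * m"
      using integral_unif_subball[OF m1, of q] q by (simp add: b_def dirn_scale m_def n_def)
    have E2: "(\<integral>y. b y * f (x + t *\<^sub>R y) \<partial>unif) = q ^ n * a"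
      using integral_unif_subball[OF m2, of q] ball[of "t * q"] q t by (simp add: b_def n_def mult_left_le)
    have E3: "(\<integral>y. b y \<partial>unif) = q ^ n"
      using integral_unif_subball[of "\<lambda>_. 1" q] q by (simp add: b_def n_def)
    have E4: "(\<integral>y. f (x + t *\<^sub>R y) \<partial>unif) = a" using ball t by simp
    let ?D = "\<lambda>y. (f (x + t *\<^sub>R y) - b y * f (x + t *\<^sub>R y)) - (f (x + t *\<^sub>R dirn y) - b y * f (x + t *\<^sub>R dirn y))"
    have ID: "integrable unif ?D" using I1 I2 IbG[OF I1] IbG[OF I2] by simp
    have "(\<integral>y. ?D y \<partial>unif) = (a - q ^ n * a) - (m - q ^ n * m)"
      using I1 I2 IbG[OF I1] IbG[OF I2] by (simp add: E1 E2 E4 m_def[symmetric])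
    also have "\<dots> = (1 - q ^ n) * (a - m)" by (simp add: algebra_simps)
    finally have "(1 - q ^ n) * (a - m) = (\<integral>y. ?D y \<partial>unif)" by simp
    moreover have "\<bar>\<integral>y. ?D y \<partial>unif\<bar> \<le> (\<integral>y. e * (1 - b y) \<partial>unif)"
    proof (rule order_trans[OF integral_abs_bound integral_unif_mono])
      show "integrable unif (\<lambda>y. \<bar>?D y\<bar>)" using ID by (rule integrable_abs)
      show "integrable unif (\<lambda>y. e * (1 - b y))"
        by (intro integrable_mult_right Bochner_Integration.integrable_diff Ib integrable_unif_const)
      show "\<bar>?D y\<bar> \<le> e * (1 - b y)" if "norm y < 1" for y
        using close[of y] that by (auto simp: b_def indicator_def)
    qed
    moreover have "(\<integral>y. e * (1 - b y) \<partial>unif) = e * (1 - q ^ n)"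
      using Bochner_Integration.integral_diff[OF integrable_unif_const[of 1] Ib] by (simp add: E3)
    ultimately have "\<bar>(1 - q ^ n) * (a - m)\<bar> \<le> e * (1 - q ^ n)" by (simp only:)
    then have "(1 - q ^ n) * \<bar>a - m\<bar> \<le> (1 - q ^ n) * e"
      using qn by (simp add: abs_mult mult.commute)
    then show ?thesis using qn by simp
  qed
  have "a = m"
    using le[of "\<bar>a - m\<bar> / 2"] by (cases "a = m") auto
  then show ?thesis by (simp add: m_def)
qed

text \<open>Integration in polar coordinates by discretisation: once the radius is rounded to a
  multiple of \<open>1 / Suc j\<close>, the integral is a finite sum of sphere means whose shell
  weights telescope to 1. Continuity removes the rounding in the limit.\<close>

lemma ball_mean_le_of_sphere_means:
  fixes f :: "'a::euclidean_space \<Rightarrow> real"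
  assumes f: "continuous_on (cball x t) f" and t: "0 < t"
    and sph: "\<And>s. 0 < s \<Longrightarrow> s \<le> t \<Longrightarrow> (\<integral>y. f (x + s *\<^sub>R dirn y) \<partial>unif) \<le> a"
  shows "(\<integral>y. f (x + t *\<^sub>R y) \<partial>unif) \<le> a"
proof -
  \<comment> \<open>Rounding goes strictly upwards: every radius is then positive, as the hypothesis
    on spheres demands, and it stays at most 1 because \<open>norm y < 1\<close>.\<close>
  define R where "R j r = (real_of_int \<lfloor>real (Suc j) * r\<rfloor> + 1) / real (Suc j)" for j r
  define F where "F j y = f (x + (t * R j (norm y)) *\<^sub>R dirn y)" for j and y :: 'a
  have "bounded (f ` cball x t)"
    by (intro compact_imp_bounded compact_continuous_image f) simp
  then obtain B where B: "\<And>z. z \<in> cball x t \<Longrightarrow> \<bar>f z\<bar> \<le> B" unfolding bounded_iff by force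
  have R01: "0 < R j r" "R j r \<le> 1" if "0 \<le> r" "r < 1" for j r
  proof -
    have "0 \<le> \<lfloor>real (Suc j) * r\<rfloor>" using that by simp
    then show "0 < R j r" unfolding R_def by (intro divide_pos_pos) linarith+
    have "real (Suc j) * r < real (Suc j)" using that by simp
    then have "\<lfloor>real (Suc j) * r\<rfloor> < int (Suc j)" by (simp add: floor_less_iff)
    then have "\<lfloor>real (Suc j) * r\<rfloor> + 1 \<le> int (Suc j)" by simp
    then have "real_of_int (\<lfloor>real (Suc j) * r\<rfloor> + 1) \<le> real (Suc j)"
      by (metis of_int_le_iff of_int_of_nat_eq)
    then show "R j r \<le> 1" by (simp add: R_def)
  qed
  have Rlim: "(\<lambda>j. R j r) \<longlonglongrightarrow> r" for r
  proof (rule LIMSEQ_I)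
    fix e :: real assume "0 < e"
    then obtain N where N: "N \<noteq> 0" "inverse (real N) < e" using real_arch_inverse[of e] by auto
    have "norm (R j r - r) < e" if "N \<le> j" for j
    proof -
      have "R j r - r = (real_of_int \<lfloor>real (Suc j) * r\<rfloor> + 1 - real (Suc j) * r) / real (Suc j)"
        by (simp add: R_def diff_divide_distrib)
      moreover have "\<bar>real_of_int \<lfloor>real (Suc j) * r\<rfloor> + 1 - real (Suc j) * r\<bar> \<le> 1" by linarith
      ultimately have "norm (R j r - r) \<le> 1 / real (Suc j)"
        by (simp add: divide_right_mono)
      also have "\<dots> \<le> inverse (real N)" using that N by (simp add: divide_inverse le_imp_inverse_le)
      finally show ?thesis using N by simp
    qed
    then show "\<exists>no. \<forall>n\<ge>no. norm (R n r - r) < e" by blast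
  qed
  have Feq: "F j y = (\<Sum>k<Suc j. indicator {real k / real (Suc j)..<real (Suc k) / real (Suc j)} (norm y)
      * f (x + (t * (real (Suc k) / real (Suc j))) *\<^sub>R dirn y))" if y: "norm y < 1" for j y
  proof -
    define k0 where "k0 = nat \<lfloor>real (Suc j) * norm y\<rfloor>"
    have k0: "real k0 = real_of_int \<lfloor>real (Suc j) * norm y\<rfloor>" by (simp add: k0_def)
    have "real (Suc j) * norm y < real (Suc j) * 1" using y by (intro mult_strict_left_mono) auto
    moreover have "real k0 \<le> real (Suc j) * norm y" by (simp only: k0 of_int_floor_le)
    ultimately have "real k0 < real (Suc j)" by (simp only: mult_1_right)
    then have k0j: "k0 < Suc j" by (simp only: of_nat_less_iff)
    have ind: "(norm y \<in> {real k / real (Suc j)..<real (Suc k) / real (Suc j)}) \<longleftrightarrow> k = k0" for k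
    proof -
      have "(norm y \<in> {real k / real (Suc j)..<real (Suc k) / real (Suc j)}) \<longleftrightarrow>
          real k \<le> real (Suc j) * norm y \<and> real (Suc j) * norm y < real (Suc k)"
        by (simp add: divide_le_eq less_divide_eq mult.commute)
      also have "\<dots> \<longleftrightarrow> int k = \<lfloor>real (Suc j) * norm y\<rfloor>" by linarith
      also have "\<dots> \<longleftrightarrow> k = k0" by (auto simp: k0_def)
      finally show ?thesis .
    qed
    have "(\<Sum>k<Suc j. indicator {real k / real (Suc j)..<real (Suc k) / real (Suc j)} (norm y)
        * f (x + (t * (real (Suc k) / real (Suc j))) *\<^sub>R dirn y))
      = (\<Sum>k<Suc j. if k = k0 then f (x + (t * (real (Suc k0) / real (Suc j))) *\<^sub>R dirn y) else 0)"
      by (rule sum.cong[OF refl]) (simp only: indicator_def ind, simp)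
    also have "\<dots> = f (x + (t * (real (Suc k0) / real (Suc j))) *\<^sub>R dirn y)"
      using k0j by simp
    also have "\<dots> = F j y" by (simp add: F_def R_def k0 add.commute)
    finally show ?thesis by simp
  qed
  have cs: "continuous_on (sphere 0 1) (\<lambda>\<theta>. f (x + (t * (real (Suc k) / real (Suc j))) *\<^sub>R \<theta>))" if "k < Suc j" for k j
  proof (rule continuous_on_cball_dirn(1)[OF f])
    have "real (Suc k) / real (Suc j) \<le> 1" using that by simp
    then show "t * (real (Suc k) / real (Suc j)) \<le> t" using t by (intro mult_left_le) auto
  qed (use t in simp)
  have IF: "integrable unif (\<lambda>y. indicator {real k / real (Suc j)..<real (Suc k) / real (Suc j)} (norm y)
        * f (x + (t * (real (Suc k) / real (Suc j))) *\<^sub>R dirn y))" if "k < Suc j" for k j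
    by (rule integrable_unif_mult[OF integrable_dirn_comp[OF cs[OF that]] borel_measurable_indicator_unif(2)])
      (simp add: indicator_def)
  have EF: "(\<integral>y. F j y \<partial>unif) \<le> a" for j
  proof -
    let ?q = "\<lambda>k. real k / real (Suc j)"
    have "(\<integral>y. F j y \<partial>unif) = (\<integral>y. (\<Sum>k<Suc j. indicator {?q k..<?q (Suc k)} (norm y)
        * f (x + (t * ?q (Suc k)) *\<^sub>R dirn y)) \<partial>unif)"
      by (rule Bochner_Integration.integral_cong) (auto simp: Feq simp del: sum.lessThan_Suc of_nat_Suc)
    also have "\<dots> = (\<Sum>k<Suc j. \<integral>y. indicator {?q k..<?q (Suc k)} (norm y)
        * f (x + (t * ?q (Suc k)) *\<^sub>R dirn y) \<partial>unif)"
      by (rule Bochner_Integration.integral_sum) (rule IF, simp)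
    also have "\<dots> \<le> (\<Sum>k<Suc j. (?q (Suc k) ^ DIM('a) - ?q k ^ DIM('a)) * a)"
    proof (rule sum_mono)
      fix k assume "k \<in> {..<Suc j}"
      then have k: "k < Suc j" by simp
      have q: "0 \<le> ?q k" "?q k \<le> ?q (Suc k)" "0 < ?q (Suc k)" "?q (Suc k) \<le> 1"
        using k by (auto simp: divide_right_mono simp del: of_nat_Suc)
      have "(\<integral>y. indicator {?q k..<?q (Suc k)} (norm y) * f (x + (t * ?q (Suc k)) *\<^sub>R dirn y) \<partial>unif)
         = (?q (Suc k) ^ DIM('a) - ?q k ^ DIM('a)) * (\<integral>y. f (x + (t * ?q (Suc k)) *\<^sub>R dirn y) \<partial>unif)"
        by (rule integral_unif_shell[OF cs[OF k] q])
      also have "\<dots> \<le> (?q (Suc k) ^ DIM('a) - ?q k ^ DIM('a)) * a"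
      proof (intro mult_left_mono sph)
        show "0 < t * ?q (Suc k)" using q(3) t by (rule mult_pos_pos[rotated])
        show "t * ?q (Suc k) \<le> t" using q(4) t by (intro mult_left_le) auto
        show "0 \<le> ?q (Suc k) ^ DIM('a) - ?q k ^ DIM('a)"
          using power_mono[OF q(2,1), of "DIM('a)"] by (simp only: diff_ge_0_iff_ge)
      qed
      finally show "(\<integral>y. indicator {?q k..<?q (Suc k)} (norm y) * f (x + (t * ?q (Suc k)) *\<^sub>R dirn y) \<partial>unif)
         \<le> (?q (Suc k) ^ DIM('a) - ?q k ^ DIM('a)) * a" .
    qed
    also have "\<dots> = (?q (Suc j) ^ DIM('a) - ?q 0 ^ DIM('a)) * a"
      using sum_lessThan_telescope[of "\<lambda>k. ?q k ^ DIM('a)" "Suc j"]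
      by (simp only: sum_distrib_right[symmetric])
    also have "\<dots> = a" by simp
    finally show ?thesis .
  qed
  have "(\<lambda>j. \<integral>y. F j y \<partial>unif) \<longlonglongrightarrow> (\<integral>y. f (x + t *\<^sub>R y) \<partial>unif)"
  proof (rule integral_dominated_convergence[where w="\<lambda>_. B"])
    show "integrable unif (\<lambda>_::'a. B)" using finite_measure.integrable_const[OF finite_measure_unif] .
    show "(\<lambda>y. f (x + t *\<^sub>R y)) \<in> borel_measurable unif"
      by (rule borel_measurable_integrable[OF integrable_unif_cont[OF continuous_on_cball_dirn(2)[OF f]]]) (use t in auto)
    show "F j \<in> borel_measurable unif" for j
    proof -
      have "(\<lambda>y. \<Sum>k<Suc j. indicator {real k / real (Suc j)..<real (Suc k) / real (Suc j)} (norm y)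
        * f (x + (t * (real (Suc k) / real (Suc j))) *\<^sub>R dirn y)) \<in> borel_measurable unif"
        by (intro borel_measurable_sum borel_measurable_integrable IF) simp
      then show ?thesis
        by (rule measurable_cong[THEN iffD2, rotated]) (simp add: Feq del: sum.lessThan_Suc of_nat_Suc)
    qed
    have inb: "x + (t * R j (norm y)) *\<^sub>R dirn y \<in> cball x t" if "norm y < 1" for j and y :: 'a
      using R01[of "norm y" j] that t by (simp add: dist_norm mult_left_le)
    show "AE y in unif. norm (F j y) \<le> B" for j
      by (rule AE_I2) (use inb B in \<open>simp add: F_def\<close>)
    show "AE y in unif. (\<lambda>j. F j y) \<longlonglongrightarrow> f (x + t *\<^sub>R y)"
    proof (rule AE_I2)
      fix y :: 'a assume "y \<in> space unif"
      then have y: "norm y < 1" by simp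
      have "(\<lambda>j. x + (t * R j (norm y)) *\<^sub>R dirn y) \<longlonglongrightarrow> x + (t * norm y) *\<^sub>R dirn y"
        by (intro tendsto_intros Rlim)
      moreover have "x + (t * norm y) *\<^sub>R dirn y = x + t *\<^sub>R y"
        using norm_scale_dirn[of y] by (simp flip: scaleR_scaleR)
      moreover have "x + t *\<^sub>R y \<in> cball x t" using y t by (simp add: dist_norm mult_left_le)
      ultimately show "(\<lambda>j. F j y) \<longlonglongrightarrow> f (x + t *\<^sub>R y)"
        unfolding F_def using inb[OF y]
        by (intro continuous_on_tendsto_compose[OF f]) auto
    qed
  qed
  then show ?thesis by (rule LIMSEQ_le_const2) (use EF in auto)
qed

(* The factor is rho^n / rho^2 rather than rho^(n - 2), where the subtraction would truncate for n = 1. *)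
definition poisson_kernel :: "'a::euclidean_space \<Rightarrow> real \<Rightarrow> 'a \<Rightarrow> 'a \<Rightarrow> real" where
  "poisson_kernel c \<rho> x \<theta> = (\<rho> ^ DIM('a) / \<rho>\<^sup>2) * ((\<rho>\<^sup>2 - (dist c x)\<^sup>2) / dist x (c + \<rho> *\<^sub>R \<theta>) ^ DIM('a))"

definition poisson_integral :: "'a::euclidean_space \<Rightarrow> real \<Rightarrow> ('a \<Rightarrow> real) \<Rightarrow> 'a \<Rightarrow> real" where
  "poisson_integral c \<rho> f x = (\<integral>z. poisson_kernel c \<rho> x (dirn z) * f (c + \<rho> *\<^sub>R dirn z) \<partial>unif)"

lemma poisson_kernel_pole_kernel:
  assumes "0 < \<rho>" "norm \<theta> = 1"
  shows "poisson_kernel c \<rho> x \<theta> = (\<rho> ^ DIM('a) / \<rho>\<^sup>2) * pole_kernel (- (\<rho> *\<^sub>R \<theta>)) (c + \<rho> *\<^sub>R \<theta>) (x::'a::euclidean_space)"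
  using pole_kernel_sphere[of c "c + \<rho> *\<^sub>R \<theta>" \<rho> x] assms
  by (simp add: poisson_kernel_def dist_norm)

lemma dist_sphere_ge:
  fixes c x \<theta> :: "'a::euclidean_space"
  assumes "0 < \<rho>" "norm \<theta> = 1"
  shows "\<rho> - dist c x \<le> dist x (c + \<rho> *\<^sub>R \<theta>)"
proof -
  have "dist c (c + \<rho> *\<^sub>R \<theta>) = \<rho>" using assms by (simp add: dist_norm)
  then show ?thesis using dist_triangle[of c "c + \<rho> *\<^sub>R \<theta>" x] by simp
qed

lemma poisson_kernel_nonneg:
  assumes "0 < \<rho>" "dist c x < \<rho>"
  shows "0 \<le> poisson_kernel c \<rho> x \<theta>"
proof -
  have "(dist c x)\<^sup>2 \<le> \<rho>\<^sup>2" using assms by (intro power_mono) auto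
  then show ?thesis using assms by (simp add: poisson_kernel_def)
qed

lemma poisson_kernel_le:
  fixes c x \<theta> :: "'a::euclidean_space"
  assumes "0 < \<rho>" "norm \<theta> = 1" "dist c x \<le> \<rho> - \<delta>" "0 < \<delta>"
  shows "poisson_kernel c \<rho> x \<theta> \<le> \<rho> ^ DIM('a) / \<delta> ^ DIM('a)"
proof -
  have d: "\<delta> \<le> dist x (c + \<rho> *\<^sub>R \<theta>)" using dist_sphere_ge[OF assms(1,2), of c x] assms by linarith
  have "(dist c x)\<^sup>2 \<le> \<rho>\<^sup>2" using assms zero_le_dist[of c x] by (intro power_mono) linarith+
  then have "(\<rho>\<^sup>2 - (dist c x)\<^sup>2) / dist x (c + \<rho> *\<^sub>R \<theta>) ^ DIM('a) \<le> \<rho>\<^sup>2 / \<delta> ^ DIM('a)"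
    using d assms by (intro frac_le power_mono) auto
  then have "(\<rho> ^ DIM('a) / \<rho>\<^sup>2) * ((\<rho>\<^sup>2 - (dist c x)\<^sup>2) / dist x (c + \<rho> *\<^sub>R \<theta>) ^ DIM('a))
      \<le> (\<rho> ^ DIM('a) / \<rho>\<^sup>2) * (\<rho>\<^sup>2 / \<delta> ^ DIM('a))"
    using assms by (intro mult_left_mono) auto
  then show ?thesis using assms by (simp add: poisson_kernel_def)
qed

lemma continuous_on_poisson_kernel:
  fixes c x :: "'a::euclidean_space"
  assumes "0 < \<rho>" "dist c x < \<rho>"
  shows "continuous_on (sphere 0 1) (poisson_kernel c \<rho> x)"
  unfolding poisson_kernel_def
proof (intro continuous_intros ballI)
  fix \<theta> :: 'a assume "\<theta> \<in> sphere 0 1"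
  then show "dist x (c + \<rho> *\<^sub>R \<theta>) ^ DIM('a) \<noteq> 0" using dist_sphere_ge[of \<rho> \<theta> c x] assms by auto
qed

text \<open>A reflection exchanges the variables: the distance from
  \<open>c + s *\<^sub>R \<tau>\<close> to \<open>c + \<rho> *\<^sub>R \<theta>\<close> is unchanged
  when \<open>\<tau>\<close> and \<open>\<theta>\<close> are swapped. The integral over the pole
  thus becomes a mean over the sphere of radius \<open>s\<close> with a fixed pole outside it, and
  the mean value property evaluates it at the centre.\<close>

lemma integral_poisson_kernel:
  fixes c x :: "'a::euclidean_space"
  assumes "0 < \<rho>" "dist c x < \<rho>"
  shows "(\<integral>z. poisson_kernel c \<rho> x (dirn z) \<partial>unif) = 1"
proof (cases "x = c")
  case True
  then show ?thesis using assms by (simp add: poisson_kernel_def dist_norm)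
next
  case False
  define s where "s = dist c x"
  define \<tau> where "\<tau> = sgn (x - c)"
  have s: "0 < s" "s < \<rho>" using False assms by (auto simp: s_def)
  have \<tau>: "norm \<tau> = 1" using False by (simp add: \<tau>_def norm_sgn)
  have x: "x = c + s *\<^sub>R \<tau>" using False by (simp add: s_def \<tau>_def sgn_div_norm dist_norm norm_minus_commute)
  define b where "b = - (\<rho> *\<^sub>R \<tau>)"
  define y where "y = c + \<rho> *\<^sub>R \<tau>"
  have ycb: "y \<notin> cball c t" if "t < \<rho>" for t using that \<tau> assms by (simp add: y_def dist_norm)
  have refl: "poisson_kernel c \<rho> x \<theta> = poisson_kernel c \<rho> (c + s *\<^sub>R \<theta>) \<tau>" if "norm \<theta> = 1" for \<theta>
  proof -
    have "(dist x (c + \<rho> *\<^sub>R \<theta>))\<^sup>2 = (s *\<^sub>R \<tau> - \<rho> *\<^sub>R \<theta>) \<bullet> (s *\<^sub>R \<tau> - \<rho> *\<^sub>R \<theta>)"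
      by (simp add: x dist_norm power2_norm_eq_inner)
    also have "\<dots> = (s *\<^sub>R \<theta> - \<rho> *\<^sub>R \<tau>) \<bullet> (s *\<^sub>R \<theta> - \<rho> *\<^sub>R \<tau>)"
      using that \<tau> by (simp add: inner_diff_left inner_diff_right inner_commute norm_eq_1)
    also have "\<dots> = (dist (c + s *\<^sub>R \<theta>) (c + \<rho> *\<^sub>R \<tau>))\<^sup>2"
      by (simp add: dist_norm power2_norm_eq_inner)
    finally have "dist x (c + \<rho> *\<^sub>R \<theta>) = dist (c + s *\<^sub>R \<theta>) (c + \<rho> *\<^sub>R \<tau>)"
      by (simp add: power2_eq_iff_nonneg)
    moreover have "dist c (c + s *\<^sub>R \<theta>) = dist c x" using that \<tau> by (simp add: x dist_norm)
    ultimately show ?thesis by (simp add: poisson_kernel_def)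
  qed
  have "(\<integral>z. pole_kernel b y (c + s *\<^sub>R dirn z) \<partial>unif) = pole_kernel b y c"
  proof (rule sphere_mean_eq_of_ball_means)
    show "continuous_on (cball c s) (pole_kernel b y)"
      by (rule continuous_on_subset[OF continuous_on_pole_kernel]) (use ycb s in auto)
    show "(\<integral>z. pole_kernel b y (c + t *\<^sub>R z) \<partial>unif) = pole_kernel b y c" if "0 < t" "t \<le> s" for t
      by (rule pole_kernel_mean[OF that(1) ycb]) (use that s in simp)
  qed (use s in simp)
  moreover have "pole_kernel b y c = \<rho>\<^sup>2 / \<rho> ^ DIM('a)"
    using assms \<tau> by (simp add: pole_kernel_def b_def y_def dot_square_norm power2_eq_square)
  ultimately have I: "(\<integral>z. pole_kernel b y (c + s *\<^sub>R dirn z) \<partial>unif) = \<rho>\<^sup>2 / \<rho> ^ DIM('a)"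
    by (rule trans)
  have "poisson_kernel c \<rho> x (dirn z) = (\<rho> ^ DIM('a) / \<rho>\<^sup>2) * pole_kernel b y (c + s *\<^sub>R dirn z)" for z :: 'a
    using refl[of "dirn z"] poisson_kernel_pole_kernel[OF assms(1) \<tau>, of c "c + s *\<^sub>R dirn z"] by (simp add: b_def y_def)
  then have "(\<integral>z. poisson_kernel c \<rho> x (dirn z) \<partial>unif) =
      (\<integral>z. (\<rho> ^ DIM('a) / \<rho>\<^sup>2) * pole_kernel b y (c + s *\<^sub>R dirn z) \<partial>unif)"
    by (simp only:)
  also have "\<dots> = (\<rho> ^ DIM('a) / \<rho>\<^sup>2) * (\<rho>\<^sup>2 / \<rho> ^ DIM('a))"
    by (simp only: integral_mult_right_zero I)
  also have "\<dots> = 1" using assms by simp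
  finally show ?thesis .
qed

lemma poisson_kernel_mean:
  fixes c x \<theta> :: "'a::euclidean_space"
  assumes "0 < \<rho>" "norm \<theta> = 1" "0 < r" "cball z r \<subseteq> ball c \<rho>"
  shows "(\<integral>w. poisson_kernel c \<rho> (z + r *\<^sub>R w) \<theta> \<partial>unif) = poisson_kernel c \<rho> z \<theta>"
proof -
  have "c + \<rho> *\<^sub>R \<theta> \<notin> cball z r" using assms by (auto simp: subset_iff dist_norm)
  from pole_kernel_mean[OF assms(3) this]
  show ?thesis using assms(1,2) by (simp add: poisson_kernel_pole_kernel)
qed

section \<open>Poisson integrals and the Dirichlet problem on a ball\<close>

locale poisson =
  fixes c :: "'a::euclidean_space" and \<rho> :: real and f :: "'a \<Rightarrow> real"
  assumes \<rho>: "0 < \<rho>" and f: "continuous_on (sphere c \<rho>) f"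
begin

abbreviation "h \<equiv> poisson_integral c \<rho> f"

lemma f_dirn: "continuous_on (sphere 0 1) (\<lambda>\<theta>. f (c + \<rho> *\<^sub>R \<theta>))"
  using \<rho> by (auto intro!: continuous_on_compose2[OF f] continuous_intros simp: dist_norm)

lemma f_bound: obtains M where "0 < M" "\<And>\<theta>. norm \<theta> = 1 \<Longrightarrow> \<bar>f (c + \<rho> *\<^sub>R \<theta>)\<bar> \<le> M"
proof -
  have "bounded ((\<lambda>\<theta>. f (c + \<rho> *\<^sub>R \<theta>)) ` sphere 0 1)"
    by (intro compact_imp_bounded compact_continuous_image f_dirn) simp
  then obtain M where "0 < M" "\<forall>z\<in>(\<lambda>\<theta>. f (c + \<rho> *\<^sub>R \<theta>)) ` sphere 0 1. norm z \<le> M"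
    unfolding bounded_pos by blast
  then show thesis using that[of M] by auto
qed

lemma kernel_integrable:
  assumes "dist c x < \<rho>"
  shows "integrable unif (\<lambda>z. poisson_kernel c \<rho> x (dirn z))"
    and "integrable unif (\<lambda>z. poisson_kernel c \<rho> x (dirn z) * f (c + \<rho> *\<^sub>R dirn z))"
proof -
  note k = continuous_on_poisson_kernel[OF \<rho> assms]
  show "integrable unif (\<lambda>z. poisson_kernel c \<rho> x (dirn z))"
    by (rule integrable_dirn_comp[OF k])
  show "integrable unif (\<lambda>z. poisson_kernel c \<rho> x (dirn z) * f (c + \<rho> *\<^sub>R dirn z))"
    by (rule integrable_dirn_comp[OF continuous_on_mult[OF k f_dirn]])
qed

lemma poisson_center: "h c = (\<integral>z. f (c + \<rho> *\<^sub>R dirn z) \<partial>unif)"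
  unfolding poisson_integral_def using \<rho> by (simp add: poisson_kernel_def dist_norm)

text \<open>For each fixed pole the kernel has the mean value property in its interior variable;
  Fubini carries it over to the integral. The closed ball keeps distance \<open>\<delta>\<close>
  from the sphere, which bounds the kernel uniformly.\<close>

lemma poisson_mean:
  assumes "0 < r" "cball z r \<subseteq> ball c \<rho>"
  shows "(\<integral>w. h (z + r *\<^sub>R w) \<partial>unif) = h z"
proof -
  obtain M where M: "0 < M" "\<And>\<theta>. norm \<theta> = 1 \<Longrightarrow> \<bar>f (c + \<rho> *\<^sub>R \<theta>)\<bar> \<le> M" using f_bound by blast
  have "dist z c + r < \<rho>" using assms by (simp add: cball_subset_ball_iff)
  define \<delta> where "\<delta> = \<rho> - (dist c z + r)"
  have \<delta>: "0 < \<delta>" using \<open>dist z c + r < \<rho>\<close> by (simp add: \<delta>_def dist_commute)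
  have near: "dist c (z + r *\<^sub>R w) \<le> \<rho> - \<delta>" if "norm w < 1" for w
  proof -
    have "dist c (z + r *\<^sub>R w) \<le> dist c z + dist z (z + r *\<^sub>R w)" by (rule dist_triangle)
    also have "dist z (z + r *\<^sub>R w) \<le> r" using that assms by (simp add: dist_norm mult_left_le)
    finally show ?thesis by (simp add: \<delta>_def)
  qed
  define G where "G w v = poisson_kernel c \<rho> (z + r *\<^sub>R w) (dirn v) * f (c + \<rho> *\<^sub>R dirn v)" for w v
  have m1 [measurable]: "(\<lambda>p. fst p) \<in> measurable (unif \<Otimes>\<^sub>M unif) (borel :: 'a measure)"
    and m2 [measurable]: "(\<lambda>p. snd p) \<in> measurable (unif \<Otimes>\<^sub>M unif) (borel :: 'a measure)"
    by (rule measurable_compose[OF measurable_fst borel_measurable_unifI[OF continuous_on_id]])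
      (rule measurable_compose[OF measurable_snd borel_measurable_unifI[OF continuous_on_id]])
  note fm [measurable] = measurable_compose[OF m2 borel_measurable_dirn_comp[OF f_dirn]]
  note dm [measurable] = measurable_compose[OF m2 dirn_measurable]
  have Gm: "(\<lambda>p. G (fst p) (snd p)) \<in> borel_measurable (unif \<Otimes>\<^sub>M unif)"
    unfolding G_def poisson_kernel_def by measurable
  interpret U: finite_measure "unif :: 'a measure" by (rule finite_measure_unif)
  interpret pair_sigma_finite "unif :: 'a measure" "unif :: 'a measure" ..
  have fin: "finite_measure (unif \<Otimes>\<^sub>M (unif :: 'a measure))"
    using finite_measure_unif finite_measure_unif by (rule finite_measure_pair_measure)
  have int: "integrable (unif \<Otimes>\<^sub>M unif) (\<lambda>p. G (fst p) (snd p))"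
  proof (rule finite_measure.integrable_const_bound[OF fin _ Gm])
    show "AE p in unif \<Otimes>\<^sub>M unif. norm (G (fst p) (snd p)) \<le> \<rho> ^ DIM('a) / \<delta> ^ DIM('a) * M"
    proof (rule AE_I2)
      fix p :: "'a \<times> 'a" assume "p \<in> space (unif \<Otimes>\<^sub>M unif)"
      then have w: "norm (fst p) < 1" by (auto simp: space_pair_measure)
      have k: "poisson_kernel c \<rho> (z + r *\<^sub>R fst p) (dirn (snd p)) \<le> \<rho> ^ DIM('a) / \<delta> ^ DIM('a)"
        by (rule poisson_kernel_le[OF \<rho> norm_dirn near[OF w] \<delta>])
      have "0 \<le> poisson_kernel c \<rho> (z + r *\<^sub>R fst p) (dirn (snd p))"
        by (rule poisson_kernel_nonneg[OF \<rho>]) (use near[OF w] \<delta> in linarith)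
      then have "\<bar>poisson_kernel c \<rho> (z + r *\<^sub>R fst p) (dirn (snd p))\<bar> * \<bar>f (c + \<rho> *\<^sub>R dirn (snd p))\<bar>
          \<le> \<rho> ^ DIM('a) / \<delta> ^ DIM('a) * M"
        using k \<rho> \<delta> M by (intro mult_mono) auto
      then show "norm (G (fst p) (snd p)) \<le> \<rho> ^ DIM('a) / \<delta> ^ DIM('a) * M"
        by (simp add: G_def abs_mult)
    qed
  qed
  have "(\<integral>w. h (z + r *\<^sub>R w) \<partial>unif) = (\<integral>w. (\<integral>v. G w v \<partial>unif) \<partial>unif)"
    by (simp add: poisson_integral_def G_def)
  also have "\<dots> = (\<integral>v. (\<integral>w. G w v \<partial>unif) \<partial>unif)"
    by (rule Fubini_integral[symmetric]) (use int in \<open>simp add: case_prod_unfold\<close>)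
  also have "\<dots> = (\<integral>v. poisson_kernel c \<rho> z (dirn v) * f (c + \<rho> *\<^sub>R dirn v) \<partial>unif)"
    by (simp add: G_def poisson_kernel_mean[OF \<rho> norm_dirn assms])
  finally show ?thesis by (simp add: poisson_integral_def)
qed

lemma poisson_continuous: "continuous_on (ball c \<rho>) h"
  unfolding continuous_on_sequentially comp_def
proof (intro allI ballI impI)
  fix X a assume a: "a \<in> ball c \<rho>" and X: "(\<forall>n. X n \<in> ball c \<rho>) \<and> X \<longlonglongrightarrow> a"
  obtain M where M: "0 < M" "\<And>\<theta>. norm \<theta> = 1 \<Longrightarrow> \<bar>f (c + \<rho> *\<^sub>R \<theta>)\<bar> \<le> M" using f_bound by blast
  \<comment> \<open>Half the distance from \<open>a\<close> to the sphere: the tail of the sequence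
    stays \<open>\<delta>\<close> away from the sphere, so one constant dominates the
    kernels.\<close>
  define \<delta> where "\<delta> = (\<rho> - dist c a) / 2"
  have \<delta>: "0 < \<delta>" "dist c a < \<rho> - \<delta>" using a by (auto simp: \<delta>_def field_simps)
  have "\<forall>\<^sub>F n in sequentially. dist c (X n) < \<rho> - \<delta>"
    using X \<delta> by (intro order_tendstoD(2)[of _ "dist c a"] tendsto_intros) auto
  then obtain N where "\<forall>n\<ge>N. dist c (X n) < \<rho> - \<delta>"
    unfolding eventually_sequentially by blast
  then have N: "dist c (X (n + N)) < \<rho> - \<delta>" for n by simp
  have XN: "(\<lambda>n. X (n + N)) \<longlonglongrightarrow> a" using X by (simp add: LIMSEQ_ignore_initial_segment)
  have "(\<lambda>n. h (X (n + N))) \<longlonglongrightarrow> h a"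
    unfolding poisson_integral_def
  proof (rule integral_dominated_convergence[where w="\<lambda>_. \<rho> ^ DIM('a) / \<delta> ^ DIM('a) * M"])
    show "(\<lambda>z. poisson_kernel c \<rho> a (dirn z) * f (c + \<rho> *\<^sub>R dirn z)) \<in> borel_measurable unif"
      by (rule borel_measurable_integrable[OF kernel_integrable(2)]) (use a in simp)
    show "(\<lambda>z. poisson_kernel c \<rho> (X (n + N)) (dirn z) * f (c + \<rho> *\<^sub>R dirn z)) \<in> borel_measurable unif" for n
      by (rule borel_measurable_integrable[OF kernel_integrable(2)]) (use X in simp)
    show "AE z in unif. (\<lambda>n. poisson_kernel c \<rho> (X (n + N)) (dirn z) * f (c + \<rho> *\<^sub>R dirn z)) \<longlonglongrightarrow>
        poisson_kernel c \<rho> a (dirn z) * f (c + \<rho> *\<^sub>R dirn z)"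
    proof (rule AE_I2)
      fix z :: 'a
      have "dist a (c + \<rho> *\<^sub>R dirn z) \<noteq> 0"
        using dist_sphere_ge[OF \<rho> norm_dirn, of c a z] a by auto
      then show "(\<lambda>n. poisson_kernel c \<rho> (X (n + N)) (dirn z) * f (c + \<rho> *\<^sub>R dirn z)) \<longlonglongrightarrow>
        poisson_kernel c \<rho> a (dirn z) * f (c + \<rho> *\<^sub>R dirn z)"
        unfolding poisson_kernel_def by (intro tendsto_intros XN) auto
    qed
    show "AE z in unif. norm (poisson_kernel c \<rho> (X (n + N)) (dirn z) * f (c + \<rho> *\<^sub>R dirn z)) \<le>
        \<rho> ^ DIM('a) / \<delta> ^ DIM('a) * M" for n
    proof (rule AE_I2)
      fix z :: 'a
      have k: "poisson_kernel c \<rho> (X (n + N)) (dirn z) \<le> \<rho> ^ DIM('a) / \<delta> ^ DIM('a)"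
        by (rule poisson_kernel_le[OF \<rho> norm_dirn less_imp_le[OF N] \<delta>(1)])
      have "0 \<le> poisson_kernel c \<rho> (X (n + N)) (dirn z)"
        by (rule poisson_kernel_nonneg[OF \<rho>]) (use X in simp)
      then have "\<bar>poisson_kernel c \<rho> (X (n + N)) (dirn z)\<bar> * \<bar>f (c + \<rho> *\<^sub>R dirn z)\<bar> \<le> \<rho> ^ DIM('a) / \<delta> ^ DIM('a) * M"
        using k \<rho> \<delta> M by (intro mult_mono) auto
      then show "norm (poisson_kernel c \<rho> (X (n + N)) (dirn z) * f (c + \<rho> *\<^sub>R dirn z)) \<le> \<rho> ^ DIM('a) / \<delta> ^ DIM('a) * M"
        by (simp add: abs_mult)
    qed
  qed simp
  then show "(\<lambda>n. h (X n)) \<longlonglongrightarrow> h a" by (rule LIMSEQ_offset)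
qed

text \<open>The kernel is an approximate identity. Close to \<open>y0\<close> the oscillation of
  \<open>f\<close> is small and the kernel has mass one; away from \<open>y0\<close> its denominator
  is bounded below, and it is at most \<open>C\<close> times
  \<open>\<rho>\<^sup>2 - (dist c x)\<^sup>2\<close>, which tends to 0.\<close>

lemma poisson_boundary:
  assumes y0: "y0 \<in> sphere c \<rho>"
  shows "(h \<longlongrightarrow> f y0) (at y0 within ball c \<rho>)"
proof (rule tendstoI)
  fix e :: real assume e: "0 < e"
  obtain M where M: "0 < M" "\<And>\<theta>. norm \<theta> = 1 \<Longrightarrow> \<bar>f (c + \<rho> *\<^sub>R \<theta>)\<bar> \<le> M" using f_bound by blast
  have "c + \<rho> *\<^sub>R ((1/\<rho>) *\<^sub>R (y0 - c)) = y0" using \<rho> by simp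
  moreover have "norm (y0 - c) = \<rho>" using y0 by (simp add: dist_norm norm_minus_commute)
  then have "norm ((1/\<rho>) *\<^sub>R (y0 - c)) = 1" using \<rho> by (simp only: norm_scaleR) simp
  ultimately have "\<bar>f y0\<bar> \<le> M" using M(2) by metis
  obtain d where d: "0 < d" "\<And>y. y \<in> sphere c \<rho> \<Longrightarrow> dist y y0 < d \<Longrightarrow> dist (f y) (f y0) < e / 2"
    using f y0 e unfolding continuous_on_iff by (meson half_gt_zero)
  define C where "C = \<rho> ^ DIM('a) / \<rho>\<^sup>2 / (d/2) ^ DIM('a)"
  have C: "0 \<le> C" using \<rho> d by (simp add: C_def)
  have "((\<lambda>x. 2 * M * C * (\<rho>\<^sup>2 - (dist c x)\<^sup>2)) \<longlongrightarrow> 2 * M * C * (\<rho>\<^sup>2 - (dist c y0)\<^sup>2)) (at y0 within ball c \<rho>)"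
    by (intro tendsto_intros)
  then have ev1: "\<forall>\<^sub>F x in at y0 within ball c \<rho>. 2 * M * C * (\<rho>\<^sup>2 - (dist c x)\<^sup>2) < e / 2"
    using e y0 by (intro order_tendstoD(2)) auto
  have ev2: "\<forall>\<^sub>F x in at y0 within ball c \<rho>. x \<in> ball c \<rho> \<and> dist x y0 < d / 2"
    unfolding eventually_at using d by (intro exI[of _ "d / 2"]) auto
  show "\<forall>\<^sub>F x in at y0 within ball c \<rho>. dist (h x) (f y0) < e"
    using ev1 ev2
  proof eventually_elim
    case (elim x)
    then have x: "dist c x < \<rho>" "dist x y0 < d / 2" by auto
    note I = kernel_integrable[OF x(1)]
    have sq: "0 \<le> \<rho>\<^sup>2 - (dist c x)\<^sup>2" using x \<rho> by (simp add: power_mono)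
    have "h x - f y0 = (\<integral>z. poisson_kernel c \<rho> x (dirn z) * f (c + \<rho> *\<^sub>R dirn z) \<partial>unif)
        - f y0 * (\<integral>z. poisson_kernel c \<rho> x (dirn z) \<partial>unif)"
      by (simp add: poisson_integral_def integral_poisson_kernel[OF \<rho> x(1)])
    also have "\<dots> = (\<integral>z. poisson_kernel c \<rho> x (dirn z) * (f (c + \<rho> *\<^sub>R dirn z) - f y0) \<partial>unif)"
      using I by (simp add: right_diff_distrib mult.commute)
    finally have "\<bar>h x - f y0\<bar> = \<bar>\<integral>z. poisson_kernel c \<rho> x (dirn z) * (f (c + \<rho> *\<^sub>R dirn z) - f y0) \<partial>unif\<bar>"
      by simp
    also have "\<dots> \<le> (\<integral>z. e/2 * poisson_kernel c \<rho> x (dirn z) + 2 * M * C * (\<rho>\<^sup>2 - (dist c x)\<^sup>2) \<partial>unif)"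
    proof (rule order_trans[OF integral_abs_bound integral_unif_mono])
      have "integrable unif (\<lambda>z. poisson_kernel c \<rho> x (dirn z) * (f (c + \<rho> *\<^sub>R dirn z) - f y0))"
        using I by (simp add: right_diff_distrib)
      then show "integrable unif (\<lambda>z. \<bar>poisson_kernel c \<rho> x (dirn z) * (f (c + \<rho> *\<^sub>R dirn z) - f y0)\<bar>)"
        by (rule integrable_abs)
      show "integrable unif (\<lambda>z. e/2 * poisson_kernel c \<rho> x (dirn z) + 2 * M * C * (\<rho>\<^sup>2 - (dist c x)\<^sup>2))"
        using I by simp
      fix z :: 'a
      define y where "y = c + \<rho> *\<^sub>R dirn z"
      have y: "y \<in> sphere c \<rho>" using \<rho> by (simp add: y_def dist_norm)
      have k0: "0 \<le> poisson_kernel c \<rho> x (dirn z)" by (rule poisson_kernel_nonneg[OF \<rho> x(1)])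
      show "\<bar>poisson_kernel c \<rho> x (dirn z) * (f (c + \<rho> *\<^sub>R dirn z) - f y0)\<bar> \<le>
          e/2 * poisson_kernel c \<rho> x (dirn z) + 2 * M * C * (\<rho>\<^sup>2 - (dist c x)\<^sup>2)"
      proof (cases "dist y y0 < d")
        case True
        then have "\<bar>f y - f y0\<bar> \<le> e / 2" using d(2)[OF y True] by (simp add: dist_real_def)
        then have "poisson_kernel c \<rho> x (dirn z) * \<bar>f y - f y0\<bar> \<le> poisson_kernel c \<rho> x (dirn z) * (e/2)"
          using k0 by (rule mult_left_mono)
        moreover have "0 \<le> 2 * M * C * (\<rho>\<^sup>2 - (dist c x)\<^sup>2)" using M C sq by simp
        ultimately show ?thesis using k0 by (simp add: abs_mult y_def mult.commute)
      next
        case False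
        have "d / 2 \<le> dist x y" using False x(2) dist_triangle[of y y0 x] by (simp add: dist_commute)
        then have "(\<rho>\<^sup>2 - (dist c x)\<^sup>2) / dist x y ^ DIM('a) \<le> (\<rho>\<^sup>2 - (dist c x)\<^sup>2) / (d/2) ^ DIM('a)"
          using sq d by (intro frac_le power_mono) auto
        then have "poisson_kernel c \<rho> x (dirn z) \<le> C * (\<rho>\<^sup>2 - (dist c x)\<^sup>2)"
          using \<rho> mult_left_mono[of "(\<rho>\<^sup>2 - (dist c x)\<^sup>2) / dist x y ^ DIM('a)" "(\<rho>\<^sup>2 - (dist c x)\<^sup>2) / (d/2) ^ DIM('a)" "\<rho> ^ DIM('a) / \<rho>\<^sup>2"]
          by (simp add: poisson_kernel_def C_def y_def)
        moreover have "\<bar>f y - f y0\<bar> \<le> 2 * M"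
          using M(2)[of "dirn z"] \<open>\<bar>f y0\<bar> \<le> M\<close> abs_triangle_ineq4[of "f y" "f y0"] by (simp add: y_def)
        ultimately have "poisson_kernel c \<rho> x (dirn z) * \<bar>f y - f y0\<bar> \<le> (C * (\<rho>\<^sup>2 - (dist c x)\<^sup>2)) * (2 * M)"
          using k0 C sq by (intro mult_mono) auto
        moreover have "0 \<le> e/2 * poisson_kernel c \<rho> x (dirn z)" using e k0 by simp
        moreover have "(C * (\<rho>\<^sup>2 - (dist c x)\<^sup>2)) * (2 * M) = 2 * M * C * (\<rho>\<^sup>2 - (dist c x)\<^sup>2)" by simp
        moreover have "\<bar>poisson_kernel c \<rho> x (dirn z) * (f y - f y0)\<bar> = poisson_kernel c \<rho> x (dirn z) * \<bar>f y - f y0\<bar>"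
          using k0 by (simp add: abs_mult)
        ultimately show ?thesis unfolding y_def by linarith
      qed
    qed
    also have "\<dots> = e/2 + 2 * M * C * (\<rho>\<^sup>2 - (dist c x)\<^sup>2)"
      using I by (simp add: integral_poisson_kernel[OF \<rho> x(1)])
    also have "\<dots> < e" using elim(1) by simp
    finally show ?case by (simp add: dist_real_def)
  qed
qed

end

subsection \<open>Superharmonic functions and Perron solutions\<close>

text \<open>The inequality is asked for small radii only and up to a cubic error whose constant may
  depend on the point. Such a condition can be verified with a different dominating function at each
  point; the mean inequality on all closed balls in \<open>S\<close> is recovered in
  \<open>local_super_cont_superharmonic_on\<close>.\<close>

definition local_super :: "'a::euclidean_space set \<Rightarrow> ('a \<Rightarrow> real) \<Rightarrow> bool" where
  "local_super S w \<longleftrightarrow> open S \<and> continuous_on S w \<and>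
     (\<forall>z\<in>S. \<exists>K. \<exists>e>0. cball z e \<subseteq> S \<and>
        (\<forall>r. 0 < r \<and> r < e \<longrightarrow> (\<integral>y. w (z + r *\<^sub>R y) \<partial>unif) \<le> w z + K * r ^ 3))"

lemma integrable_unif_ball:
  fixes w :: "'a::euclidean_space \<Rightarrow> real"
  assumes "continuous_on S w" "cball z r \<subseteq> S" "0 \<le> r"
  shows "integrable unif (\<lambda>y. w (z + r *\<^sub>R y))"
  by (rule integrable_unif_cont[OF continuous_on_cball_dirn(2)[OF continuous_on_subset[OF assms(1,2)] assms(3)]]) simp

lemma local_superI_mean:
  fixes w :: "'a::euclidean_space \<Rightarrow> real"
  assumes "open S" "continuous_on S w"
    and "\<And>z r. 0 < r \<Longrightarrow> cball z r \<subseteq> S \<Longrightarrow> (\<integral>y. w (z + r *\<^sub>R y) \<partial>unif) \<le> w z"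
  shows "local_super S w"
  unfolding local_super_def
proof (intro conjI ballI assms(1,2))
  fix z assume "z \<in> S"
  then obtain e where e: "0 < e" "cball z e \<subseteq> S" using assms(1) open_contains_cball by blast
  have "(\<integral>y. w (z + r *\<^sub>R y) \<partial>unif) \<le> w z + 0 * r ^ 3" if "0 < r" "r < e" for r
  proof -
    have "cball z r \<subseteq> S" using e(2) that by (auto simp: subset_iff)
    then show ?thesis using assms(3)[OF that(1)] by simp
  qed
  then show "\<exists>K. \<exists>e>0. cball z e \<subseteq> S \<and> (\<forall>r. 0 < r \<and> r < e \<longrightarrow> (\<integral>y. w (z + r *\<^sub>R y) \<partial>unif) \<le> w z + K * r ^ 3)"
    using e by blast
qed

lemma local_super_add:
  fixes v w :: "'a::euclidean_space \<Rightarrow> real"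
  assumes v: "local_super S v" and w: "local_super S w"
  shows "local_super S (\<lambda>x. v x + w x)"
  unfolding local_super_def
proof (intro conjI ballI)
  show "open S" "continuous_on S (\<lambda>x. v x + w x)"
    using v w by (auto simp: local_super_def intro: continuous_on_add)
  fix z assume z: "z \<in> S"
  obtain K e where e: "0 < e" "cball z e \<subseteq> S"
    and K: "\<And>r. 0 < r \<Longrightarrow> r < e \<Longrightarrow> (\<integral>y. v (z + r *\<^sub>R y) \<partial>unif) \<le> v z + K * r ^ 3"
    using v z unfolding local_super_def by blast
  obtain K' e' where e': "0 < e'" "cball z e' \<subseteq> S"
    and K': "\<And>r. 0 < r \<Longrightarrow> r < e' \<Longrightarrow> (\<integral>y. w (z + r *\<^sub>R y) \<partial>unif) \<le> w z + K' * r ^ 3"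
    using w z unfolding local_super_def by blast
  have "(\<integral>y. v (z + r *\<^sub>R y) + w (z + r *\<^sub>R y) \<partial>unif) \<le> v z + w z + (K + K') * r ^ 3"
    if r: "0 < r" "r < min e e'" for r
  proof -
    have sub: "cball z r \<subseteq> S" using e(2) r by (auto simp: subset_iff)
    have "integrable unif (\<lambda>y. v (z + r *\<^sub>R y))" "integrable unif (\<lambda>y. w (z + r *\<^sub>R y))"
      using v w sub r by (auto simp: local_super_def intro: integrable_unif_ball)
    then show ?thesis using K[of r] K'[of r] r by (simp add: distrib_right)
  qed
  moreover have "cball z (min e e') \<subseteq> S" using e(2) by (auto simp: subset_iff)
  ultimately show "\<exists>K. \<exists>e>0. cball z e \<subseteq> S \<and>
      (\<forall>r. 0 < r \<and> r < e \<longrightarrow> (\<integral>y. v (z + r *\<^sub>R y) + w (z + r *\<^sub>R y) \<partial>unif) \<le> v z + w z + K * r ^ 3)"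
    using e(1) e'(1) by (intro exI[of _ "K + K'"] exI[of _ "min e e'"]) auto
qed

lemma local_super_subset:
  assumes "local_super S w" "T \<subseteq> S" "open T"
  shows "local_super T w"
  unfolding local_super_def
proof (intro conjI ballI assms(3))
  show "continuous_on T w" using assms by (auto simp: local_super_def intro: continuous_on_subset)
  fix z assume z: "z \<in> T"
  obtain d where d: "0 < d" "cball z d \<subseteq> T" using assms(3) z open_contains_cball by blast
  obtain K e where e: "0 < e"
    and K: "\<And>r. 0 < r \<Longrightarrow> r < e \<Longrightarrow> (\<integral>y. w (z + r *\<^sub>R y) \<partial>unif) \<le> w z + K * r ^ 3"
    using assms z unfolding local_super_def by blast
  have "cball z (min e d) \<subseteq> T" using d(2) by (auto simp: subset_iff)
  then show "\<exists>K. \<exists>e>0. cball z e \<subseteq> T \<and> (\<forall>r. 0 < r \<and> r < e \<longrightarrow> (\<integral>y. w (z + r *\<^sub>R y) \<partial>unif) \<le> w z + K * r ^ 3)"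
    using e d K by (intro exI[of _ K] exI[of _ "min e d"]) auto
qed

lemma integral_unif_inner: "(\<integral>y. y \<bullet> v \<partial>unif) = 0"
proof -
  have "C2_on UNIV (\<lambda>y. y \<bullet> v) (\<lambda>_. v) (\<lambda>_ _. 0)"
    unfolding C2_on_def by (auto intro!: derivative_eq_intros simp: inner_commute)
  from mean_eq_of_laplacian_eq[OF this, of 1 0] show ?thesis by simp
qed

lemma integral_unif_inner_self_pos: "0 < (\<integral>y. y \<bullet> y \<partial>(unif::'a::euclidean_space measure))"
proof -
  have m: "(\<lambda>y::'a. indicator (ball 0 (1/2)) y :: real) \<in> borel_measurable unif"
    by (rule borel_measurable_indicator_unif)
  have I: "integrable unif (\<lambda>y::'a. indicator (ball 0 (1/2)) y :: real)"
    using integrable_unif_mult[OF integrable_unif_const[of 1] m] by (simp add: indicator_def)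
  have half: "(\<integral>y. indicator (ball 0 (1/2)) y \<partial>(unif::'a measure)) = (1/2 :: real) ^ DIM('a)"
    using integral_unif_subball[of "\<lambda>_::'a. 1" "1/2"] by simp
  have "(1/2::real) ^ DIM('a) < 1" by (simp add: power_less_one_iff)
  then have "0 < 1/4 * (1 - (1/2::real) ^ DIM('a))" by simp
  also have "\<dots> = (\<integral>y. 1/4 * (1 - indicator (ball 0 (1/2)) y) \<partial>(unif::'a measure))"
    using Bochner_Integration.integral_diff[OF integrable_unif_const[of 1] I] half by simp
  also have "\<dots> \<le> (\<integral>y. y \<bullet> y \<partial>(unif::'a measure))"
  proof (rule integral_unif_mono)
    show "integrable unif (\<lambda>y::'a. 1/4 * (1 - indicator (ball 0 (1/2)) y) :: real)"
      by (intro integrable_mult_right Bochner_Integration.integrable_diff I integrable_unif_const)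
    show "integrable unif (\<lambda>y::'a. y \<bullet> y)" by (intro integrable_unif_cont continuous_intros)
    fix y :: 'a
    show "1/4 * (1 - indicator (ball 0 (1/2)) y) \<le> y \<bullet> y"
    proof (cases "norm y < 1/2")
      case False
      then have "(1/2)\<^sup>2 \<le> (norm y)\<^sup>2" by (intro power_mono) auto
      then show ?thesis using False by (simp add: indicator_def dot_square_norm power2_eq_square)
    qed (simp add: indicator_def)
  qed
  finally show ?thesis .
qed

(* Subtracting a small multiple of |x|^2 makes w strictly superharmonic, so an interior minimum is impossible. *)
lemma min_principle:
  fixes w :: "'a::euclidean_space \<Rightarrow> real"
  assumes w: "local_super S w" and S: "bounded S"
    and bd: "\<And>y e. y \<in> frontier S \<Longrightarrow> 0 < e \<Longrightarrow> \<forall>\<^sub>F x in at y within S. - e < w x"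
    and x1: "x1 \<in> S"
  shows "0 \<le> w x1"
proof (rule ccontr)
  assume "\<not> 0 \<le> w x1"
  define a where "a = - w x1 / 2"
  have a: "0 < a" using \<open>\<not> 0 \<le> w x1\<close> by (simp add: a_def)
  have oS: "open S" and cw: "continuous_on S w" using w by (auto simp: local_super_def)
  obtain B where B: "0 < B" "\<And>x. x \<in> S \<Longrightarrow> norm x \<le> B" using S bounded_pos by blast
  define D where "D = (2 * B)\<^sup>2"
  have D: "0 < D" using B by (simp add: D_def)
  have nD: "(norm (x - x1))\<^sup>2 \<le> D" if "x \<in> S" for x
    using norm_triangle_ineq4[of x x1] B(2)[OF that] B(2)[OF x1] unfolding D_def by (intro power_mono) auto
  \<comment> \<open>On \<open>S\<close> the perturbation is at most \<open>a\<close>, half the depth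
    of \<open>w\<close> at \<open>x1\<close>. Hence outside \<open>A\<close> the function
    \<open>W\<close> stays above \<open>W x1\<close>, and a minimum over \<open>A\<close> is a
    minimum over \<open>S\<close>.\<close>
  define \<eta> where "\<eta> = a / D"
  have \<eta>: "0 < \<eta>" "\<eta> * D = a" using a D by (simp_all add: \<eta>_def)
  define W where "W x = w x - \<eta> * (norm (x - x1))\<^sup>2" for x
  \<comment> \<open>The boundary condition keeps this sublevel set away from the frontier, so it is
    compact although \<open>S\<close> is open.\<close>
  define A where "A = {x \<in> S. w x \<le> - a}"
  have "x1 \<in> A" using x1 a by (simp add: A_def a_def)
  have "closed A"
    unfolding closed_sequential_limits
  proof (intro allI impI)
    fix X l assume X: "(\<forall>n. X n \<in> A) \<and> X \<longlonglongrightarrow> l"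
    have lS: "l \<in> closure S" using X unfolding closure_sequential by (auto simp: A_def)
    have "l \<in> S"
    proof (rule ccontr)
      assume "l \<notin> S"
      then have "l \<in> frontier S" using lS oS by (simp add: frontier_def interior_open)
      from bd[OF this a] obtain d where d: "0 < d" "\<And>x. x \<in> S \<Longrightarrow> x \<noteq> l \<Longrightarrow> dist x l < d \<Longrightarrow> - a < w x"
        by (auto simp: eventually_at)
      obtain n where "dist (X n) l < d" using X d(1) unfolding lim_sequentially by (meson order_refl)
      then show False using d(2)[of "X n"] X \<open>l \<notin> S\<close> by (auto simp: A_def not_le[symmetric])
    qed
    moreover have "(\<lambda>n. w (X n)) \<longlonglongrightarrow> w l"
      using X \<open>l \<in> S\<close> by (intro continuous_on_tendsto_compose[OF cw]) (auto simp: A_def)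
    then have "w l \<le> - a" by (rule LIMSEQ_le_const2) (use X in \<open>auto simp: A_def\<close>)
    ultimately show "l \<in> A" by (simp add: A_def)
  qed
  moreover have "bounded A" using S by (rule bounded_subset) (auto simp: A_def)
  ultimately have "compact A" by (simp add: compact_eq_bounded_closed)
  moreover have "continuous_on A W" unfolding W_def
    by (intro continuous_intros continuous_on_subset[OF cw]) (auto simp: A_def)
  ultimately obtain x0 where x0: "x0 \<in> A" "\<And>x. x \<in> A \<Longrightarrow> W x0 \<le> W x"
    using continuous_attains_inf[of A W] \<open>x1 \<in> A\<close> by blast
  have Wmin: "W x0 \<le> W x" if "x \<in> S" for x
  proof (cases "x \<in> A")
    case False
    then have "- a < w x" using that by (simp add: A_def)
    moreover have "\<eta> * (norm (x - x1))\<^sup>2 \<le> a"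
      using mult_left_mono[OF nD[OF that], of \<eta>] \<eta> by simp
    moreover have "W x1 = - 2 * a" by (simp add: W_def a_def)
    ultimately have "W x1 \<le> W x" by (simp add: W_def)
    then show ?thesis using x0(2)[OF \<open>x1 \<in> A\<close>] by simp
  qed (use x0 in simp)
  have x0S: "x0 \<in> S" using x0 by (simp add: A_def)
  obtain K e where e: "0 < e" "cball x0 e \<subseteq> S"
    and K: "\<And>r. 0 < r \<Longrightarrow> r < e \<Longrightarrow> (\<integral>y. w (x0 + r *\<^sub>R y) \<partial>unif) \<le> w x0 + K * r ^ 3"
    using w x0S unfolding local_super_def by blast
  define \<kappa> where "\<kappa> = (\<integral>y. y \<bullet> y \<partial>(unif::'a measure))"
  have \<kappa>: "0 < \<kappa>" unfolding \<kappa>_def by (rule integral_unif_inner_self_pos)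
  \<comment> \<open>Minimality of \<open>W\<close> at \<open>x0\<close> puts \<open>w\<close> above
    a paraboloid there, so its mean exceeds \<open>w x0\<close> by at least
    \<open>\<eta> * r\<^sup>2 * \<kappa>\<close>. For small \<open>r\<close> the cubic error cannot
    absorb this.\<close>
  have key: "\<eta> * \<kappa> \<le> K * r" if r: "0 < r" "r < e" for r
  proof -
    have sub: "cball x0 r \<subseteq> S" using e(2) r by (auto simp: subset_iff)
    have low: "w x0 + (2 * \<eta> * r) * (y \<bullet> (x0 - x1)) + (\<eta> * r\<^sup>2) * (y \<bullet> y) \<le> w (x0 + r *\<^sub>R y)" if y: "norm y < 1" for y
    proof -
      have "x0 + r *\<^sub>R y \<in> S" using sub r y by (auto simp: subset_iff dist_norm mult_left_le)
      from Wmin[OF this] have "w x0 - \<eta> * (norm (x0 - x1))\<^sup>2 \<le> w (x0 + r *\<^sub>R y) - \<eta> * (norm ((x0 - x1) + r *\<^sub>R y))\<^sup>2"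
        by (simp add: W_def algebra_simps)
      moreover have "(norm ((x0 - x1) + r *\<^sub>R y))\<^sup>2 = (norm (x0 - x1))\<^sup>2 + 2 * r * (y \<bullet> (x0 - x1)) + r\<^sup>2 * (y \<bullet> y)"
        unfolding power2_norm_eq_inner
        by (simp only: inner_add_left inner_add_right inner_scaleR_left inner_scaleR_right
            inner_commute[of "x0 - x1" y] power2_eq_square) (simp only: algebra_simps)
      ultimately show ?thesis by (simp only: distrib_left)
    qed
    have I: "integrable unif (\<lambda>y. y \<bullet> (x0 - x1))" "integrable unif (\<lambda>y::'a. y \<bullet> y)"
      by (intro integrable_unif_cont continuous_intros)+
    have "w x0 + \<eta> * r\<^sup>2 * \<kappa> = (\<integral>y. w x0 + (2 * \<eta> * r) * (y \<bullet> (x0 - x1)) + (\<eta> * r\<^sup>2) * (y \<bullet> y) \<partial>unif)"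
      using I by (simp add: \<kappa>_def integral_unif_inner del: inner_diff_right)
    also have "\<dots> \<le> (\<integral>y. w (x0 + r *\<^sub>R y) \<partial>unif)"
      by (rule integral_unif_mono[OF _ integrable_unif_ball[OF cw sub] low]) (use I r in auto)
    also have "\<dots> \<le> w x0 + K * r ^ 3" by (rule K[OF r])
    finally have "r\<^sup>2 * (\<eta> * \<kappa>) \<le> r\<^sup>2 * (K * r)" by (simp add: power2_eq_square power3_eq_cube algebra_simps)
    then show ?thesis using r by simp
  qed
  have "((\<lambda>r. K * r) \<longlongrightarrow> K * 0) (at_right 0)" by (intro tendsto_intros)
  then have "\<forall>\<^sub>F r in at_right 0. K * r < \<eta> * \<kappa>"
    using \<eta> \<kappa> by (intro order_tendstoD(2)) auto
  moreover have "\<forall>\<^sub>F r in at_right 0. 0 < r \<and> r < e"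
    using e(1) by (auto simp: eventually_at_right_less eventually_at_right intro!: exI[of _ e])
  ultimately have "\<forall>\<^sub>F r in at_right (0::real). False"
    by eventually_elim (use key in force)
  then show False by (simp add: trivial_limit_def[symmetric])
qed

section \<open>From local to global superharmonicity\<close>

lemma measure_lebesgue_ball_pos: "0 < r \<Longrightarrow> 0 < measure lebesgue (ball (x::'a::euclidean_space) r)"
  using content_ball_pos[of r x] by (simp add: measure_completion)

lemma cont_superharmonic_on_mean:
  assumes "cont_superharmonic_on S w" "0 < r" "cball x r \<subseteq> S"
  shows "(\<integral>y. w (x + r *\<^sub>R y) \<partial>unif) \<le> w x"
proof -
  have "continuous_on (cball x r) w"
    using assms by (auto simp: cont_superharmonic_on_def intro: continuous_on_subset)
  note eq = integral_ball_unif[OF this assms(2)]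
  have "integral (ball x r) w \<le> w x * measure lebesgue (ball x r)"
    using assms unfolding cont_superharmonic_on_def by blast
  then have "measure lebesgue (ball x r) * (\<integral>y. w (x + r *\<^sub>R y) \<partial>unif) \<le> measure lebesgue (ball x r) * w x"
    unfolding eq by (simp only: mult.commute)
  then show ?thesis using measure_lebesgue_ball_pos[OF assms(2), of x] by simp
qed

lemma cont_superharmonic_onI_mean:
  assumes "continuous_on S w"
    and "\<And>x r. 0 < r \<Longrightarrow> cball x r \<subseteq> S \<Longrightarrow> (\<integral>y. w (x + r *\<^sub>R y) \<partial>unif) \<le> w x"
  shows "cont_superharmonic_on S w"
  unfolding cont_superharmonic_on_def
proof (intro conjI allI impI assms(1), elim conjE)
  fix x r assume r: "0 < r" "cball x r \<subseteq> S"
  show "integral (ball x r) w \<le> w x * measure lebesgue (ball x r)"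
    using integral_ball_unif[OF continuous_on_subset[OF assms(1) r(2)] r(1)]
      mult_left_mono[OF assms(2)[OF r], of "measure lebesgue (ball x r)"]
    by (simp add: mult.commute)
qed

lemma cont_superharmonic_on_local: "open S \<Longrightarrow> cont_superharmonic_on S w \<Longrightarrow> local_super S w"
  by (rule local_superI_mean) (auto simp: cont_superharmonic_on_def cont_superharmonic_on_mean)

(* On each ball w dominates the Poisson integral of its own boundary values. *)
lemma local_super_cont_superharmonic_on:
  fixes w :: "'a::euclidean_space \<Rightarrow> real"
  assumes w: "local_super S w"
  shows "cont_superharmonic_on S w"
proof (rule cont_superharmonic_onI_mean)
  show cw: "continuous_on S w" using w by (simp add: local_super_def)
  fix x r assume r: "0 < r" "cball x r \<subseteq> S"
  show "(\<integral>y. w (x + r *\<^sub>R y) \<partial>unif) \<le> w x"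
  \<comment> \<open>Comparison with the Poisson integral controls its value at the centre, which is
    a mean over a sphere; taking all radii up to \<open>r\<close> yields the mean over the solid
    ball.\<close>
  proof (rule ball_mean_le_of_sphere_means[OF continuous_on_subset[OF cw r(2)] r(1)])
    fix s assume s: "0 < s" "s \<le> r"
    have sub: "cball x s \<subseteq> S" using r s by (auto simp: subset_iff)
    have "sphere x s \<subseteq> S" using sub sphere_cball by blast
    interpret poisson x s w
      using s(1) continuous_on_subset[OF cw \<open>sphere x s \<subseteq> S\<close>] by unfold_locales
    have "0 \<le> w x + - h x"
    proof (rule min_principle[where S="ball x s" and w="\<lambda>z. w z + - h z"])
      show "local_super (ball x s) (\<lambda>z. w z + - h z)"
      proof (rule local_super_add)
        show "local_super (ball x s) w"
          by (rule local_super_subset[OF w]) (use sub ball_subset_cball in blast, simp)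
        show "local_super (ball x s) (\<lambda>z. - h z)"
          by (rule local_superI_mean) (auto intro: continuous_on_minus poisson_continuous simp: poisson_mean)
      qed
      fix y e :: 'a and \<epsilon> :: real assume "y \<in> frontier (ball x s)" and e: "0 < \<epsilon>"
      then have y: "y \<in> sphere x s" using s by simp
      have "continuous_on (ball x s \<union> {y}) w"
        by (rule continuous_on_subset[OF cw]) (use sub y \<open>sphere x s \<subseteq> S\<close> in auto)
      then have "(w \<longlongrightarrow> w y) (at y within ball x s \<union> {y})" by (simp add: continuous_on)
      then have "(w \<longlongrightarrow> w y) (at y within ball x s)" by (rule tendsto_within_subset) auto
      then have "((\<lambda>z. w z + - h z) \<longlongrightarrow> w y + - w y) (at y within ball x s)"
        by (intro tendsto_intros poisson_boundary y)
      then show "\<forall>\<^sub>F z in at y within ball x s. - \<epsilon> < w z + - h z"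
        using e by (intro order_tendstoD(1)) auto
    qed (use s in auto)
    then show "(\<integral>y. w (x + s *\<^sub>R dirn y) \<partial>unif) \<le> w x" by (simp add: poisson_center)
  qed
qed

text \<open>\<open>w\<close> is itself a competitor in the infimum. The infimum is meaningful
  because the minimum principle, applied to a competitor shifted by \<open>B\<close>, bounds all of
  them from below.\<close>

lemma perron_le:
  fixes f w :: "'a::euclidean_space \<Rightarrow> real"
  assumes D0: "open D0" "bounded D0" "\<xi> \<in> D0" and f: "\<And>y. y \<in> frontier D0 \<Longrightarrow> - B \<le> f y"
    and w: "local_super D0 w" "bdd_below (w ` D0)"
      "\<And>y e. y \<in> frontier D0 \<Longrightarrow> 0 < e \<Longrightarrow> \<forall>\<^sub>F x in at y within D0. f y - e < w x"
  shows "perron D0 f \<xi> \<le> w \<xi>"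
  unfolding perron_def
proof (rule cInf_lower)
  show "w \<xi> \<in> {w \<xi> |w. cont_superharmonic_on D0 w \<and> bdd_below (w ` D0) \<and>
      (\<forall>y\<in>frontier D0. \<forall>e>0. \<forall>\<^sub>F x in at y within D0. f y - e < w x)}"
    using local_super_cont_superharmonic_on[OF w(1)] w(2,3) by blast
  show "bdd_below {w \<xi> |w. cont_superharmonic_on D0 w \<and> bdd_below (w ` D0) \<and>
      (\<forall>y\<in>frontier D0. \<forall>e>0. \<forall>\<^sub>F x in at y within D0. f y - e < w x)}"
  proof (rule bdd_belowI[of _ "- B"], clarify)
    fix w' assume w': "cont_superharmonic_on D0 w'"
      "\<forall>y\<in>frontier D0. \<forall>e>0. \<forall>\<^sub>F x in at y within D0. f y - e < w' x"
    have "0 \<le> w' \<xi> + B"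
    proof (rule min_principle[where w="\<lambda>x. w' x + B", OF _ D0(2) _ D0(3)])
      show "local_super D0 (\<lambda>x. w' x + B)"
        by (intro local_super_add cont_superharmonic_on_local D0 w' local_superI_mean) auto
      fix y and e :: real assume y: "y \<in> frontier D0" and e: "0 < e"
      then have "\<forall>\<^sub>F x in at y within D0. f y - e < w' x" using w' by blast
      then show "\<forall>\<^sub>F x in at y within D0. - e < w' x + B"
        by eventually_elim (use f[OF y] in linarith)
    qed
    then show "- B \<le> w' \<xi>" by simp
  qed
qed

text \<open>Every competitor lies above \<open>h\<close> by the minimum principle for the
  difference, with the tolerance split between the two boundary conditions. The constant
  \<open>B\<close> shows that there is a competitor.\<close>

lemma perron_ge:
  fixes f h :: "'a::euclidean_space \<Rightarrow> real"
  assumes D0: "open D0" "bounded D0" "\<xi> \<in> D0" and f: "\<And>y. y \<in> frontier D0 \<Longrightarrow> f y \<le> B"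
    and h: "local_super D0 (\<lambda>x. - h x)"
      "\<And>y e. y \<in> frontier D0 \<Longrightarrow> 0 < e \<Longrightarrow> \<forall>\<^sub>F x in at y within D0. h x < f y + e"
  shows "h \<xi> \<le> perron D0 f \<xi>"
  unfolding perron_def
proof (rule cInf_greatest)
  have "cont_superharmonic_on D0 (\<lambda>_. B)"
    by (rule cont_superharmonic_onI_mean) auto
  moreover have "\<forall>y\<in>frontier D0. \<forall>e>0. \<forall>\<^sub>F x in at y within D0. f y - e < B"
    using f by (auto intro!: always_eventually simp: less_le_trans le_less_trans) (smt (verit))
  ultimately show "{w \<xi> |w. cont_superharmonic_on D0 w \<and> bdd_below (w ` D0) \<and>
      (\<forall>y\<in>frontier D0. \<forall>e>0. \<forall>\<^sub>F x in at y within D0. f y - e < w x)} \<noteq> {}"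
    by (auto intro!: exI[of _ "\<lambda>_. B"])
  fix a assume "a \<in> {w \<xi> |w. cont_superharmonic_on D0 w \<and> bdd_below (w ` D0) \<and>
      (\<forall>y\<in>frontier D0. \<forall>e>0. \<forall>\<^sub>F x in at y within D0. f y - e < w x)}"
  then obtain w where a: "a = w \<xi>" and w: "cont_superharmonic_on D0 w"
      "\<forall>y\<in>frontier D0. \<forall>e>0. \<forall>\<^sub>F x in at y within D0. f y - e < w x" by blast
  have "0 \<le> w \<xi> + - h \<xi>"
  proof (rule min_principle[where w="\<lambda>x. w x + - h x", OF _ D0(2) _ D0(3)])
    show "local_super D0 (\<lambda>x. w x + - h x)"
      by (intro local_super_add cont_superharmonic_on_local D0 w h)
    fix y and e :: real assume y: "y \<in> frontier D0" and e: "0 < e"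
    have "\<forall>\<^sub>F x in at y within D0. f y - e/2 < w x" using w y e by simp
    moreover have "\<forall>\<^sub>F x in at y within D0. h x < f y + e/2" using h(2)[OF y, of "e/2"] e by simp
    ultimately show "\<forall>\<^sub>F x in at y within D0. - e < w x + - h x" by eventually_elim linarith
  qed
  then show "h \<xi> \<le> a" by (simp add: a)
qed

subsection \<open>Harmonic measure\<close>

lemma powr_ge_tangent:
  fixes t a :: real
  assumes "0 \<le> t" "1 \<le> a"
  shows "1 + a * (t - 1) \<le> t powr a"
proof (cases "t = 0")
  case False
  have "a * 1 powr (a - 1) * (t - 1) \<le> t powr a - 1 powr a"
  proof (rule convex_on_imp_above_tangent[OF powr_convex[OF assms(2)]])
    show "((\<lambda>x. x powr a) has_real_derivative a * 1 powr (a - 1)) (at 1 within {0<..})"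
      by (rule has_field_derivative_at_within[OF has_real_derivative_powr]) simp
  qed (use assms False in \<open>auto simp: interior_open\<close>)
  then show ?thesis by simp
qed (use assms in simp)

text \<open>Concavity for the exponent \<open>p\<close> is read off from convexity for
  \<open>1 / p\<close>, applied at the point \<open>s powr p\<close>; this includes
  \<open>x = 0\<close>.\<close>

lemma powr_le_tangent:
  fixes x x0 p :: real
  assumes "0 \<le> x" "0 < x0" "0 < p" "p < 1"
  shows "x powr p \<le> x0 powr p + p * x0 powr p * (x / x0 - 1)"
proof -
  define s where "s = x / x0"
  have s: "0 \<le> s" using assms by (simp add: s_def)
  have "1 + 1/p * (s powr p - 1) \<le> (s powr p) powr (1/p)"
    using assms by (intro powr_ge_tangent) auto
  also have "\<dots> = s" using assms s by (simp add: powr_powr)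
  finally have "p * (1 + 1/p * (s powr p - 1)) \<le> p * s" using assms by (intro mult_left_mono) auto
  then have "s powr p \<le> 1 + p * (s - 1)" using assms by (simp add: algebra_simps)
  then have "x0 powr p * s powr p \<le> x0 powr p * (1 + p * (s - 1))" by (intro mult_left_mono) auto
  moreover have "x0 powr p * s powr p = x powr p"
    using assms by (simp add: s_def powr_divide)
  ultimately show ?thesis by (simp add: s_def algebra_simps)
qed

section \<open>Integration against a harmonic measure\<close>

locale harmonic_measure =
  fixes D D0 :: "'a::euclidean_space set" and \<xi> :: 'a and \<mu> :: "'a measure"
  assumes adm: "admissible D \<xi> D0" and hm: "harmonic_measure_at D0 \<xi> \<mu>"
begin

lemma D0: "open D0" "bounded D0" "\<xi> \<in> D0" "closure D0 \<subseteq> D" "D0 \<subseteq> D" "frontier D0 \<subseteq> D"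
  using adm closure_subset[of D0] by (auto simp: admissible_def frontier_def)

lemma compact_frontier: "compact (frontier D0)"
  using D0(2) by (rule compact_frontier_bounded)

lemma sets_\<mu>: "sets \<mu> = sets (restrict_space borel (frontier D0))"
  using hm by (simp add: harmonic_measure_at_def)

lemma space_\<mu>: "space \<mu> = frontier D0"
  using sets_eq_imp_space_eq[OF sets_\<mu>] by (simp add: space_restrict_space)

sublocale finite_measure \<mu>
  using hm by (simp add: harmonic_measure_at_def)

lemma measurable_\<mu>: "continuous_on (frontier D0) f \<Longrightarrow> f \<in> borel_measurable \<mu>"
  for f :: "'a \<Rightarrow> real"
  using borel_measurable_continuous_on_restrict measurable_cong_sets[OF sets_\<mu> refl] by blast

lemma bounded_on_frontier:
  fixes f :: "'a \<Rightarrow> real"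
  assumes "continuous_on (frontier D0) f"
  obtains B where "0 < B" "\<And>y. y \<in> frontier D0 \<Longrightarrow> \<bar>f y\<bar> \<le> B"
proof -
  have "bounded (f ` frontier D0)"
    by (intro compact_imp_bounded compact_continuous_image assms compact_frontier)
  then obtain B where "0 < B" "\<forall>x\<in>f ` frontier D0. norm x \<le> B" unfolding bounded_pos by blast
  then show thesis using that[of B] by auto
qed

lemma integrable_\<mu>:
  fixes f :: "'a \<Rightarrow> real"
  assumes "continuous_on (frontier D0) f"
  shows "integrable \<mu> f"
proof -
  obtain B where "\<And>y. y \<in> frontier D0 \<Longrightarrow> \<bar>f y\<bar> \<le> B" using bounded_on_frontier[OF assms] by blast
  then show ?thesis
    by (intro integrable_const_bound[where B=B] measurable_\<mu> assms) (auto intro!: AE_I2 simp: space_\<mu>)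
qed

lemma tendsto_frontier:
  fixes w :: "'a \<Rightarrow> real"
  assumes w: "continuous_on (closure D0) w" and y: "y \<in> frontier D0"
  shows "(w \<longlongrightarrow> w y) (at y within D0)"
proof -
  have "y \<in> closure D0" using y by (simp add: frontier_def)
  then have "(w \<longlongrightarrow> w y) (at y within closure D0)" using w by (simp add: continuous_on)
  then show ?thesis by (rule tendsto_within_subset[OF _ closure_subset])
qed

text \<open>The integral is the Perron solution for the boundary values of \<open>w\<close>, and
  \<open>w\<close>, being continuous up to the closure, is a competitor for these values.\<close>

lemma integral_le_of_local_super:
  fixes w :: "'a \<Rightarrow> real"
  assumes w: "continuous_on (closure D0) w" "local_super D0 w"
  shows "(\<integral>x. w x \<partial>\<mu>) \<le> w \<xi>"
proof -
  have cf: "continuous_on (frontier D0) w"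
    by (rule continuous_on_subset[OF w(1)]) (auto simp: frontier_def)
  obtain B where B: "\<And>y. y \<in> frontier D0 \<Longrightarrow> \<bar>w y\<bar> \<le> B" using bounded_on_frontier[OF cf] by blast
  have "(\<integral>x. w x \<partial>\<mu>) = perron D0 w \<xi>" using hm cf by (simp add: harmonic_measure_at_def)
  also have "\<dots> \<le> w \<xi>"
  proof (rule perron_le[OF D0(1-3) _ w(2), where B=B])
    show "- B \<le> w y" if "y \<in> frontier D0" for y using B[OF that] by simp
    have "bounded (w ` closure D0)"
      by (intro compact_imp_bounded compact_continuous_image w) (simp add: D0 compact_closure)
    then have "bounded (w ` D0)"
      by (rule bounded_subset[OF _ image_mono[OF closure_subset]])
    then show "bdd_below (w ` D0)" by (rule bounded_imp_bdd_below)
    show "\<forall>\<^sub>F x in at y within D0. w y - e < w x" if "y \<in> frontier D0" "0 < e" for y e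
      using that by (intro order_tendstoD(1)[OF tendsto_frontier[OF w(1) that(1)]]) simp
  qed
  finally show ?thesis .
qed

lemma integral_eq_of_mean:
  fixes w :: "'a \<Rightarrow> real"
  assumes w: "continuous_on D w"
    and mean: "\<And>z r. 0 < r \<Longrightarrow> cball z r \<subseteq> D \<Longrightarrow> (\<integral>y. w (z + r *\<^sub>R y) \<partial>unif) = w z"
  shows "(\<integral>x. w x \<partial>\<mu>) = w \<xi>"
proof (rule antisym)
  have mean0: "(\<integral>y. w (z + r *\<^sub>R y) \<partial>unif) = w z" if "0 < r" "cball z r \<subseteq> D0" for z r
    using mean that D0 by blast
  note cc = continuous_on_subset[OF w D0(4)] and c0 = continuous_on_subset[OF w D0(5)]
  show "(\<integral>x. w x \<partial>\<mu>) \<le> w \<xi>"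
    by (rule integral_le_of_local_super[OF cc local_superI_mean[OF D0(1) c0]]) (simp add: mean0)
  have "(\<integral>x. - w x \<partial>\<mu>) \<le> - w \<xi>"
    by (rule integral_le_of_local_super[OF continuous_on_minus[OF cc] local_superI_mean[OF D0(1) continuous_on_minus[OF c0]]])
      (simp add: mean0)
  then show "w \<xi> \<le> (\<integral>x. w x \<partial>\<mu>)" by simp
qed

text \<open>\<open>harmonic_measure_at\<close> asks for a finite measure; the mass one results from
  testing with the constant function.\<close>

lemma measure_\<mu>: "measure \<mu> (frontier D0) = 1"
proof -
  have "(\<integral>x. 1 \<partial>\<mu>) = (1::real)"
    by (rule integral_eq_of_mean[of "\<lambda>_. 1"]) auto
  then show ?thesis by (simp add: space_\<mu>)
qed

lemma integral_const_\<mu> [simp]: "(\<integral>x. c \<partial>\<mu>) = (c::real)"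
  by (simp add: space_\<mu> measure_\<mu>)

lemma sets_level:
  fixes v :: "'a \<Rightarrow> real"
  assumes "continuous_on (frontier D0) v"
  shows "{x \<in> frontier D0. l \<le> \<bar>v x\<bar>} \<in> sets \<mu>"
proof -
  have "(\<lambda>x. \<bar>v x\<bar>) \<in> borel_measurable \<mu>"
    by (intro measurable_\<mu> continuous_on_rabs assms)
  then have "(\<lambda>x. \<bar>v x\<bar>) -` {l..} \<inter> space \<mu> \<in> sets \<mu>" by (rule measurable_sets) simp
  also have "(\<lambda>x. \<bar>v x\<bar>) -` {l..} \<inter> space \<mu> = {x \<in> frontier D0. l \<le> \<bar>v x\<bar>}"
    by (auto simp: space_\<mu>)
  finally show ?thesis .
qed

text \<open>Markov's inequality for a general majorant. In the weak-type bounds \<open>g\<close> is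
  a special function plus the term that it has to be compared with.\<close>

lemma measure_level_le:
  fixes v g :: "'a \<Rightarrow> real"
  assumes v: "continuous_on (frontier D0) v" and g: "continuous_on (frontier D0) g"
    and le: "\<And>x. x \<in> frontier D0 \<Longrightarrow> 0 \<le> g x" "\<And>x. x \<in> frontier D0 \<Longrightarrow> l \<le> \<bar>v x\<bar> \<Longrightarrow> 1 \<le> g x"
  shows "measure \<mu> {x \<in> frontier D0. l \<le> \<bar>v x\<bar>} \<le> (\<integral>x. g x \<partial>\<mu>)"
proof -
  let ?A = "{x \<in> frontier D0. l \<le> \<bar>v x\<bar>}"
  have A: "?A \<in> sets \<mu>" by (rule sets_level[OF v])
  have "measure \<mu> ?A = (\<integral>x. indicator ?A x \<partial>\<mu>)"
  proof -
    have "?A \<inter> frontier D0 = ?A" by auto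
    then show ?thesis by (simp add: space_\<mu>)
  qed
  also have "\<dots> \<le> (\<integral>x. g x \<partial>\<mu>)"
  proof (rule integral_mono[OF _ integrable_\<mu>[OF g]])
    show "integrable \<mu> (indicator ?A :: 'a \<Rightarrow> real)"
      using A by (intro integrable_real_indicator) (simp_all add: emeasure_eq_measure)
    show "indicator ?A x \<le> g x" if "x \<in> space \<mu>" for x
      using le[of x] that by (auto simp: space_\<mu> indicator_def)
  qed
  finally show ?thesis .
qed

end

text \<open>The density lives on the ball and is moved to the sphere by radial projection. The
  target carries the trace of the Borel sets, as \<open>harmonic_measure_at\<close> prescribes for
  the frontier.\<close>

definition poisson_measure :: "'a::euclidean_space \<Rightarrow> real \<Rightarrow> 'a \<Rightarrow> 'a measure" where
  "poisson_measure c \<rho> x = distr (density unif (\<lambda>z. ennreal (poisson_kernel c \<rho> x (dirn z))))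
     (restrict_space borel (sphere c \<rho>)) (\<lambda>z. c + \<rho> *\<^sub>R dirn z)"

context
  fixes c x :: "'a::euclidean_space" and \<rho> :: real
  assumes \<rho>: "0 < \<rho>" and x: "dist c x < \<rho>"
begin

lemma poisson_map_measurable:
  "(\<lambda>z. c + \<rho> *\<^sub>R dirn z) \<in> measurable (density unif (\<lambda>z. ennreal (poisson_kernel c \<rho> x (dirn z))))
     (restrict_space borel (sphere c \<rho>))"
proof -
  have "(\<lambda>z. c + \<rho> *\<^sub>R dirn z) \<in> borel_measurable unif"
    by (rule borel_measurable_unif_borelI) measurable
  then show ?thesis using \<rho> by (intro measurable_restrict_space2) (auto simp: dist_norm)
qed

lemma poisson_kernel_measurable: "(\<lambda>z. poisson_kernel c \<rho> x (dirn z)) \<in> borel_measurable unif"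
  by (rule borel_measurable_integrable[OF integrable_dirn_comp[OF continuous_on_poisson_kernel[OF \<rho> x]]])

lemma nn_integral_poisson_kernel: "(\<integral>\<^sup>+z. ennreal (poisson_kernel c \<rho> x (dirn z)) \<partial>unif) = 1"
  using nn_integral_eq_integral[OF integrable_dirn_comp[OF continuous_on_poisson_kernel[OF \<rho> x]]]
    integral_poisson_kernel[OF \<rho> x] poisson_kernel_nonneg[OF \<rho> x] by simp

lemma finite_poisson_measure: "finite_measure (poisson_measure c \<rho> x)"
proof -
  let ?d = "density unif (\<lambda>z. ennreal (poisson_kernel c \<rho> x (dirn z)))"
  have "emeasure ?d (space ?d) = (\<integral>\<^sup>+z. ennreal (poisson_kernel c \<rho> x (dirn z)) * indicator (space unif) z \<partial>unif)"
    using poisson_kernel_measurable sets.top[of "unif :: 'a measure"]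
    by (subst emeasure_density) auto
  also have "\<dots> = (\<integral>\<^sup>+z. ennreal (poisson_kernel c \<rho> x (dirn z)) \<partial>unif)"
    by (rule nn_integral_cong) simp
  finally have "finite_measure ?d"
    by (intro finite_measureI) (simp add: nn_integral_poisson_kernel)
  then show ?thesis
    unfolding poisson_measure_def by (rule finite_measure.finite_measure_distr[OF _ poisson_map_measurable])
qed

lemma integral_poisson_measure:
  fixes f :: "'a \<Rightarrow> real"
  assumes "f \<in> borel_measurable (restrict_space borel (sphere c \<rho>))"
  shows "(\<integral>y. f y \<partial>poisson_measure c \<rho> x) = poisson_integral c \<rho> f x"
proof -
  have m: "(\<lambda>z. f (c + \<rho> *\<^sub>R dirn z)) \<in> borel_measurable unif"
    using measurable_compose[OF poisson_map_measurable assms] by simp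
  have "(\<integral>y. f y \<partial>poisson_measure c \<rho> x) =
      (\<integral>z. f (c + \<rho> *\<^sub>R dirn z) \<partial>density unif (\<lambda>z. ennreal (poisson_kernel c \<rho> x (dirn z))))"
    unfolding poisson_measure_def by (rule integral_distr[OF poisson_map_measurable assms])
  also have "\<dots> = poisson_integral c \<rho> f x"
    unfolding poisson_integral_def
    by (subst integral_density[OF m poisson_kernel_measurable]) (auto intro!: AE_I2 poisson_kernel_nonneg[OF \<rho> x])
  finally show ?thesis .
qed

text \<open>The Poisson integral \<open>h\<close> tends to \<open>f\<close> at the boundary, and
  both \<open>h\<close> and \<open>- h\<close> satisfy the mean inequality. So \<open>h\<close>
  bounds the Perron solution from above as a competitor and from below by comparison.\<close>

lemma harmonic_measure_at_poisson: "harmonic_measure_at (ball c \<rho>) x (poisson_measure c \<rho> x)"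
  unfolding harmonic_measure_at_def
proof (intro conjI allI impI finite_poisson_measure)
  have fr: "frontier (ball c \<rho>) = sphere c \<rho>" using \<rho> by simp
  show "sets (poisson_measure c \<rho> x) = sets (restrict_space borel (frontier (ball c \<rho>)))"
    unfolding fr by (simp add: poisson_measure_def)
  fix f :: "'a \<Rightarrow> real" assume "continuous_on (frontier (ball c \<rho>)) f"
  then have f: "continuous_on (sphere c \<rho>) f" by (simp only: fr)
  interpret poisson c \<rho> f using \<rho> f by unfold_locales
  obtain M where M: "0 < M" "\<And>\<theta>. norm \<theta> = 1 \<Longrightarrow> \<bar>f (c + \<rho> *\<^sub>R \<theta>)\<bar> \<le> M" using f_bound by blast
  have fM: "\<bar>f y\<bar> \<le> M" if "y \<in> frontier (ball c \<rho>)" for y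
  proof -
    have "c + \<rho> *\<^sub>R ((1/\<rho>) *\<^sub>R (y - c)) = y" using \<rho> by simp
    moreover have "norm (y - c) = \<rho>" using that by (simp add: fr dist_norm norm_minus_commute)
    then have "norm ((1/\<rho>) *\<^sub>R (y - c)) = 1" using \<rho> by (simp only: norm_scaleR) simp
    ultimately show ?thesis using M(2) by metis
  qed
  have hM: "\<bar>h z\<bar> \<le> M" if "z \<in> ball c \<rho>" for z
  proof -
    have z: "dist c z < \<rho>" using that by simp
    have "\<bar>h z\<bar> \<le> (\<integral>w. M * poisson_kernel c \<rho> z (dirn w) \<partial>unif)"
      unfolding poisson_integral_def
    proof (rule order_trans[OF integral_abs_bound integral_unif_mono])
      show "integrable unif (\<lambda>w. \<bar>poisson_kernel c \<rho> z (dirn w) * f (c + \<rho> *\<^sub>R dirn w)\<bar>)"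
        using kernel_integrable[OF z] by (intro integrable_abs)
      show "integrable unif (\<lambda>w. M * poisson_kernel c \<rho> z (dirn w))"
        using kernel_integrable[OF z] by simp
      fix w :: 'a
      have "poisson_kernel c \<rho> z (dirn w) * \<bar>f (c + \<rho> *\<^sub>R dirn w)\<bar> \<le> poisson_kernel c \<rho> z (dirn w) * M"
        by (intro mult_left_mono M poisson_kernel_nonneg[OF \<rho> z] norm_dirn)
      then show "\<bar>poisson_kernel c \<rho> z (dirn w) * f (c + \<rho> *\<^sub>R dirn w)\<bar> \<le> M * poisson_kernel c \<rho> z (dirn w)"
        using poisson_kernel_nonneg[OF \<rho> z, of "dirn w"] by (simp add: abs_mult mult.commute)
    qed
    then show ?thesis by (simp add: integral_poisson_kernel[OF \<rho> z])
  qed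
  have lim: "(h \<longlongrightarrow> f y) (at y within ball c \<rho>)" if "y \<in> frontier (ball c \<rho>)" for y
    using poisson_boundary[of y] that by (simp add: fr)
  have "(\<integral>y. f y \<partial>poisson_measure c \<rho> x) = h x"
    by (rule integral_poisson_measure[OF borel_measurable_continuous_on_restrict[OF f]])
  also have "\<dots> = perron (ball c \<rho>) f x"
  proof (rule antisym)
    show "perron (ball c \<rho>) f x \<le> h x"
    proof (rule perron_le[where B=M])
      show "local_super (ball c \<rho>) h"
        by (rule local_superI_mean) (auto simp: poisson_continuous poisson_mean)
      show "bdd_below (h ` ball c \<rho>)"
        by (rule bdd_belowI[of _ "- M"]) (use hM in \<open>force simp: abs_le_iff\<close>)
      show "\<forall>\<^sub>F z in at y within ball c \<rho>. f y - e < h z" if "y \<in> frontier (ball c \<rho>)" "0 < e" for y e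
        using that(2) by (intro order_tendstoD(1)[OF lim[OF that(1)]]) simp
      show "- M \<le> f y" if "y \<in> frontier (ball c \<rho>)" for y using fM[OF that] by simp
    qed (use x in auto)
    show "h x \<le> perron (ball c \<rho>) f x"
    proof (rule perron_ge[where B=M])
      show "local_super (ball c \<rho>) (\<lambda>z. - h z)"
        by (rule local_superI_mean) (auto simp: poisson_mean intro: continuous_on_minus poisson_continuous)
      show "\<forall>\<^sub>F z in at y within ball c \<rho>. h z < f y + e" if "y \<in> frontier (ball c \<rho>)" "0 < e" for y e
        using that(2) by (intro order_tendstoD(2)[OF lim[OF that(1)]]) simp
      show "f y \<le> M" if "y \<in> frontier (ball c \<rho>)" for y using fM[OF that] by simp
    qed (use x in auto)
  qed
  finally show "(\<integral>y. f y \<partial>poisson_measure c \<rho> x) = perron (ball c \<rho>) f x" .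
qed

end

section \<open>The strong norm dominates the value at the base point\<close>

lemma admissible_ball:
  assumes "0 < \<rho>" "dist c \<xi> < \<rho>" "cball c \<rho> \<subseteq> D"
  shows "admissible D \<xi> (ball c \<rho>)"
  using assms by (simp add: admissible_def)

text \<open>For \<open>p < 1\<close> Jensen's inequality bounds the integral of
  \<open>u powr p\<close> in the wrong direction on each single domain. The supremum over domains
  repairs this: on small spheres around \<open>\<xi>\<close> the function exceeds any given
  \<open>a < u \<xi>\<close>, and the harmonic measure has mass one.\<close>

lemma strong_norm_ge:
  fixes u :: "'a::euclidean_space \<Rightarrow> real"
  assumes D: "open D" "\<xi> \<in> D" and u: "continuous_on D u" "\<And>x. x \<in> D \<Longrightarrow> 0 \<le> u x" and p: "0 < p"
  shows "ennreal (u \<xi>) \<le> strong_norm p D \<xi> u"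
proof (rule dense_le)
  fix y assume y: "y < ennreal (u \<xi>)"
  obtain a where a: "y = ennreal a" "0 \<le> a"
    using y by (cases y) (auto simp: top_unique)
  have au: "a < u \<xi>" using y a by (simp add: ennreal_less_iff)
  have "(u \<longlongrightarrow> u \<xi>) (at \<xi> within D)" using u(1) D by (simp add: continuous_on)
  then have "\<forall>\<^sub>F x in at \<xi> within D. a < u x" using au by (rule order_tendstoD)
  then obtain d where d: "0 < d" "\<And>x. x \<in> D \<Longrightarrow> x \<noteq> \<xi> \<Longrightarrow> dist x \<xi> < d \<Longrightarrow> a < u x"
    by (auto simp: eventually_at)
  obtain e where e: "0 < e" "cball \<xi> e \<subseteq> D" using D open_contains_cball by blast
  define \<rho> where "\<rho> = min e (d / 2)"
  have \<rho>: "0 < \<rho>" "\<rho> < d" "cball \<xi> \<rho> \<subseteq> D" using d e by (auto simp: \<rho>_def subset_iff)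
  let ?\<mu> = "poisson_measure \<xi> \<rho> \<xi>"
  have hm: "harmonic_measure_at (ball \<xi> \<rho>) \<xi> ?\<mu>" by (rule harmonic_measure_at_poisson) (use \<rho> in auto)
  have adm: "admissible D \<xi> (ball \<xi> \<rho>)" by (rule admissible_ball) (use \<rho> in auto)
  interpret harmonic_measure D "ball \<xi> \<rho>" \<xi> ?\<mu> by unfold_locales fact+
  have fr: "frontier (ball \<xi> \<rho>) = sphere \<xi> \<rho>" using \<rho> by simp
  have cu: "continuous_on (frontier (ball \<xi> \<rho>)) (\<lambda>x. \<bar>u x\<bar> powr p)"
    using p by (intro continuous_on_powr' continuous_intros continuous_on_subset[OF u(1) D0(6)]) auto
  have "a powr p = (\<integral>x. a powr p \<partial>?\<mu>)" by (rule integral_const_\<mu>[symmetric])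
  also have "\<dots> \<le> (\<integral>x. \<bar>u x\<bar> powr p \<partial>?\<mu>)"
  proof (rule integral_mono[OF _ integrable_\<mu>[OF cu]])
    fix x assume "x \<in> space ?\<mu>"
    then have xs: "x \<in> sphere \<xi> \<rho>" by (simp add: space_\<mu> fr)
    then have xD: "x \<in> D" using \<rho>(3) by auto
    have "a < u x" using d(2)[OF xD] xs \<rho> by (auto simp: dist_commute)
    then show "a powr p \<le> \<bar>u x\<bar> powr p" using a p by (intro powr_mono2) auto
  qed simp
  finally have "(a powr p) powr (1/p) \<le> (\<integral>x. \<bar>u x\<bar> powr p \<partial>?\<mu>) powr (1/p)"
    using p by (intro powr_mono2) auto
  then have "a \<le> (\<integral>x. \<bar>u x\<bar> powr p \<partial>?\<mu>) powr (1/p)" using p a by (simp add: powr_powr)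
  then have "y \<le> ennreal ((\<integral>x. \<bar>u x\<bar> powr p \<partial>?\<mu>) powr (1/p))"
    unfolding a(1) by (rule ennreal_leI)
  also have "\<dots> \<le> strong_norm p D \<xi> u"
    unfolding strong_norm_def using adm hm
    by (intro SUP_upper2[of "(ball \<xi> \<rho>, ?\<mu>)"]) auto
  finally show "y \<le> strong_norm p D \<xi> u" .
qed

subsection \<open>The special function for large exponents\<close>

text \<open>\<open>C\<close> is the \<open>p\<close>-th power of the constant to be proved. The
  value of \<open>m\<close> is fixed by \<open>p / 2 - m = 1\<close>, which makes the square in
  \<open>\<Phi>_alt\<close> equal to 1 at \<open>\<rho> = 1\<close>, \<open>y = 1\<close>.\<close>

locale burkholder_function =
  fixes p m C :: real
  assumes p: "2 < p" and m: "m = p / 2 - 1" and C: "C = (p / 2) powr p / (p - 1)"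
begin

(* Each Phi rho is a quadratic a(y^2 - x^2) - b y + c x + d with a, b >= 0 dominating - C x^p.
   W follows the larger critical point rho_s of rho |-> Phi rho x y, which is a local minimum. *)
definition \<Phi> :: "real \<Rightarrow> real \<Rightarrow> real \<Rightarrow> real" where
  "\<Phi> \<rho> x y = \<rho> powr (p - 2) * (p / 2)\<^sup>2 * (y\<^sup>2 - x\<^sup>2)
     - \<rho> powr (p - 1) * (p * m) * (y - x / (p - 1)) + m\<^sup>2 * \<rho> powr p"

definition \<rho>s :: "real \<Rightarrow> real \<Rightarrow> real" where
  "\<rho>s x y = max (x + y) ((y - x) * p / (p - 2))"

definition W :: "real \<Rightarrow> real \<Rightarrow> real" where
  "W x y = \<Phi> (min 1 (\<rho>s x y)) x y"

lemma m_pos: "0 < m" using p m by simp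

lemma p_minus_2: "p - 2 = 2 * m" using m by simp

text \<open>Completing the square in \<open>y\<close> shows that the bracket is homogeneous of
  degree 2 in \<open>(x, y, \<rho>)\<close>: all \<open>\<Phi> \<rho>\<close> are dilations of
  \<open>\<Phi> 1\<close>.\<close>

lemma \<Phi>_alt:
  assumes "0 < \<rho>"
  shows "\<Phi> \<rho> x y = \<rho> powr (p - 2) * ((p * y / 2 - m * \<rho>)\<^sup>2 - (p * x / 2)\<^sup>2 + m * \<rho> * p * x / (p - 1))"
proof -
  have "\<rho> powr (p - 1) = \<rho> powr (p - 2) * \<rho>" "\<rho> powr p = \<rho> powr (p - 2) * \<rho>\<^sup>2"
    using assms powr_add[of \<rho> "p - 2" 1] powr_add[of \<rho> "p - 2" 2] by (simp_all add: powr_numeral)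
  then show ?thesis unfolding \<Phi>_def
    using p by (simp add: field_simps power2_eq_square)
qed

lemma \<Phi>_deriv:
  assumes "0 < \<rho>"
  shows "((\<lambda>\<rho>. \<Phi> \<rho> x y) has_real_derivative
    p * m\<^sup>2 * \<rho> powr (p - 3) * (\<rho> - (x + y)) * (\<rho> - (y - x) * p / (p - 2))) (at \<rho>)"
proof -
  \<comment> \<open>Taking out \<open>\<rho> powr (p - 3)\<close> leaves a quadratic polynomial in
    \<open>\<rho>\<close>; its two roots are \<open>x + y\<close> and
    \<open>(y - x) * p / (p - 2)\<close>.\<close>
  define q where "q = \<rho> powr (p - 3)"
  have q: "\<rho> powr (p - 2) = q * \<rho>" "\<rho> powr (p - 1) = q * \<rho>\<^sup>2"
    using assms powr_add[of \<rho> "p - 3" 1] powr_add[of \<rho> "p - 3" 2] by (simp_all add: powr_numeral q_def)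
  have "((\<lambda>\<rho>. \<Phi> \<rho> x y) has_real_derivative
     (p - 2) * \<rho> powr (p - 2 - 1) * (p / 2)\<^sup>2 * (y\<^sup>2 - x\<^sup>2)
     - (p - 1) * \<rho> powr (p - 1 - 1) * (p * m) * (y - x / (p - 1)) + m\<^sup>2 * (p * \<rho> powr (p - 1))) (at \<rho>)"
    unfolding \<Phi>_def
    by (rule derivative_eq_intros has_real_derivative_powr assms refl)+ simp
  moreover have "(p - 2) * \<rho> powr (p - 2 - 1) * (p / 2)\<^sup>2 * (y\<^sup>2 - x\<^sup>2)
     - (p - 1) * \<rho> powr (p - 1 - 1) * (p * m) * (y - x / (p - 1)) + m\<^sup>2 * (p * \<rho> powr (p - 1))
     = p * m\<^sup>2 * \<rho> powr (p - 3) * (\<rho> - (x + y)) * (\<rho> - (y - x) * p / (p - 2))"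
  proof -
    have e: "(p - 1) * (y - x / (p - 1)) = (p - 1) * y - x" using p by (simp add: field_simps)
    have f: "m * ((y - x) * p / (p - 2)) = (y - x) * p / 2" using m_pos by (simp add: p_minus_2)
    have "p * m\<^sup>2 * q * (\<rho> - (x + y)) * (\<rho> - d) = p * m * q * (\<rho> - (x + y)) * (m * \<rho> - m * d)" for d
      by (simp add: power2_eq_square algebra_simps)
    then have "p * m\<^sup>2 * q * (\<rho> - (x + y)) * (\<rho> - (y - x) * p / (p - 2)) =
        p * m * q * (\<rho> - (x + y)) * (m * \<rho> - m * ((y - x) * p / (p - 2)))" .
    also have "\<dots> = p * m * q * (\<rho> - (x + y)) * (m * \<rho> - (y - x) * p / 2)" by (simp only: f)
    also have "\<dots> = 2 * m * q * (p / 2)\<^sup>2 * (y\<^sup>2 - x\<^sup>2) - (q * \<rho>) * (p * m) * ((p - 1) * y - x) + m\<^sup>2 * (p * (q * \<rho>\<^sup>2))"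
    proof -
      have "p = 2 * m + 2" using m by simp
      then show ?thesis by (simp add: field_simps power2_eq_square)
    qed
    also have "\<dots> = (p - 2) * q * (p / 2)\<^sup>2 * (y\<^sup>2 - x\<^sup>2) - (p - 1) * (q * \<rho>) * (p * m) * (y - x / (p - 1)) + m\<^sup>2 * (p * (q * \<rho>\<^sup>2))"
      unfolding e[symmetric] using m by simp
    finally show ?thesis using q by (simp add: q_def)
  qed
  ultimately show ?thesis by simp
qed

lemma \<rho>s_pos: "0 < x \<Longrightarrow> 0 \<le> y \<Longrightarrow> 0 < \<rho>s x y"
  by (simp add: \<rho>s_def less_max_iff_disj)

lemma \<rho>s_lipschitz: "\<rho>s x y \<le> \<rho>s x0 y0 + p / (p - 2) * (\<bar>x - x0\<bar> + \<bar>y - y0\<bar>)"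
proof -
  define S where "S = \<bar>x - x0\<bar> + \<bar>y - y0\<bar>"
  define L where "L = p / (p - 2)"
  have S: "0 \<le> S" "x + y \<le> x0 + y0 + S" "y - x \<le> y0 - x0 + S" unfolding S_def by linarith+
  have L: "1 \<le> L" using p by (simp add: L_def)
  have "1 * S \<le> L * S" using L S(1) by (intro mult_right_mono) auto
  then have "x + y \<le> x0 + y0 + L * S" using S(2) by linarith
  moreover have "L * (y - x) \<le> L * (y0 - x0 + S)" using L S(3) by (intro mult_left_mono) auto
  then have "L * (y - x) \<le> L * (y0 - x0) + L * S" by (simp only: distrib_left)
  moreover have "b * p / (p - 2) = L * b" for b by (simp add: L_def)
  ultimately have "\<rho>s x y \<le> \<rho>s x0 y0 + L * S" unfolding \<rho>s_def by simp linarith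
  then show ?thesis by (simp only: L_def S_def)
qed

(* In rho, the derivative of Phi vanishes at both arguments of the maximum defining rho_s, so replacing
   rho_s(x,y) by the parameter of a nearby point costs only a term of third order. *)
lemma W_support:
  assumes "0 < x0" "0 \<le> y0"
  obtains K where "0 \<le> K"
    "\<And>x y. 0 < x \<Longrightarrow> 0 \<le> y \<Longrightarrow> W x y \<le> \<Phi> (min 1 (\<rho>s x0 y0)) x y + K * (\<bar>x - x0\<bar> + \<bar>y - y0\<bar>) ^ 3"
proof -
  define r0 where "r0 = min 1 (\<rho>s x0 y0)"
  define L where "L = p / (p - 2)"
  \<comment> \<open>A bound for \<open>\<rho> powr (p - 3)\<close> on the interval from
    \<open>r0\<close> to 1; for \<open>p < 3\<close> the exponent is negative and the lower end
    decides.\<close>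
  define M where "M = max 1 (r0 powr (p - 3))"
  define K where "K = p * m\<^sup>2 * M * L ^ 3"
  have r0: "0 < r0" "r0 \<le> 1" using \<rho>s_pos[OF assms] by (auto simp: r0_def)
  have L: "0 < L" using p by (simp add: L_def)
  have M: "1 \<le> M" by (simp add: M_def)
  have K: "0 \<le> K" using p L M by (simp add: K_def)
  have "W x y \<le> \<Phi> r0 x y + K * (\<bar>x - x0\<bar> + \<bar>y - y0\<bar>) ^ 3" if xy: "0 < x" "0 \<le> y" for x y
  proof -
    define r where "r = min 1 (\<rho>s x y)"
    define d where "d = \<bar>x - x0\<bar> + \<bar>y - y0\<bar>"
    have d: "0 \<le> d" by (simp add: d_def)
    have r: "0 < r" "r \<le> 1" "r \<le> \<rho>s x y" using \<rho>s_pos[OF xy] by (auto simp: r_def)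
    let ?D = "\<lambda>\<rho>. p * m\<^sup>2 * \<rho> powr (p - 3) * (\<rho> - (x + y)) * (\<rho> - (y - x) * p / (p - 2))"
    have "\<Phi> r x y \<le> \<Phi> r0 x y + K * d ^ 3"
    \<comment> \<open>For \<open>r \<le> r0\<close> the function \<open>\<Phi>\<close> increases in
      the parameter beyond the larger root, so no error arises. For \<open>r > r0\<close> the mean
      value theorem gives the length \<open>r - r0\<close> times a derivative with two small
      factors, three quantities of order \<open>d\<close> in all.\<close>
    proof (cases "r \<le> r0")
      case True
      have "\<Phi> r x y \<le> \<Phi> r0 x y"
      proof (cases "r = r0")
        case False
        then have "r < 1" using True r0 by simp
        then have rr: "r = \<rho>s x y" by (simp add: r_def min_def split: if_splits)
        show ?thesis
        proof (rule DERIV_nonneg_imp_nondecreasing[OF True])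
          fix \<rho> assume \<rho>: "r \<le> \<rho>" "\<rho> \<le> r0"
          then have "x + y \<le> \<rho>" "(y - x) * p / (p - 2) \<le> \<rho>" using rr by (auto simp: \<rho>s_def)
          then have "0 \<le> ?D \<rho>" using p by (intro mult_nonneg_nonneg) auto
          then show "\<exists>z. ((\<lambda>\<rho>. \<Phi> \<rho> x y) has_real_derivative z) (at \<rho>) \<and> 0 \<le> z"
            using \<Phi>_deriv[of \<rho> x y] \<rho> r by (intro exI[of _ "?D \<rho>"]) auto
        qed
      qed simp
      then show ?thesis using K d by (simp add: add_increasing2)
    next
      case False
      then have lt: "r0 < r" by simp
      then have "r0 < 1" using r by simp
      then have r0': "r0 = \<rho>s x0 y0" by (simp add: r0_def min_def split: if_splits)
      have gap: "\<rho>s x y - r0 \<le> L * d" using \<rho>s_lipschitz[of x y x0 y0] by (simp add: r0' L_def d_def)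
      obtain \<rho> where \<rho>: "r0 < \<rho>" "\<rho> < r" "\<Phi> r x y - \<Phi> r0 x y = (r - r0) * ?D \<rho>"
        using MVT2[OF lt, of "\<lambda>\<rho>. \<Phi> \<rho> x y" ?D] \<Phi>_deriv r0 by (meson less_le_trans)
      \<comment> \<open>The smaller root. Between the roots the derivative is nonpositive, which
        helps; below both roots each factor is at most \<open>L * d\<close> in absolute
        value.\<close>
      define A where "A = min (x + y) ((y - x) * p / (p - 2))"
      have prod: "(\<rho> - (x + y)) * (\<rho> - (y - x) * p / (p - 2)) = (\<rho> - A) * (\<rho> - \<rho>s x y)"
        by (auto simp: A_def \<rho>s_def min_def max_def)
      have A: "A \<le> \<rho>s x y" by (auto simp: A_def \<rho>s_def)
      have "(\<rho> - A) * (\<rho> - \<rho>s x y) \<le> (L * d)\<^sup>2"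
      proof (cases "A \<le> \<rho>")
        case True
        then have "(\<rho> - A) * (\<rho> - \<rho>s x y) \<le> 0" using \<rho> r by (intro mult_nonneg_nonpos) auto
        then show ?thesis by (meson order_trans zero_le_power2)
      next
        case False
        then have "(A - \<rho>) * (\<rho>s x y - \<rho>) \<le> (L * d) * (L * d)"
          using gap \<rho> A r by (intro mult_mono) auto
        then show ?thesis by (simp add: algebra_simps power2_eq_square)
      qed
      moreover have "\<rho> powr (p - 3) \<le> M"
      proof (cases "3 \<le> p")
        case True
        then have "\<rho> powr (p - 3) \<le> 1 powr (p - 3)" using \<rho> r0 r by (intro powr_mono2) auto
        then show ?thesis using M by simp
      next
        case False
        then have "\<rho> powr (p - 3) \<le> r0 powr (p - 3)" using \<rho> r0 by (intro powr_mono2') auto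
        then show ?thesis by (simp add: M_def)
      qed
      ultimately have "\<rho> powr (p - 3) * ((\<rho> - A) * (\<rho> - \<rho>s x y)) \<le> M * (L * d)\<^sup>2"
        by (meson mult_left_mono mult_right_mono order_trans powr_ge_zero zero_le_power2)
      then have "p * m\<^sup>2 * (\<rho> powr (p - 3) * ((\<rho> - A) * (\<rho> - \<rho>s x y))) \<le> p * m\<^sup>2 * (M * (L * d)\<^sup>2)"
        using p by (intro mult_left_mono) auto
      moreover have "?D \<rho> = p * m\<^sup>2 * (\<rho> powr (p - 3) * ((\<rho> - A) * (\<rho> - \<rho>s x y)))"
        by (simp only: prod[symmetric] mult.assoc)
      ultimately have "?D \<rho> \<le> p * m\<^sup>2 * (M * (L * d)\<^sup>2)" by (simp only:)
      then have "(r - r0) * ?D \<rho> \<le> (r - r0) * (p * m\<^sup>2 * (M * (L * d)\<^sup>2))"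
        using lt by (intro mult_left_mono) auto
      also have "\<dots> \<le> (L * d) * (p * m\<^sup>2 * (M * (L * d)\<^sup>2))"
        using gap r p M by (intro mult_right_mono) auto
      also have "\<dots> = K * d ^ 3" by (simp add: K_def power2_eq_square power3_eq_cube)
      finally show ?thesis using \<rho>(3) by linarith
    qed
    then show ?thesis by (simp add: W_def r_def d_def)
  qed
  then show thesis using that[OF K] by (simp add: r0_def)
qed

text \<open>In terms of \<open>t = p * x / (2 * \<rho>)\<close> this is the tangent inequality for
  \<open>t powr (p - 1)\<close> at \<open>t = 1\<close>, multiplied by \<open>t\<close>. Contact at
  \<open>x = 2 * \<rho> / p\<close> is what determines \<open>C\<close>.\<close>

lemma \<Phi>_ge:
  assumes "0 < \<rho>" "0 \<le> x"
  shows "\<rho> powr (p - 2) * (p * y / 2 - m * \<rho>)\<^sup>2 - C * x powr p \<le> \<Phi> \<rho> x y"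
proof -
  define t where "t = p * x / 2 / \<rho>"
  define q where "q = \<rho> powr (p - 2)"
  have t: "0 \<le> t" using assms p by (simp add: t_def)
  have q: "0 < q" "\<rho> powr p = q * \<rho>\<^sup>2"
    using assms powr_add[of \<rho> "p - 2" 2] by (simp_all add: powr_numeral q_def)
  have px: "p * x / 2 = t * \<rho>" using assms by (simp add: t_def)
  have "C * x powr p = (p * x / 2) powr p / (p - 1)"
    using p assms by (simp add: C powr_mult[symmetric])
  also have "\<dots> = t powr p * (q * \<rho>\<^sup>2) / (p - 1)"
    unfolding px using t assms by (simp add: powr_mult q)
  also have "t powr p = t * t powr (p - 1)"
    using t powr_add[of t 1 "p - 1"] by (cases "t = 0") (auto simp: powr_one)
  finally have Cx: "C * x powr p = q * \<rho>\<^sup>2 * t / (p - 1) * t powr (p - 1)" by simp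
  have "1 + (p - 1) * (t - 1) \<le> t powr (p - 1)" using t p by (intro powr_ge_tangent) auto
  then have "q * \<rho>\<^sup>2 * t / (p - 1) * (1 + (p - 1) * (t - 1)) \<le> C * x powr p"
    unfolding Cx using q t p by (intro mult_left_mono) auto
  moreover have "q * \<rho>\<^sup>2 * t / (p - 1) * (1 + (p - 1) * (t - 1)) = q * ((p * x / 2)\<^sup>2 - m * \<rho> * p * x / (p - 1))"
  proof -
    have "m * \<rho> * p * x / (p - 1) = 2 * m * \<rho> * (p * x / 2) / (p - 1)" by simp
    then have *: "m * \<rho> * p * x / (p - 1) = 2 * m * \<rho> * (t * \<rho>) / (p - 1)" by (simp only: px)
    show ?thesis unfolding * unfolding px m using p by (simp add: field_simps power2_eq_square)
  qed
  ultimately show ?thesis unfolding \<Phi>_alt[OF assms(1)] q_def[symmetric] by (simp add: algebra_simps)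
qed

lemma W_ge: "0 < x \<Longrightarrow> 0 \<le> y \<Longrightarrow> - (C * x powr p) \<le> W x y"
proof -
  assume xy: "0 < x" "0 \<le> y"
  define r where "r = min 1 (\<rho>s x y)"
  have r: "0 < r" using \<rho>s_pos[OF xy] by (simp add: r_def)
  have "0 \<le> r powr (p - 2) * (p * y / 2 - m * r)\<^sup>2" by simp
  then show ?thesis using \<Phi>_ge[OF r less_imp_le[OF xy(1)], of y] unfolding W_def r_def[symmetric] by linarith
qed

text \<open>For \<open>y \<ge> 1\<close> the parameter is cut off at 1, and the square in
  \<open>\<Phi>_ge\<close> is at least 1 since \<open>p / 2 - m = 1\<close>.\<close>

lemma W_ge_one: "0 < x \<Longrightarrow> 1 \<le> y \<Longrightarrow> 1 - C * x powr p \<le> W x y"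
proof -
  assume xy: "0 < x" "1 \<le> y"
  have "1 \<le> \<rho>s x y" using xy by (simp add: \<rho>s_def le_max_iff_disj)
  then have W: "W x y = \<Phi> 1 x y" by (simp add: W_def)
  have "p * 1 \<le> p * y" using xy p by (intro mult_left_mono) auto
  then have "1 \<le> p * y / 2 - m * 1" using m by simp
  then have "1\<^sup>2 \<le> (p * y / 2 - m * 1)\<^sup>2" by (intro power_mono) auto
  then show ?thesis using \<Phi>_ge[of 1 x y] xy by (simp add: W)
qed

text \<open>For \<open>y \<le> x\<close> the larger root is \<open>x + y\<close>. If
  \<open>x + y \<le> 1\<close>, the bracket in \<open>\<Phi>_alt\<close> factors through
  \<open>x + y\<close> and the claim reduces to \<open>(p - 2)\<^sup>2 \<ge> 0\<close>. Otherwise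
  \<open>W\<close> is a convex quadratic in \<open>y\<close>, to be checked at the ends
  \<open>y = x\<close> and \<open>y = 1 - x\<close>; the sign of \<open>a\<close> tells which end
  bounds it.\<close>

lemma W_le_zero:
  assumes "0 < x" "0 \<le> y" "y \<le> x"
  shows "W x y \<le> 0"
proof -
  have "(y - x) * p / (p - 2) \<le> 0" using assms p by (simp add: mult_nonpos_nonneg divide_nonpos_pos)
  then have rs: "\<rho>s x y = x + y" using assms unfolding \<rho>s_def by linarith
  show ?thesis
  proof (cases "x + y \<le> 1")
    case True
    then have W: "W x y = \<Phi> (x + y) x y" by (simp add: W_def rs)
    have r: "0 < x + y" using assms by simp
    have pm: "p = 2 * m + 2" using m by simp
    have "(p * y / 2 - m * (x + y))\<^sup>2 - (p * x / 2)\<^sup>2 + m * (x + y) * p * x / (p - 1)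
      = (x + y) * (y - (p - 1) * x + m * p * x / (p - 1))"
      unfolding pm using m_pos by (simp add: field_simps power2_eq_square)
    moreover have "y - (p - 1) * x + m * p * x / (p - 1) \<le> 0"
    proof -
      have "(p - 1) * 1 + m * p \<le> (p - 1) * (p - 1)"
        unfolding m using zero_le_power2[of "p - 2"] by (simp add: field_simps power2_eq_square)
      then have "1 + m * p / (p - 1) \<le> p - 1" using p by (simp add: field_simps)
      then have "(1 + m * p / (p - 1)) * x \<le> (p - 1) * x" using assms by (intro mult_right_mono) auto
      then show ?thesis using assms by (simp add: algebra_simps)
    qed
    ultimately show ?thesis unfolding W \<Phi>_alt[OF r] using r
      by (simp add: mult_nonneg_nonpos)
  next
    case False
    then have W: "W x y = \<Phi> 1 x y" by (simp add: W_def rs)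
    have x: "1 / 2 < x" using False assms by simp
    define a where "a = p * y / 2 - m"
    define k where "k = 1 / (p - 1)"
    define X where "X = p * x"
    have k: "0 < k" "k \<le> 1" "k * (p - 1) = 1" using p by (simp_all add: k_def)
    have W1: "W x y = a\<^sup>2 - (X / 2)\<^sup>2 + m * X * k"
      unfolding W \<Phi>_alt[of 1 x y, simplified] by (simp add: a_def X_def k_def)
    have X: "p / 2 \<le> X" using x p by (simp add: X_def)
    have pk: "p / 2 * k \<le> 1" using p by (simp add: k_def field_simps)
    show ?thesis
    proof (cases "0 \<le> a")
      case True
      have "p * y \<le> p * x" using assms p by (intro mult_left_mono) auto
      then have "a \<le> X / 2 - m" by (simp add: a_def X_def)
      then have "a\<^sup>2 \<le> (X / 2 - m)\<^sup>2" using True by (rule power_mono)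
      then have "W x y \<le> (X / 2 - m)\<^sup>2 - (X / 2)\<^sup>2 + m * X * k" unfolding W1 by simp
      also have "\<dots> = m * (m - X * (1 - k))" by (simp add: power2_eq_square algebra_simps)
      also have "\<dots> \<le> m * 0"
      proof (rule mult_left_mono)
        have "p / 2 * (1 - k) \<le> X * (1 - k)" using X k by (intro mult_right_mono) auto
        moreover have "m \<le> p / 2 * (1 - k)" using pk by (simp add: m right_diff_distrib)
        ultimately show "m - X * (1 - k) \<le> 0" by simp
      qed (use m_pos in simp)
      finally show ?thesis by simp
    next
      case a: False
      have "1 - x \<le> y" using False by simp
      then have "p * (1 - x) \<le> p * y" using p by (intro mult_left_mono) auto
      then have "- a \<le> X / 2 - 1" by (simp add: a_def m X_def algebra_simps)
      then have "(- a)\<^sup>2 \<le> (X / 2 - 1)\<^sup>2" using a by (intro power_mono) auto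
      then have "W x y \<le> (X / 2 - 1)\<^sup>2 - (X / 2)\<^sup>2 + m * X * k" unfolding W1 by simp
      also have "\<dots> = 1 - X * (1 - m * k)" by (simp add: power2_eq_square algebra_simps)
      also have "1 - m * k = p / 2 * k"
      proof -
        have "1 - m * k = k * (p - 1) - m * k" using k by simp
        also have "\<dots> = p / 2 * k" by (simp add: m algebra_simps)
        finally show ?thesis .
      qed
      also have "1 - X * (p / 2 * k) \<le> 1 - p / 2 * (p / 2 * k)"
        using X k p by (intro diff_left_mono mult_right_mono) auto
      also have "\<dots> \<le> 0"
      proof -
        have "p - 1 \<le> p / 2 * (p / 2)"
          using zero_le_power2[of "p - 2"] by (simp add: field_simps power2_eq_square)
        then have "(p - 1) * k \<le> p / 2 * (p / 2) * k" using k by (intro mult_right_mono) auto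
        then show ?thesis using k by (simp add: ac_simps)
      qed
      finally show ?thesis .
    qed
  qed
qed

lemma continuous_on_W:
  fixes f g :: "'a::topological_space \<Rightarrow> real"
  assumes f: "continuous_on S f" and g: "continuous_on S g"
    and pos: "\<And>x. x \<in> S \<Longrightarrow> 0 < f x" "\<And>x. x \<in> S \<Longrightarrow> 0 \<le> g x"
  shows "continuous_on S (\<lambda>x. W (f x) (g x))"
proof -
  have r: "continuous_on S (\<lambda>x. min 1 (\<rho>s (f x) (g x)))"
    unfolding \<rho>s_def using p by (intro continuous_intros f g) auto
  have "\<forall>x\<in>S. min 1 (\<rho>s (f x) (g x)) \<noteq> 0"
  proof
    fix x assume "x \<in> S"
    then have "0 < \<rho>s (f x) (g x)" by (intro \<rho>s_pos pos)
    then show "min 1 (\<rho>s (f x) (g x)) \<noteq> 0" by (simp add: min_def)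
  qed
  then have "continuous_on S (\<lambda>x. min 1 (\<rho>s (f x) (g x)) powr e)" for e
    by (intro continuous_on_powr r continuous_on_const)
  moreover have "\<forall>x\<in>S. p - 1 \<noteq> 0" using p by simp
  ultimately show ?thesis
    unfolding W_def \<Phi>_def
    by (intro continuous_on_add continuous_on_diff continuous_on_mult continuous_on_power
        continuous_on_divide continuous_on_const f g)
qed

end

subsection \<open>Weak-type inequalities\<close>

lemma C2_on_continuous: "C2_on S f g H \<Longrightarrow> continuous_on S f"
  unfolding C2_on_def
  by (auto intro!: continuous_at_imp_continuous_on intro: has_derivative_continuous)

text \<open>Converts an error that is cubic in the increments of \<open>u\<close> and
  \<open>v\<close> into one that is cubic in the distance to \<open>z\<close>.\<close>

lemma C2_on_lipschitz_at:
  assumes "C2_on S f g H" "z \<in> S"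
  obtains L e where "0 < e" "0 \<le> L" "\<And>x. dist x z < e \<Longrightarrow> \<bar>f x - f z\<bar> \<le> L * dist x z"
proof -
  have "(f has_derivative (\<lambda>h. g z \<bullet> h)) (at z)" using assms by (auto simp: C2_on_def)
  then obtain e where e: "0 < e"
    "\<And>x. norm (x - z) < e \<Longrightarrow> norm (f x - f z - g z \<bullet> (x - z)) \<le> 1 * norm (x - z)"
    unfolding has_derivative_at_alt by (metis zero_less_one)
  have "\<bar>f x - f z\<bar> \<le> (norm (g z) + 1) * dist x z" if "dist x z < e" for x
  proof -
    have "\<bar>f x - f z - g z \<bullet> (x - z)\<bar> \<le> norm (x - z)" using e(2)[of x] that by (simp add: dist_norm)
    moreover have "\<bar>g z \<bullet> (x - z)\<bar> \<le> norm (g z) * norm (x - z)" by (rule Cauchy_Schwarz_ineq2)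
    ultimately show ?thesis unfolding dist_norm distrib_right by linarith
  qed
  then show thesis using that[of e "norm (g z) + 1"] e(1) by auto
qed

text \<open>Subordination recast in terms of ball means: the gradient condition survives only as
  \<open>msq\<close>. In this form the hypotheses pass to \<open>(u + \<eta>) / l\<close> and
  \<open>v / l\<close> by linear algebra, without any return to derivatives.\<close>

locale subordinate_pair =
  fixes D :: "'a::euclidean_space set" and \<xi> :: 'a and u v :: "'a \<Rightarrow> real"
  assumes D: "open D" and cu: "continuous_on D u" and cv: "continuous_on D v"
    and mu: "\<And>z r. 0 < r \<Longrightarrow> cball z r \<subseteq> D \<Longrightarrow> (\<integral>y. u (z + r *\<^sub>R y) \<partial>unif) = u z"
    and mv: "\<And>z r. 0 < r \<Longrightarrow> cball z r \<subseteq> D \<Longrightarrow> (\<integral>y. v (z + r *\<^sub>R y) \<partial>unif) = v z"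
    and msq: "\<And>z r. 0 < r \<Longrightarrow> cball z r \<subseteq> D \<Longrightarrow>
      (\<integral>y. (v (z + r *\<^sub>R y))\<^sup>2 - (u (z + r *\<^sub>R y))\<^sup>2 \<partial>unif) \<le> (v z)\<^sup>2 - (u z)\<^sup>2"
    and lu: "\<And>z. z \<in> D \<Longrightarrow> \<exists>L\<ge>0. \<exists>e>0. \<forall>x. dist x z < e \<longrightarrow> \<bar>u x - u z\<bar> \<le> L * dist x z"
    and lv: "\<And>z. z \<in> D \<Longrightarrow> \<exists>L\<ge>0. \<exists>e>0. \<forall>x. dist x z < e \<longrightarrow> \<bar>v x - v z\<bar> \<le> L * dist x z"
    and u0: "\<And>x. x \<in> D \<Longrightarrow> 0 \<le> u x" and start: "\<bar>v \<xi>\<bar> \<le> u \<xi>"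

lemma subordinate_pairI:
  fixes u v :: "'a::euclidean_space \<Rightarrow> real"
  assumes D: "open D" "\<xi> \<in> D" and u: "harmonic_on D u" and v: "harmonic_on D v"
    and u0: "\<forall>x\<in>D. 0 \<le> u x" and sub: "diff_subordinate D \<xi> v u"
  shows "subordinate_pair D \<xi> u v"
proof -
  note cu = harmonic_onD_C2[OF u] and cv = harmonic_onD_C2[OF v]
  define Hu where "Hu x = frechet_derivative (grad u) (at x)" for x
  define Hv where "Hv x = frechet_derivative (grad v) (at x)" for x
  have C2u: "C2_on D u (grad u) Hu" and C2v: "C2_on D v (grad v) Hv"
    using cu(1) cv(1) by (simp_all add: Hu_def[abs_def] Hv_def[abs_def])
  have lapu: "(\<Sum>i\<in>Basis. Hu x i \<bullet> i) = 0" and lapv: "(\<Sum>i\<in>Basis. Hv x i \<bullet> i) = 0" if "x \<in> D" for x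
    using cu(2)[OF that] cv(2)[OF that] by (simp_all add: Hu_def Hv_def)
  define g where "g x = (2 * v x) *\<^sub>R grad v x - (2 * u x) *\<^sub>R grad u x" for x
  define H where "H x h = ((2 * (grad v x \<bullet> h)) *\<^sub>R grad v x + (2 * v x) *\<^sub>R Hv x h)
      - ((2 * (grad u x \<bullet> h)) *\<^sub>R grad u x + (2 * u x) *\<^sub>R Hu x h)" for x h
  have du: "(u has_derivative (\<lambda>h. grad u z \<bullet> h)) (at z)" "(grad u has_derivative Hu z) (at z)"
    and dv: "(v has_derivative (\<lambda>h. grad v z \<bullet> h)) (at z)" "(grad v has_derivative Hv z) (at z)"
    if "z \<in> D" for z using that C2u C2v by (auto simp: C2_on_def)
  have cg: "continuous_on D (grad u)" "continuous_on D (grad v)"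
    using du(2) dv(2) by (auto intro!: continuous_at_imp_continuous_on intro: has_derivative_continuous)
  have "C2_on D (\<lambda>x. (v x)\<^sup>2 - (u x)\<^sup>2) g H"
    unfolding C2_on_def
  proof (intro conjI ballI D(1))
    fix z assume z: "z \<in> D"
    show "((\<lambda>x. (v x)\<^sup>2 - (u x)\<^sup>2) has_derivative (\<lambda>h. g z \<bullet> h)) (at z)"
      unfolding power2_eq_square
      by (rule has_derivative_eq_rhs[OF has_derivative_diff[OF has_derivative_mult[OF dv(1)[OF z] dv(1)[OF z]]
            has_derivative_mult[OF du(1)[OF z] du(1)[OF z]]]])
        (simp add: fun_eq_iff g_def inner_diff_left)
    show "(g has_derivative H z) (at z)"
      unfolding g_def H_def
      by (rule has_derivative_eq_rhs, (rule derivative_eq_intros du[OF z] dv[OF z] refl)+)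
        (simp add: fun_eq_iff algebra_simps)
  next
    fix i j :: 'a assume ij: "i \<in> Basis" "j \<in> Basis"
    have c: "continuous_on D (\<lambda>z. Hu z i \<bullet> j)" "continuous_on D (\<lambda>z. Hv z i \<bullet> j)"
      using C2u C2v ij by (auto simp: C2_on_def)
    show "continuous_on D (\<lambda>z. H z i \<bullet> j)"
      unfolding H_def inner_diff_left inner_add_left inner_scaleR_left
      by (intro continuous_intros c cg C2_on_continuous[OF C2u] C2_on_continuous[OF C2v])
  qed
  moreover have "(\<Sum>i\<in>Basis. H x i \<bullet> i) \<le> 0" if x: "x \<in> D" for x
  proof -
    have "(\<Sum>i\<in>Basis. H x i \<bullet> i) = (\<Sum>i\<in>Basis. 2 * ((grad v x \<bullet> i) * (grad v x \<bullet> i)) + 2 * v x * (Hv x i \<bullet> i)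
        - 2 * ((grad u x \<bullet> i) * (grad u x \<bullet> i)) - 2 * u x * (Hu x i \<bullet> i))"
      by (rule sum.cong[OF refl]) (simp add: H_def inner_diff_left inner_add_left)
    also have "\<dots> = 2 * (grad v x \<bullet> grad v x) - 2 * (grad u x \<bullet> grad u x)"
      by (simp only: sum.distrib sum_subtractf sum_distrib_left[symmetric] trace_inner_products lapu[OF x] lapv[OF x])
    also have "\<dots> \<le> 0"
    proof -
      have "norm (grad v x) \<le> norm (grad u x)" using sub x by (simp add: diff_subordinate_def)
      then show ?thesis by (simp add: norm_le)
    qed
    finally show ?thesis .
  qed
  ultimately have msq: "(\<integral>y. (v (z + r *\<^sub>R y))\<^sup>2 - (u (z + r *\<^sub>R y))\<^sup>2 \<partial>unif) \<le> (v z)\<^sup>2 - (u z)\<^sup>2"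
    if "0 < r" "cball z r \<subseteq> D" for z r
    using mean_le_of_laplacian_le[of D "\<lambda>x. (v x)\<^sup>2 - (u x)\<^sup>2" g H r z] that by blast
  show ?thesis
  proof
    show "(\<integral>y. u (z + r *\<^sub>R y) \<partial>unif) = u z" "(\<integral>y. v (z + r *\<^sub>R y) \<partial>unif) = v z"
      if "0 < r" "cball z r \<subseteq> D" for z r
      using mean_eq_of_laplacian_eq[OF C2u that lapu] mean_eq_of_laplacian_eq[OF C2v that lapv] by auto
    show "\<exists>L\<ge>0. \<exists>e>0. \<forall>x. dist x z < e \<longrightarrow> \<bar>u x - u z\<bar> \<le> L * dist x z" if "z \<in> D" for z
      using C2_on_lipschitz_at[OF C2u that] by metis
    show "\<exists>L\<ge>0. \<exists>e>0. \<forall>x. dist x z < e \<longrightarrow> \<bar>v x - v z\<bar> \<le> L * dist x z" if "z \<in> D" for z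
      using C2_on_lipschitz_at[OF C2v that] by metis
    show "\<bar>v \<xi>\<bar> \<le> u \<xi>" using sub u0 D(2) by (simp add: diff_subordinate_def)
  qed (use D(1) u0 msq C2_on_continuous[OF C2u] C2_on_continuous[OF C2v] in auto)
qed

text \<open>Touching from above: \<open>s\<close> agrees with \<open>w\<close> at \<open>z\<close>
  and dominates it nearby up to a cubic error, so the mean inequality of \<open>s\<close> at
  \<open>z\<close> passes to \<open>w\<close>. The function \<open>s\<close> may change with
  \<open>z\<close>.\<close>

lemma local_superI_support:
  fixes w :: "'a::euclidean_space \<Rightarrow> real"
  assumes S: "open S" and w: "continuous_on S w"
    and sup: "\<And>z. z \<in> S \<Longrightarrow> \<exists>s K e. 0 \<le> K \<and> 0 < e \<and> continuous_on S s \<and> w z = s z \<and>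
      (\<forall>x\<in>S. dist x z < e \<longrightarrow> w x \<le> s x + K * dist x z ^ 3) \<and>
      (\<forall>r. 0 < r \<longrightarrow> cball z r \<subseteq> S \<longrightarrow> (\<integral>y. s (z + r *\<^sub>R y) \<partial>unif) \<le> s z)"
  shows "local_super S w"
  unfolding local_super_def
proof (intro conjI ballI S w)
  fix z assume z: "z \<in> S"
  from sup[OF z] obtain s K e where K: "0 \<le> K" and e: "0 < e" and s: "continuous_on S s" "w z = s z"
    and le: "\<And>x. x \<in> S \<Longrightarrow> dist x z < e \<Longrightarrow> w x \<le> s x + K * dist x z ^ 3"
    and mean: "\<And>r. 0 < r \<Longrightarrow> cball z r \<subseteq> S \<Longrightarrow> (\<integral>y. s (z + r *\<^sub>R y) \<partial>unif) \<le> s z"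
    by blast
  obtain d where d: "0 < d" "cball z d \<subseteq> S" using S z open_contains_cball by blast
  define \<epsilon> where "\<epsilon> = min d e"
  have "(\<integral>y. w (z + r *\<^sub>R y) \<partial>unif) \<le> w z + K * r ^ 3" if r: "0 < r" "r < \<epsilon>" for r
  proof -
    have sub: "cball z r \<subseteq> S" using d r by (auto simp: \<epsilon>_def subset_iff)
    have Iw: "integrable unif (\<lambda>y. w (z + r *\<^sub>R y))" and Is: "integrable unif (\<lambda>y. s (z + r *\<^sub>R y))"
      using r by (auto intro: integrable_unif_ball[OF w sub] integrable_unif_ball[OF s(1) sub])
    have "(\<integral>y. w (z + r *\<^sub>R y) \<partial>unif) \<le> (\<integral>y. s (z + r *\<^sub>R y) + K * r ^ 3 \<partial>unif)"
    proof (rule integral_unif_mono[OF Iw])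
      show "integrable unif (\<lambda>y. s (z + r *\<^sub>R y) + K * r ^ 3)" using Is by simp
      fix y :: 'a assume y: "norm y < 1"
      have dz: "dist (z + r *\<^sub>R y) z \<le> r" using r y by (simp add: dist_norm mult_left_le)
      then have "z + r *\<^sub>R y \<in> S" using sub by (auto simp: subset_iff dist_commute)
      then have "w (z + r *\<^sub>R y) \<le> s (z + r *\<^sub>R y) + K * dist (z + r *\<^sub>R y) z ^ 3"
        using dz r by (intro le) (auto simp: \<epsilon>_def)
      also have "\<dots> \<le> s (z + r *\<^sub>R y) + K * r ^ 3"
        using dz K by (intro add_left_mono mult_left_mono power_mono) auto
      finally show "w (z + r *\<^sub>R y) \<le> s (z + r *\<^sub>R y) + K * r ^ 3" .
    qed
    also have "\<dots> = (\<integral>y. s (z + r *\<^sub>R y) \<partial>unif) + K * r ^ 3" using Is by simp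
    also have "\<dots> \<le> w z + K * r ^ 3" using mean[OF r(1) sub] s(2) by simp
    finally show ?thesis .
  qed
  moreover have "0 < \<epsilon>" "cball z \<epsilon> \<subseteq> S" using d e by (auto simp: \<epsilon>_def subset_iff)
  ultimately show "\<exists>K. \<exists>e>0. cball z e \<subseteq> S \<and> (\<forall>r. 0 < r \<and> r < e \<longrightarrow> (\<integral>y. w (z + r *\<^sub>R y) \<partial>unif) \<le> w z + K * r ^ 3)"
    by blast
qed

context subordinate_pair
begin

text \<open>The linear coefficients may have any sign because \<open>u\<close> and \<open>v\<close>
  satisfy the mean value property with equality; \<open>msq\<close> is an inequality and forces
  \<open>\<alpha> \<ge> 0\<close>.\<close>

lemma quadratic_mean:
  assumes "0 \<le> \<alpha>" "0 < r" "cball z r \<subseteq> D"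
  shows "(\<integral>y. \<alpha> * ((v (z + r *\<^sub>R y))\<^sup>2 - (u (z + r *\<^sub>R y))\<^sup>2) + \<beta> * v (z + r *\<^sub>R y) + \<gamma> * u (z + r *\<^sub>R y) + \<epsilon> \<partial>unif)
    \<le> \<alpha> * ((v z)\<^sup>2 - (u z)\<^sup>2) + \<beta> * v z + \<gamma> * u z + \<epsilon>"
proof -
  have I: "integrable unif (\<lambda>y. u (z + r *\<^sub>R y))" "integrable unif (\<lambda>y. v (z + r *\<^sub>R y))"
    "integrable unif (\<lambda>y. (v (z + r *\<^sub>R y))\<^sup>2 - (u (z + r *\<^sub>R y))\<^sup>2)"
    using assms(2)
    by (auto intro!: integrable_unif_ball[OF cu assms(3)] integrable_unif_ball[OF cv assms(3)]
        integrable_unif_ball[OF _ assms(3), of "\<lambda>x. (v x)\<^sup>2 - (u x)\<^sup>2"] continuous_on_diff continuous_on_power cu cv)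
  have "(\<integral>y. \<alpha> * ((v (z + r *\<^sub>R y))\<^sup>2 - (u (z + r *\<^sub>R y))\<^sup>2) + \<beta> * v (z + r *\<^sub>R y) + \<gamma> * u (z + r *\<^sub>R y) + \<epsilon> \<partial>unif)
    = \<alpha> * (\<integral>y. (v (z + r *\<^sub>R y))\<^sup>2 - (u (z + r *\<^sub>R y))\<^sup>2 \<partial>unif) + \<beta> * v z + \<gamma> * u z + \<epsilon>"
    by (subst Bochner_Integration.integral_add Bochner_Integration.integral_mult_right_zero
        | (intro Bochner_Integration.integrable_add integrable_mult_right I integrable_unif_const; fail)
        | simp only: mu[OF assms(2,3)] mv[OF assms(2,3)] integral_unif_const)+
  then show ?thesis using mult_left_mono[OF msq[OF assms(2,3)] assms(1)] by simp
qed

text \<open>Reduces level \<open>l\<close> to level 1 and, for \<open>\<eta> > 0\<close>, makes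
  \<open>u\<close> strictly positive. In the square, \<open>\<eta>\<close> contributes only a
  multiple of \<open>u\<close> and a constant.\<close>

lemma scale:
  assumes "0 < l" "0 \<le> \<eta>"
  shows "subordinate_pair D \<xi> (\<lambda>x. (u x + \<eta>) / l) (\<lambda>x. v x / l)"
proof
  fix z r assume zr: "0 < (r::real)" "cball z r \<subseteq> D"
  have q: "(\<integral>y. \<alpha> * ((v (z + r *\<^sub>R y))\<^sup>2 - (u (z + r *\<^sub>R y))\<^sup>2) + \<gamma> * u (z + r *\<^sub>R y) + \<epsilon> \<partial>unif)
    \<le> \<alpha> * ((v z)\<^sup>2 - (u z)\<^sup>2) + \<gamma> * u z + \<epsilon>" if "0 \<le> \<alpha>" for \<alpha> \<gamma> \<epsilon>
    using quadratic_mean[OF that zr, of 0 \<gamma> \<epsilon>] by simp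
  have e: "(v x / l)\<^sup>2 - ((u x + \<eta>) / l)\<^sup>2 = 1 / l\<^sup>2 * ((v x)\<^sup>2 - (u x)\<^sup>2) + (- 2 * \<eta> / l\<^sup>2) * u x + (- (\<eta> / l)\<^sup>2)" for x
    using assms by (simp add: field_simps power2_eq_square)
  show "(\<integral>y. (v (z + r *\<^sub>R y) / l)\<^sup>2 - ((u (z + r *\<^sub>R y) + \<eta>) / l)\<^sup>2 \<partial>unif) \<le> (v z / l)\<^sup>2 - ((u z + \<eta>) / l)\<^sup>2"
    unfolding e by (rule q) simp
  show "(\<integral>y. v (z + r *\<^sub>R y) / l \<partial>unif) = v z / l" using mv[OF zr] by simp
  have "integrable unif (\<lambda>y. u (z + r *\<^sub>R y))" using zr by (intro integrable_unif_ball[OF cu]) auto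
  then show "(\<integral>y. (u (z + r *\<^sub>R y) + \<eta>) / l \<partial>unif) = (u z + \<eta>) / l" using mu[OF zr] by simp
next
  fix z assume z: "z \<in> D"
  obtain L e where "0 \<le> L" "0 < e" "\<And>x. dist x z < e \<Longrightarrow> \<bar>u x - u z\<bar> \<le> L * dist x z" using lu[OF z] by blast
  then show "\<exists>L\<ge>0. \<exists>e>0. \<forall>x. dist x z < e \<longrightarrow> \<bar>(u x + \<eta>) / l - (u z + \<eta>) / l\<bar> \<le> L * dist x z"
    using assms by (intro exI[of _ "L / l"] conjI exI[of _ e]) (auto simp: diff_divide_distrib[symmetric] divide_right_mono)
  obtain L e where "0 \<le> L" "0 < e" "\<And>x. dist x z < e \<Longrightarrow> \<bar>v x - v z\<bar> \<le> L * dist x z" using lv[OF z] by blast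
  then show "\<exists>L\<ge>0. \<exists>e>0. \<forall>x. dist x z < e \<longrightarrow> \<bar>v x / l - v z / l\<bar> \<le> L * dist x z"
    using assms by (intro exI[of _ "L / l"] conjI exI[of _ e]) (auto simp: diff_divide_distrib[symmetric] divide_right_mono)
next
  show "\<bar>v \<xi> / l\<bar> \<le> (u \<xi> + \<eta>) / l" using start assms by (simp add: divide_right_mono)
qed (use assms D u0 in \<open>auto intro!: continuous_intros cu cv\<close>)

(* The function is v^2 - u^2 where u + |v| <= 1 and 1 - 2u elsewhere. *)
lemma weak_type_one_unit:
  assumes "harmonic_measure D D0 \<xi> \<mu>"
  shows "measure \<mu> {x \<in> frontier D0. 1 \<le> \<bar>v x\<bar>} \<le> 2 * u \<xi>"
proof -
  interpret harmonic_measure D D0 \<xi> \<mu> by fact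
  \<comment> \<open>Since \<open>1 - 2 u - ((1 - u)^2 - v^2) = v^2 - u^2\<close>, the outer maximum
    glues the two formulas continuously and keeps \<open>B\<close> below \<open>1 - 2 u\<close>
    everywhere. The inner maximum prevents \<open>(1 - u)^2\<close> from growing again where
    \<open>u > 1\<close>.\<close>
  define B where "B x = 1 - 2 * u x - max 0 ((max 0 (1 - u x))\<^sup>2 - (v x)\<^sup>2)" for x
  have B_le: "B x \<le> 1 - 2 * u x" for x by (simp add: B_def)
  have B1: "B x = (v x)\<^sup>2 - (u x)\<^sup>2" if "u x + \<bar>v x\<bar> \<le> 1" for x
  proof -
    have "\<bar>v x\<bar>\<^sup>2 \<le> (1 - u x)\<^sup>2" using that by (intro power_mono) auto
    moreover have "0 \<le> 1 - u x" using that by linarith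
    ultimately show ?thesis by (simp add: B_def power2_eq_square algebra_simps)
  qed
  have B2: "B x = 1 - 2 * u x" if "1 \<le> u x + \<bar>v x\<bar>" for x
  proof -
    have "(max 0 (1 - u x))\<^sup>2 \<le> \<bar>v x\<bar>\<^sup>2" using that by (intro power_mono) auto
    then show ?thesis by (simp add: B_def)
  qed
  have cB: "continuous_on D B" unfolding B_def by (intro continuous_intros cu cv)
  have "local_super D B"
  proof (rule local_superI_support[OF D cB])
    fix z assume z: "z \<in> D"
    show "\<exists>s K e. 0 \<le> K \<and> 0 < e \<and> continuous_on D s \<and> B z = s z \<and>
      (\<forall>x\<in>D. dist x z < e \<longrightarrow> B x \<le> s x + K * dist x z ^ 3) \<and>
      (\<forall>r. 0 < r \<longrightarrow> cball z r \<subseteq> D \<longrightarrow> (\<integral>y. s (z + r *\<^sub>R y) \<partial>unif) \<le> s z)"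
    \<comment> \<open>The strict inequality is an open condition, so near \<open>z\<close> the first
      formula holds exactly. On the interface and beyond, \<open>1 - 2 u\<close> dominates globally
      and touches at \<open>z\<close>.\<close>
    proof (cases "u z + \<bar>v z\<bar> < 1")
      case True
      have "continuous_on D (\<lambda>x. u x + \<bar>v x\<bar>)" by (intro continuous_intros cu cv)
      then have "open (D \<inter> (\<lambda>x. u x + \<bar>v x\<bar>) -` {..<1})"
        using D open_lessThan by (rule continuous_open_preimage)
      moreover have "z \<in> D \<inter> (\<lambda>x. u x + \<bar>v x\<bar>) -` {..<1}" using True z by simp
      ultimately obtain e where e: "0 < e" "ball z e \<subseteq> D \<inter> (\<lambda>x. u x + \<bar>v x\<bar>) -` {..<1}"
        using open_contains_ball by blast
      have "B x \<le> (v x)\<^sup>2 - (u x)\<^sup>2" if "dist x z < e" for x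
      proof -
        have "u x + \<bar>v x\<bar> < 1" using e(2) that by (auto simp: subset_iff dist_commute)
        then show ?thesis using B1[of x] by simp
      qed
      then show ?thesis using e(1) True B1[of z] msq
        by (intro exI[of _ "\<lambda>x. (v x)\<^sup>2 - (u x)\<^sup>2"] exI[of _ 0] exI[of _ e])
          (auto intro!: continuous_intros cu cv)
    next
      case False
      have "(\<integral>y. 1 - 2 * u (z + r *\<^sub>R y) \<partial>unif) \<le> 1 - 2 * u z" if "0 < r" "cball z r \<subseteq> D" for r
        using quadratic_mean[OF order_refl that, of 0 "-2" 1] by simp
      then show ?thesis using False B2[of z] B_le
        by (intro exI[of _ "\<lambda>x. 1 - 2 * u x"] exI[of _ 0] exI[of _ 1])
          (auto intro!: continuous_intros cu)
    qed
  qed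
  then have B0: "local_super D0 B" by (rule local_super_subset) (use D0 in auto)
  have "B \<xi> \<le> 0"
  proof (cases "u \<xi> + \<bar>v \<xi>\<bar> \<le> 1")
    case True
    have "\<bar>v \<xi>\<bar>\<^sup>2 \<le> (u \<xi>)\<^sup>2" using start by (intro power_mono) auto
    then show ?thesis using B1[OF True] by simp
  next
    case False
    then show ?thesis using B2[of \<xi>] start by simp
  qed
  note cf = continuous_on_subset[OF _ D0(6)]
  have "measure \<mu> {x \<in> frontier D0. 1 \<le> \<bar>v x\<bar>} \<le> (\<integral>x. B x + 2 * u x \<partial>\<mu>)"
  proof (rule measure_level_le)
    show "continuous_on (frontier D0) v" "continuous_on (frontier D0) (\<lambda>x. B x + 2 * u x)"
      by (auto intro!: continuous_intros cf[OF cv] cf[OF cu] cf[OF cB])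
    fix x assume x: "x \<in> frontier D0"
    then have ux: "0 \<le> u x" using u0 D0 by blast
    show "0 \<le> B x + 2 * u x"
    proof (cases "u x + \<bar>v x\<bar> \<le> 1")
      case True
      then have "u x * u x \<le> 2 * u x" using ux by (intro mult_right_mono) auto
      then show ?thesis
        unfolding B1[OF True] power2_eq_square using zero_le_square[of "v x"] by linarith
    qed (use B2[of x] in simp)
    show "1 \<le> B x + 2 * u x" if "1 \<le> \<bar>v x\<bar>" using B2[of x] that ux by simp
  qed
  also have "\<dots> = (\<integral>x. B x \<partial>\<mu>) + 2 * (\<integral>x. u x \<partial>\<mu>)"
    using integrable_\<mu>[OF cf[OF cB]] integrable_\<mu>[OF cf[OF cu]] by simp
  also have "\<dots> \<le> 0 + 2 * u \<xi>"
    using integral_le_of_local_super[OF continuous_on_subset[OF cB D0(4)] B0] \<open>B \<xi> \<le> 0\<close>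
      integral_eq_of_mean[OF cu mu] by simp
  finally show ?thesis by simp
qed

text \<open>At \<open>p = 2\<close> the parameter \<open>\<rho>s\<close> would divide by
  \<open>p - 2\<close>, but then the constant is 1 and \<open>v^2 - u^2\<close> itself serves: the
  indicator of \<open>|v| \<ge> 1\<close> is at most \<open>v^2\<close>.\<close>

lemma weak_type_two_unit:
  assumes "harmonic_measure D D0 \<xi> \<mu>"
  shows "measure \<mu> {x \<in> frontier D0. 1 \<le> \<bar>v x\<bar>} \<le> (\<integral>x. (u x)\<^sup>2 \<partial>\<mu>)"
proof -
  interpret harmonic_measure D D0 \<xi> \<mu> by fact
  have c: "continuous_on D (\<lambda>x. (v x)\<^sup>2 - (u x)\<^sup>2)" "continuous_on D (\<lambda>x. (u x)\<^sup>2)" "continuous_on D (\<lambda>x. (v x)\<^sup>2)"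
    by (intro continuous_intros cu cv)+
  note cf = continuous_on_subset[OF _ D0(6)]
  have "local_super D0 (\<lambda>x. (v x)\<^sup>2 - (u x)\<^sup>2)"
    by (rule local_superI_mean[OF D0(1) continuous_on_subset[OF c(1) D0(5)]]) (use msq D0 in blast)
  from integral_le_of_local_super[OF continuous_on_subset[OF c(1) D0(4)] this]
  have "(\<integral>x. (v x)\<^sup>2 \<partial>\<mu>) - (\<integral>x. (u x)\<^sup>2 \<partial>\<mu>) \<le> (v \<xi>)\<^sup>2 - (u \<xi>)\<^sup>2"
    using integrable_\<mu>[OF cf[OF c(2)]] integrable_\<mu>[OF cf[OF c(3)]] by simp
  moreover have "\<bar>v \<xi>\<bar>\<^sup>2 \<le> (u \<xi>)\<^sup>2" using start by (intro power_mono) auto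
  moreover have "measure \<mu> {x \<in> frontier D0. 1 \<le> \<bar>v x\<bar>} \<le> (\<integral>x. (v x)\<^sup>2 \<partial>\<mu>)"
  proof (rule measure_level_le[OF cf[OF cv] cf[OF c(3)]])
    show "1 \<le> (v x)\<^sup>2" if "1 \<le> \<bar>v x\<bar>" for x using power_mono[OF that, of 2] by simp
  qed simp
  ultimately show ?thesis by simp
qed

lemma weak_type_large_unit:
  assumes "harmonic_measure D D0 \<xi> \<mu>" and p: "2 < p" and pos: "\<And>x. x \<in> D \<Longrightarrow> 0 < u x" and "\<xi> \<in> D"
  shows "measure \<mu> {x \<in> frontier D0. 1 \<le> \<bar>v x\<bar>} \<le> (p / 2) powr p / (p - 1) * (\<integral>x. u x powr p \<partial>\<mu>)"
proof -
  interpret harmonic_measure D D0 \<xi> \<mu> by fact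
  define m where "m = p / 2 - 1"
  define C where "C = (p / 2) powr p / (p - 1)"
  interpret F: burkholder_function p m C by unfold_locales (simp_all add: p m_def C_def)
  define w where "w x = F.W (u x) \<bar>v x\<bar>" for x
  have cw: "continuous_on D w"
    unfolding w_def by (intro F.continuous_on_W continuous_intros cu cv pos) auto
  have "local_super D w"
  proof (rule local_superI_support[OF D cw])
    fix z assume z: "z \<in> D"
    \<comment> \<open>The parameter is frozen at its value for \<open>z\<close>;
      \<open>W_support\<close> bounds the cost of this nearby.\<close>
    define \<rho> where "\<rho> = min 1 (F.\<rho>s (u z) \<bar>v z\<bar>)"
    have \<rho>: "0 < \<rho>" using F.\<rho>s_pos[OF pos[OF z], of "\<bar>v z\<bar>"] by (simp add: \<rho>_def)
    obtain K where K: "0 \<le> K"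
      "\<And>x y. 0 < x \<Longrightarrow> 0 \<le> y \<Longrightarrow> F.W x y \<le> F.\<Phi> \<rho> x y + K * (\<bar>x - u z\<bar> + \<bar>y - \<bar>v z\<bar>\<bar>) ^ 3"
      using F.W_support[OF pos[OF z], of "\<bar>v z\<bar>"] unfolding \<rho>_def by auto
    obtain Lu eu where Lu: "0 \<le> Lu" "0 < eu" "\<And>x. dist x z < eu \<Longrightarrow> \<bar>u x - u z\<bar> \<le> Lu * dist x z" using lu[OF z] by blast
    obtain Lv ev where Lv: "0 \<le> Lv" "0 < ev" "\<And>x. dist x z < ev \<Longrightarrow> \<bar>v x - v z\<bar> \<le> Lv * dist x z" using lv[OF z] by blast
    \<comment> \<open>\<open>|v|\<close> is not harmonic, so it is replaced by
      \<open>\<sigma> * v\<close> with the sign of \<open>v\<close> at \<open>z\<close>. As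
      \<open>- \<beta> * |v| \<le> - \<beta> * \<sigma> * v\<close> with equality at
      \<open>z\<close>, the result still touches from above.\<close>
    define \<sigma> where "\<sigma> = (if 0 \<le> v z then 1 else - 1 :: real)"
    define \<alpha> where "\<alpha> = \<rho> powr (p - 2) * (p / 2)\<^sup>2"
    define \<beta> where "\<beta> = \<rho> powr (p - 1) * (p * m)"
    define s where "s x = \<alpha> * ((v x)\<^sup>2 - (u x)\<^sup>2) + (- (\<beta> * \<sigma>)) * v x + (\<beta> / (p - 1)) * u x + m\<^sup>2 * \<rho> powr p" for x
    have nn: "0 \<le> \<alpha>" "0 \<le> \<beta>" using p F.m_pos by (simp_all add: \<alpha>_def \<beta>_def)
    have \<Phi>: "F.\<Phi> \<rho> (u x) \<bar>v x\<bar> = \<alpha> * ((v x)\<^sup>2 - (u x)\<^sup>2) - \<beta> * \<bar>v x\<bar> + (\<beta> / (p - 1)) * u x + m\<^sup>2 * \<rho> powr p" for x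
      by (simp add: F.\<Phi>_def \<alpha>_def \<beta>_def right_diff_distrib)
    have \<Phi>s: "F.\<Phi> \<rho> (u x) \<bar>v x\<bar> \<le> s x" for x
    proof -
      have "\<beta> * (\<sigma> * v x) \<le> \<beta> * \<bar>v x\<bar>" using nn by (intro mult_left_mono) (auto simp: \<sigma>_def)
      then show ?thesis unfolding \<Phi> s_def by simp
    qed
    have "w z = s z"
    proof -
      have "\<sigma> * v z = \<bar>v z\<bar>" by (simp add: \<sigma>_def)
      then have e: "\<beta> * \<sigma> * v z = \<beta> * \<bar>v z\<bar>" by (simp only: mult.assoc)
      have "F.\<Phi> \<rho> (u z) \<bar>v z\<bar> = s z" unfolding \<Phi> s_def mult_minus_left e by simp
      then show ?thesis by (simp add: w_def F.W_def \<rho>_def)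
    qed
    moreover have "w x \<le> s x + K * (Lu + Lv) ^ 3 * dist x z ^ 3" if x: "x \<in> D" "dist x z < min eu ev" for x
    proof -
      have "\<bar>\<bar>v x\<bar> - \<bar>v z\<bar>\<bar> \<le> \<bar>v x - v z\<bar>" by (rule abs_triangle_ineq3)
      then have "\<bar>u x - u z\<bar> + \<bar>\<bar>v x\<bar> - \<bar>v z\<bar>\<bar> \<le> (Lu + Lv) * dist x z"
        using Lu(3)[of x] Lv(3)[of x] x(2) by (simp add: distrib_right)
      then have "(\<bar>u x - u z\<bar> + \<bar>\<bar>v x\<bar> - \<bar>v z\<bar>\<bar>) ^ 3 \<le> ((Lu + Lv) * dist x z) ^ 3" by (intro power_mono) auto
      then have "K * (\<bar>u x - u z\<bar> + \<bar>\<bar>v x\<bar> - \<bar>v z\<bar>\<bar>) ^ 3 \<le> K * (Lu + Lv) ^ 3 * dist x z ^ 3"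
        using K(1) by (simp add: power_mult_distrib mult_left_mono mult.assoc)
      then show ?thesis using K(2)[OF pos[OF x(1)], of "\<bar>v x\<bar>"] \<Phi>s[of x] by (simp add: w_def)
    qed
    moreover have "continuous_on D s" unfolding s_def by (intro continuous_intros cu cv)
    moreover have "(\<integral>y. s (z + r *\<^sub>R y) \<partial>unif) \<le> s z" if "0 < r" "cball z r \<subseteq> D" for r
      unfolding s_def by (rule quadratic_mean[OF nn(1) that])
    moreover have "0 \<le> K * (Lu + Lv) ^ 3" "0 < min eu ev" using K Lu Lv by auto
    ultimately show "\<exists>s K e. 0 \<le> K \<and> 0 < e \<and> continuous_on D s \<and> w z = s z \<and>
      (\<forall>x\<in>D. dist x z < e \<longrightarrow> w x \<le> s x + K * dist x z ^ 3) \<and>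
      (\<forall>r. 0 < r \<longrightarrow> cball z r \<subseteq> D \<longrightarrow> (\<integral>y. s (z + r *\<^sub>R y) \<partial>unif) \<le> s z)"
      by blast
  qed
  then have w0: "local_super D0 w" by (rule local_super_subset) (use D0 in auto)
  have "w \<xi> \<le> 0" unfolding w_def
    by (rule F.W_le_zero) (use pos[OF \<open>\<xi> \<in> D\<close>] start in auto)
  note cf = continuous_on_subset[OF _ D0(6)]
  have cp: "continuous_on D (\<lambda>x. u x powr p)"
    by (intro continuous_on_powr cu continuous_intros) (use pos in force)
  have "measure \<mu> {x \<in> frontier D0. 1 \<le> \<bar>v x\<bar>} \<le> (\<integral>x. w x + C * u x powr p \<partial>\<mu>)"
  proof (rule measure_level_le)
    show "continuous_on (frontier D0) v" "continuous_on (frontier D0) (\<lambda>x. w x + C * u x powr p)"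
      by (auto intro!: continuous_intros cf[OF cv] cf[OF cw] cf[OF cp])
    fix x assume x: "x \<in> frontier D0"
    then have ux: "0 < u x" using pos D0 by blast
    show "0 \<le> w x + C * u x powr p" using F.W_ge[OF ux, of "\<bar>v x\<bar>"] by (simp add: w_def)
    show "1 \<le> w x + C * u x powr p" if "1 \<le> \<bar>v x\<bar>" using F.W_ge_one[OF ux that] by (simp add: w_def)
  qed
  also have "\<dots> = (\<integral>x. w x \<partial>\<mu>) + C * (\<integral>x. u x powr p \<partial>\<mu>)"
    using integrable_\<mu>[OF cf[OF cw]] integrable_\<mu>[OF cf[OF cp]] by simp
  also have "\<dots> \<le> 0 + C * (\<integral>x. u x powr p \<partial>\<mu>)"
    using integral_le_of_local_super[OF continuous_on_subset[OF cw D0(4)] w0] \<open>w \<xi> \<le> 0\<close> by simp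
  finally show ?thesis by (simp add: C_def)
qed

end

section \<open>From unit level to the norm inequalities\<close>

context subordinate_pair
begin

lemma weak_type_one:
  assumes "harmonic_measure D D0 \<xi> \<mu>" "0 < l"
  shows "measure \<mu> {x \<in> frontier D0. l \<le> \<bar>v x\<bar>} \<le> 2 * u \<xi> / l"
proof -
  interpret S: subordinate_pair D \<xi> "\<lambda>x. (u x + 0) / l" "\<lambda>x. v x / l"
    by (rule scale) (use assms in auto)
  show ?thesis using S.weak_type_one_unit[OF assms(1)] assms(2) by (simp add: le_divide_eq)
qed

text \<open>The special function needs \<open>u > 0\<close>, so the bound is first proved for
  \<open>u + \<eta>\<close>. Dominated convergence with majorant \<open>(u + 1) powr p\<close> then
  lets \<open>\<eta>\<close> tend to 0.\<close>

lemma weak_type_large: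
  assumes hmu: "harmonic_measure D D0 \<xi> \<mu>" and l: "0 < l" and p: "2 \<le> p" and \<xi>: "\<xi> \<in> D"
  shows "l powr p * measure \<mu> {x \<in> frontier D0. l \<le> \<bar>v x\<bar>} \<le> (p / 2) powr p / (p - 1) * (\<integral>x. \<bar>u x\<bar> powr p \<partial>\<mu>)"
proof -
  interpret harmonic_measure D D0 \<xi> \<mu> by fact
  define C where "C = (p / 2) powr p / (p - 1)"
  let ?m = "measure \<mu> {x \<in> frontier D0. l \<le> \<bar>v x\<bar>}"
  note cf = continuous_on_subset[OF cu D0(6)]
  have uf: "0 \<le> u x" if "x \<in> frontier D0" for x using that u0 D0 by blast
  have cp: "continuous_on (frontier D0) (\<lambda>x. (u x + \<eta>) powr p)" if "0 \<le> \<eta>" for \<eta>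
    using p that uf by (intro continuous_on_powr' continuous_intros cf) auto
  have shifted: "l powr p * ?m \<le> C * (\<integral>x. (u x + \<eta>) powr p \<partial>\<mu>)" if \<eta>: "0 < \<eta>" for \<eta>
  proof -
    interpret S: subordinate_pair D \<xi> "\<lambda>x. (u x + \<eta>) / l" "\<lambda>x. v x / l"
      by (rule scale) (use l \<eta> in auto)
    have eq: "{x \<in> frontier D0. 1 \<le> \<bar>v x / l\<bar>} = {x \<in> frontier D0. l \<le> \<bar>v x\<bar>}"
      using l by (auto simp: le_divide_eq)
    have "?m \<le> C * (\<integral>x. ((u x + \<eta>) / l) powr p \<partial>\<mu>)"
    proof (cases "p = 2")
      case True
      have "(\<integral>x. ((u x + \<eta>) / l) powr p \<partial>\<mu>) = (\<integral>x. ((u x + \<eta>) / l)\<^sup>2 \<partial>\<mu>)"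
        using uf l \<eta> True by (intro Bochner_Integration.integral_cong) (auto simp: space_\<mu> powr_numeral)
      then show ?thesis using S.weak_type_two_unit[OF hmu, unfolded eq] True by (simp add: C_def)
    next
      case False
      have "0 < (u x + \<eta>) / l" if "x \<in> D" for x using u0[OF that] \<eta> l by simp
      from S.weak_type_large_unit[OF hmu _ this \<xi>, of p, unfolded eq] show ?thesis using False p by (simp add: C_def)
    qed
    also have "(\<integral>x. ((u x + \<eta>) / l) powr p \<partial>\<mu>) = (\<integral>x. (u x + \<eta>) powr p / l powr p \<partial>\<mu>)"
      using uf l \<eta> by (intro Bochner_Integration.integral_cong) (auto simp: space_\<mu> powr_divide)
    also have "\<dots> = (\<integral>x. (u x + \<eta>) powr p \<partial>\<mu>) / l powr p" by simp
    finally show ?thesis using l by (simp add: field_simps)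
  qed
  have lim: "(\<lambda>n. \<integral>x. (u x + 1 / real (Suc n)) powr p \<partial>\<mu>) \<longlonglongrightarrow> (\<integral>x. \<bar>u x\<bar> powr p \<partial>\<mu>)"
  proof (rule integral_dominated_convergence[where w="\<lambda>x. (u x + 1) powr p"])
    show "(\<lambda>x. \<bar>u x\<bar> powr p) \<in> borel_measurable \<mu>"
      using p by (intro measurable_\<mu> continuous_on_powr' continuous_intros cf) auto
    show "(\<lambda>x. (u x + 1 / real (Suc n)) powr p) \<in> borel_measurable \<mu>" for n
      by (intro measurable_\<mu> cp) simp
    show "integrable \<mu> (\<lambda>x. (u x + 1) powr p)" by (intro integrable_\<mu> cp) simp
    show "AE x in \<mu>. (\<lambda>n. (u x + 1 / real (Suc n)) powr p) \<longlonglongrightarrow> \<bar>u x\<bar> powr p"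
    proof (rule AE_I2)
      fix x assume "x \<in> space \<mu>"
      then have "0 \<le> u x" using uf by (simp add: space_\<mu>)
      have "(\<lambda>n. u x + 1 / real (Suc n)) \<longlonglongrightarrow> u x + 0"
        by (intro tendsto_add tendsto_const LIMSEQ_Suc[OF lim_1_over_n])
      then have "(\<lambda>n. (u x + 1 / real (Suc n)) powr p) \<longlonglongrightarrow> (u x + 0) powr p"
        using p \<open>0 \<le> u x\<close> by (intro tendsto_powr2 tendsto_const always_eventually) auto
      then show "(\<lambda>n. (u x + 1 / real (Suc n)) powr p) \<longlonglongrightarrow> \<bar>u x\<bar> powr p" using \<open>0 \<le> u x\<close> by simp
    qed
    show "AE x in \<mu>. norm ((u x + 1 / real (Suc n)) powr p) \<le> (u x + 1) powr p" for n
    proof (rule AE_I2)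
      fix x assume "x \<in> space \<mu>"
      then have "0 \<le> u x" using uf by (simp add: space_\<mu>)
      then show "norm ((u x + 1 / real (Suc n)) powr p) \<le> (u x + 1) powr p"
        using p by (auto intro!: powr_mono2)
    qed
  qed
  have "l powr p * ?m \<le> C * (\<integral>x. \<bar>u x\<bar> powr p \<partial>\<mu>)"
    by (rule LIMSEQ_le_const[OF tendsto_mult[OF tendsto_const lim]])
      (auto intro!: exI[of _ 0] shifted)
  then show ?thesis by (simp add: C_def)
qed

text \<open>Jensen's inequality for the concave power: the tangent at \<open>u \<xi>\<close>
  integrates to \<open>u \<xi> powr p\<close>, because the mean of \<open>u\<close> under harmonic
  measure is \<open>u \<xi>\<close>. It serves the sharpness proof, where the strong norm must be
  bounded from above.\<close>

lemma strong_norm_le: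
  assumes p: "0 < p" "p < 1" and pos: "0 < u \<xi>"
  shows "strong_norm p D \<xi> u \<le> ennreal (u \<xi>)"
  unfolding strong_norm_def
proof (rule SUP_least, clarify)
  fix D0 and \<mu> :: "'a measure" assume "admissible D \<xi> D0" "harmonic_measure_at D0 \<xi> \<mu>"
  then interpret harmonic_measure D D0 \<xi> \<mu> by unfold_locales
  note cf = continuous_on_subset[OF cu D0(6)]
  have uf: "0 \<le> u x" if "x \<in> frontier D0" for x using that u0 D0 by blast
  have I: "integrable \<mu> u" by (rule integrable_\<mu>[OF cf])
  have "(\<integral>x. \<bar>u x\<bar> powr p \<partial>\<mu>) \<le> (\<integral>x. u \<xi> powr p + p * u \<xi> powr p * (u x / u \<xi> - 1) \<partial>\<mu>)"
  proof (rule integral_mono)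
    show "integrable \<mu> (\<lambda>x. \<bar>u x\<bar> powr p)"
      using p by (intro integrable_\<mu> continuous_on_powr' continuous_intros cf) auto
    show "integrable \<mu> (\<lambda>x. u \<xi> powr p + p * u \<xi> powr p * (u x / u \<xi> - 1))"
      by (intro integrable_\<mu> continuous_intros cf) (use pos in auto)
    show "\<bar>u x\<bar> powr p \<le> u \<xi> powr p + p * u \<xi> powr p * (u x / u \<xi> - 1)" if "x \<in> space \<mu>" for x
      using powr_le_tangent[of "u x" "u \<xi>" p] uf that p pos by (simp add: space_\<mu>)
  qed
  also have "\<dots> = u \<xi> powr p + p * u \<xi> powr p * ((\<integral>x. u x \<partial>\<mu>) / u \<xi> - 1)"
    using I by (simp add: space_\<mu> measure_\<mu>)
  also have "\<dots> = u \<xi> powr p" using integral_eq_of_mean[OF cu mu] pos by simp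
  finally have "(\<integral>x. \<bar>u x\<bar> powr p \<partial>\<mu>) powr (1 / p) \<le> (u \<xi> powr p) powr (1 / p)"
    using p by (intro powr_mono2) (auto intro!: integral_nonneg_AE)
  then show "ennreal ((\<integral>x. \<bar>u x\<bar> powr p \<partial>\<mu>) powr (1 / p)) \<le> ennreal (u \<xi>)"
    using p pos by (intro ennreal_leI) (simp add: powr_powr)
qed

text \<open>With \<open>s = 2 * u \<xi> / l\<close>, the level set has measure at most
  \<open>s\<close> and at most 1, hence at most \<open>s powr p\<close>. The level \<open>l\<close>
  then cancels.\<close>

lemma weak_norm_le_small:
  assumes p: "0 < p" "p < 1" and \<xi>: "\<xi> \<in> D"
  shows "weak_norm p D \<xi> v \<le> ennreal 2 * strong_norm p D \<xi> u"
  unfolding weak_norm_def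
proof (rule SUP_least, clarify)
  fix l :: real and D0 and \<mu> :: "'a measure"
  assume l: "0 < l" and "admissible D \<xi> D0" "harmonic_measure_at D0 \<xi> \<mu>"
  then interpret harmonic_measure D D0 \<xi> \<mu> by unfold_locales
  let ?m = "measure \<mu> {x \<in> frontier D0. l \<le> \<bar>v x\<bar>}"
  have u\<xi>: "0 \<le> u \<xi>" using u0 \<xi> by simp
  have m1: "?m \<le> 1" using bounded_measure[of "{x \<in> frontier D0. l \<le> \<bar>v x\<bar>}"] by (simp add: space_\<mu> measure_\<mu>)
  have m2: "?m \<le> 2 * u \<xi> / l" by (rule weak_type_one[OF _ l]) unfold_locales
  have "?m \<le> (2 * u \<xi> / l) powr p"
  proof (cases "l \<le> 2 * u \<xi>")
    case True
    then have "1 \<le> 2 * u \<xi> / l" using l by (simp add: le_divide_eq)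
    then have "1 powr p \<le> (2 * u \<xi> / l) powr p" using p by (intro powr_mono2) auto
    then show ?thesis using m1 by simp
  next
    case False
    then have "2 * u \<xi> / l \<le> 1" using l by (simp add: divide_le_eq)
    then have "(2 * u \<xi> / l) powr 1 \<le> (2 * u \<xi> / l) powr p" using p u\<xi> l by (intro powr_mono') auto
    then show ?thesis using m2 u\<xi> l by simp
  qed
  then have "l powr p * ?m \<le> l powr p * (2 * u \<xi> / l) powr p" by (intro mult_left_mono) auto
  also have "\<dots> = (2 * u \<xi>) powr p" using u\<xi> l by (simp add: powr_divide)
  finally have "(l powr p * ?m) powr (1 / p) \<le> ((2 * u \<xi>) powr p) powr (1 / p)"
    using p by (intro powr_mono2) auto
  also have "\<dots> = 2 * u \<xi>" using p u\<xi> by (simp add: powr_powr)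
  finally have "ennreal ((l powr p * ?m) powr (1 / p)) \<le> ennreal 2 * ennreal (u \<xi>)"
    using u\<xi> ennreal_mult[of 2 "u \<xi>"] ennreal_leI by (metis zero_le_numeral)
  also have "\<dots> \<le> ennreal 2 * strong_norm p D \<xi> u"
    by (intro mult_left_mono strong_norm_ge D \<xi> cu u0 p) auto
  finally show "ennreal ((l powr p * ?m) powr (1 / p)) \<le> ennreal 2 * strong_norm p D \<xi> u" .
qed

lemma weak_norm_le_large:
  assumes p: "2 \<le> p" and \<xi>: "\<xi> \<in> D"
  shows "weak_norm p D \<xi> v \<le> ennreal (p / 2 * (p - 1) powr (- 1 / p)) * strong_norm p D \<xi> u"
  unfolding weak_norm_def
proof (rule SUP_least, clarify)
  fix l :: real and D0 and \<mu> :: "'a measure"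
  assume l: "0 < l" and adm: "admissible D \<xi> D0" and hm: "harmonic_measure_at D0 \<xi> \<mu>"
  then interpret harmonic_measure D D0 \<xi> \<mu> by unfold_locales
  let ?m = "measure \<mu> {x \<in> frontier D0. l \<le> \<bar>v x\<bar>}" and ?I = "\<integral>x. \<bar>u x\<bar> powr p \<partial>\<mu>"
  have I: "0 \<le> ?I" by (intro integral_nonneg_AE) auto
  have "l powr p * ?m \<le> (p / 2) powr p / (p - 1) * ?I"
    by (rule weak_type_large[OF _ l p \<xi>]) unfold_locales
  then have "(l powr p * ?m) powr (1 / p) \<le> ((p / 2) powr p / (p - 1) * ?I) powr (1 / p)"
    using p by (intro powr_mono2) auto
  also have "\<dots> = p / 2 * (p - 1) powr (- 1 / p) * ?I powr (1 / p)"
  proof -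
    have "((p / 2) powr p / (p - 1) * ?I) powr (1 / p) = ((p / 2) powr p) powr (1 / p) / (p - 1) powr (1 / p) * ?I powr (1 / p)"
      using p I by (simp only: powr_mult powr_divide)
    moreover have "((p / 2) powr p) powr (1 / p) = p / 2" using p by (simp add: powr_powr)
    moreover have "(p - 1) powr (- 1 / p) = 1 / (p - 1) powr (1 / p)"
      using powr_minus_divide[of "p - 1" "1 / p"] by simp
    ultimately show ?thesis by simp
  qed
  finally have "ennreal ((l powr p * ?m) powr (1 / p)) \<le> ennreal (p / 2 * (p - 1) powr (- 1 / p)) * ennreal (?I powr (1 / p))"
    using p by (simp add: ennreal_mult[symmetric] ennreal_leI)
  also have "\<dots> \<le> ennreal (p / 2 * (p - 1) powr (- 1 / p)) * strong_norm p D \<xi> u"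
    unfolding strong_norm_def using adm hm
    by (intro mult_left_mono SUP_upper2[of "(D0, \<mu>)"]) auto
  finally show "ennreal ((l powr p * ?m) powr (1 / p)) \<le> ennreal (p / 2 * (p - 1) powr (- 1 / p)) * strong_norm p D \<xi> u" .
qed

end

(* Extremal pair: u is a Poisson kernel whose pole lies just outside the unit ball and v = 2u(xi) - u, with xi
   close to the antipode of the pole. As seen from xi, u is negligible on most of the unit sphere. *)
lemma weak_type_sharp:
  fixes p c :: real
  assumes p: "0 < p" "p < 1" and c: "c < 2"
  shows "\<exists>(D::'a::euclidean_space set) \<xi> u v. open D \<and> connected D \<and> \<xi> \<in> D \<and>
    harmonic_on D u \<and> harmonic_on D v \<and> (\<forall>x\<in>D. 0 \<le> u x) \<and> diff_subordinate D \<xi> v u \<and>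
    \<not> weak_norm p D \<xi> v \<le> ennreal c * strong_norm p D \<xi> u"
proof -
  define n where "n = DIM('a)"
  obtain e :: 'a where "e \<in> Basis" using nonempty_Basis by blast
  then have e: "norm e = 1" by simp
  \<comment> \<open>Raising \<open>c\<close> to at least 1 keeps all later constants positive, also
    for negative \<open>c\<close>.\<close>
  define c' where "c' = max c 1"
  have c': "1 \<le> c'" "c' < 2" "c \<le> c'" using c by (auto simp: c'_def)
  \<comment> \<open>Chosen so that \<open>(2 - \<eta>) * q0 = c'\<close> for
    \<open>\<eta> = (2 - c') / 2\<close>; any \<open>q\<close> strictly between \<open>q0\<close>
    and 1 then beats \<open>c'\<close>.\<close>
  define q0 where "q0 = 2 * c' / (2 + c')"
  have q0: "0 < q0" "q0 < 1" using c' by (auto simp: q0_def field_simps)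
  define q where "q = (1 + q0) / 2"
  have q: "0 < q" "q0 < q" "q < 1" using q0 by (auto simp: q_def)
  \<comment> \<open>A level set of measure \<open>t\<^sup>2\<close> contributes
    \<open>(t\<^sup>2) powr (1 / p) = q\<close> to the weak norm.\<close>
  define t where "t = q powr (p / 2)"
  have t: "0 < t" "t < 1" using q p powr_less_mono2[of "p/2" q 1] by (auto simp: t_def)
  have tq: "(t\<^sup>2) powr (1 / p) = q"
    using q p by (simp add: t_def powr_powr flip: powr_numeral)
  have t2: "0 < 1 - t\<^sup>2" using t by (simp add: power_less_one_iff)
  define \<eta> where "\<eta> = (2 - c') / 2"
  have \<eta>: "0 < \<eta>" "\<eta> < 1" using c' by (auto simp: \<eta>_def)
  \<comment> \<open>\<open>\<kappa>\<close> will bound \<open>u\<close> on the half of the unit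
    sphere away from the pole. It is compared with the lower bound
    \<open>(1 - t\<^sup>2) / 3 ^ n\<close> for \<open>u \<xi>\<close>, which does not depend on
    \<open>\<kappa>\<close>; \<open>\<kappa> \<le> 1\<close> gives \<open>a < 2\<close> and thus a
    distance below 3 from \<open>\<xi>\<close> to the pole.\<close>
  define \<kappa> where "\<kappa> = min 1 (\<eta> * ((1 - t\<^sup>2) / 3 ^ n))"
  have \<kappa>: "0 < \<kappa>" "\<kappa> \<le> 1" "\<kappa> \<le> \<eta> * ((1 - t\<^sup>2) / 3 ^ n)" using \<eta> t2 by (auto simp: \<kappa>_def)
  define a where "a = sqrt (1 + \<kappa>)"
  have a2: "a\<^sup>2 = 1 + \<kappa>" using \<kappa> by (simp add: a_def)
  have a1: "1 < a" using \<kappa> by (simp add: a_def)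
  have "a\<^sup>2 < 2\<^sup>2" using \<kappa> by (simp add: a2)
  then have "a < 2" by (rule power_less_imp_less_base) simp
  note a = a1 this
  define y where "y = a *\<^sub>R e"
  define D where "D = ball (0::'a) a"
  define u where "u = pole_kernel (0 - y) y"
  have ueq: "u x = (a\<^sup>2 - (norm x)\<^sup>2) / dist x y ^ n" for x
    unfolding u_def n_def using pole_kernel_sphere[of 0 y a x] a e by (simp add: y_def)
  define \<xi> where "\<xi> = - (t *\<^sub>R e)"
  have n\<xi>: "norm \<xi> = t" using t e by (simp add: \<xi>_def)
  define v where "v x = 2 * u \<xi> - u x" for x
  have "y \<notin> D" using a e by (simp add: D_def y_def)
  have "open D" "connected D" "\<xi> \<in> D" using t a n\<xi> by (simp_all add: D_def)
  have harm: "harmonic_on D u" "harmonic_on D v"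
    unfolding v_def u_def using pole_kernel_harmonic[OF \<open>open D\<close> \<open>y \<notin> D\<close>] by auto
  have u_nn: "0 \<le> u x" if "x \<in> D" for x
  proof -
    have "(norm x)\<^sup>2 \<le> a\<^sup>2" using that by (intro power_mono) (auto simp: D_def)
    then show ?thesis by (simp add: ueq)
  qed
  have u\<xi>: "(1 - t\<^sup>2) / 3 ^ n \<le> u \<xi>"
  proof -
    have "\<xi> - y = (- (t + a)) *\<^sub>R e" by (simp add: \<xi>_def y_def algebra_simps)
    then have d: "dist \<xi> y = t + a" using t a e by (simp add: dist_norm)
    have "(1 - t\<^sup>2) / 3 ^ n \<le> (a\<^sup>2 - t\<^sup>2) / (t + a) ^ n"
      using t a t2 \<kappa> by (intro frac_le power_mono) (auto simp: a2)
    then show ?thesis by (simp add: ueq d n\<xi>)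
  qed
  then have u\<xi>0: "0 < u \<xi>" using t2 by (auto intro: less_le_trans[rotated])
  have sub: "diff_subordinate D \<xi> v u"
    unfolding diff_subordinate_def
  proof (intro conjI ballI)
    show "\<bar>v \<xi>\<bar> \<le> \<bar>u \<xi>\<bar>" by (simp add: v_def)
    show "norm (grad v x) \<le> norm (grad u x)" if "x \<in> D" for x
      using pole_kernel_harmonic(3)[OF \<open>open D\<close> \<open>y \<notin> D\<close> that, of "2 * u \<xi>" "0 - y"]
      by (simp add: v_def[abs_def] u_def)
  qed
  interpret P: subordinate_pair D \<xi> u v
    by (rule subordinate_pairI[OF \<open>open D\<close> \<open>\<xi> \<in> D\<close> harm _ sub]) (use u_nn in simp)
  let ?\<mu> = "poisson_measure (0::'a) 1 \<xi>"
  have hm: "harmonic_measure_at (ball 0 1) \<xi> ?\<mu>" by (rule harmonic_measure_at_poisson) (use t n\<xi> in auto)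
  have adm: "admissible D \<xi> (ball 0 1)" by (rule admissible_ball) (use t n\<xi> a in \<open>auto simp: D_def\<close>)
  interpret H: harmonic_measure D "ball (0::'a) 1" \<xi> ?\<mu> by unfold_locales fact+
  have fr: "frontier (ball (0::'a) 1) = sphere 0 1" by simp
  \<comment> \<open>Slightly below \<open>2 * u \<xi>\<close>: wherever
    \<open>u \<le> \<eta> * u \<xi>\<close>, the function \<open>v = 2 * u \<xi> - u\<close> reaches
    this level.\<close>
  define l where "l = (2 - \<eta>) * u \<xi>"
  have l: "0 < l" using \<eta> u\<xi>0 by (simp add: l_def)
  define A where "A = {x \<in> frontier (ball (0::'a) 1). l \<le> \<bar>v x\<bar>}"
  define B where "B = {x \<in> sphere (0::'a) 1. 0 < x \<bullet> e}"
  \<comment> \<open>Outside the hemisphere \<open>B\<close> facing the pole, the distance to the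
    pole is at least 1, so \<open>u \<le> \<kappa>\<close> there.\<close>
  have AB: "sphere 0 1 \<subseteq> A \<union> B"
  proof
    fix x :: 'a assume x: "x \<in> sphere 0 1"
    show "x \<in> A \<union> B"
    proof (cases "0 < x \<bullet> e")
      case False
      have "(dist x y)\<^sup>2 = 1 + a\<^sup>2 - 2 * a * (x \<bullet> e)"
        unfolding dist_norm y_def power2_norm_eq_inner
        using x e by (simp add: inner_diff_left inner_diff_right inner_commute norm_eq_1 power2_eq_square)
      moreover have "a * (x \<bullet> e) \<le> 0" using False a by (intro mult_nonneg_nonpos) auto
      then have "2 * a * (x \<bullet> e) \<le> 0" by (simp only: mult.assoc)
      moreover have "0 \<le> a\<^sup>2" by simp
      ultimately have "1\<^sup>2 \<le> (dist x y)\<^sup>2" by (simp only: power_one)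
      then have "1 \<le> dist x y" by (rule power2_le_imp_le) simp
      then have "1 \<le> dist x y ^ n" by (rule one_le_power)
      moreover have "u x = \<kappa> / dist x y ^ n" using x by (simp add: ueq a2)
      ultimately have "u x \<le> \<kappa>" using \<kappa> by (simp add: divide_le_eq mult_le_cancel_left1)
      also have "\<dots> \<le> \<eta> * u \<xi>" using \<kappa>(3) mult_left_mono[OF u\<xi>, of \<eta>] \<eta> by linarith
      finally have "l \<le> v x" by (simp add: l_def v_def left_diff_distrib)
      then have "l \<le> \<bar>v x\<bar>" by linarith
      then show ?thesis using x by (simp add: A_def)
    qed (use x in \<open>simp add: B_def\<close>)
  qed
  have Bs: "B \<in> sets ?\<mu>"
  proof -
    have "(\<lambda>x::'a. x \<bullet> e) \<in> borel_measurable ?\<mu>"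
      by (intro H.measurable_\<mu> continuous_intros)
    then have "(\<lambda>x. x \<bullet> e) -` {0<..} \<inter> space ?\<mu> \<in> sets ?\<mu>" by (rule measurable_sets) simp
    also have "(\<lambda>x. x \<bullet> e) -` {0<..} \<inter> space ?\<mu> = B" by (auto simp: H.space_\<mu> B_def)
    finally show ?thesis .
  qed
  have cv: "continuous_on (frontier (ball 0 1)) v" by (rule continuous_on_subset[OF P.cv H.D0(6)])
  have As: "A \<in> sets ?\<mu>" unfolding A_def by (rule H.sets_level[OF cv])
  \<comment> \<open>Points of \<open>B\<close> are at distance at least 1 from \<open>\<xi>\<close>,
    which lies on the opposite side, so the Poisson kernel is at most \<open>1 - t\<^sup>2\<close>
    on \<open>B\<close>.\<close>
  have mB: "measure ?\<mu> B \<le> 1 - t\<^sup>2"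
  proof -
    have Bsub: "B \<inter> space ?\<mu> = B" by (auto simp: H.space_\<mu> B_def)
    have im: "(indicator B :: 'a \<Rightarrow> real) \<in> borel_measurable (restrict_space borel (sphere 0 1))"
      using Bs H.sets_\<mu> by (intro borel_measurable_indicator) (simp add: fr)
    have "measure ?\<mu> B = (\<integral>x. indicator B x \<partial>?\<mu>)" by (simp add: Bsub)
    also have "\<dots> = poisson_integral 0 1 (indicator B) \<xi>"
      by (rule integral_poisson_measure[OF _ _ im]) (use t n\<xi> in auto)
    also have "\<dots> \<le> (\<integral>z. 1 - t\<^sup>2 \<partial>(unif::'a measure))"
      unfolding poisson_integral_def
    proof (rule integral_mono')
      show "poisson_kernel 0 1 \<xi> (dirn z) * indicator B (0 + 1 *\<^sub>R dirn z) \<le> 1 - t\<^sup>2" for z :: 'a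
      proof (cases "dirn z \<in> B")
        case True
        have "(dist \<xi> (dirn z))\<^sup>2 = 1 + t\<^sup>2 + 2 * t * (dirn z \<bullet> e)"
          unfolding dist_norm \<xi>_def power2_norm_eq_inner
          using e norm_dirn[of z] by (simp add: inner_diff_left inner_diff_right
            inner_commute norm_eq_1 power2_eq_square del: norm_dirn)
        moreover have "0 \<le> t * (dirn z \<bullet> e)" using True t by (simp add: B_def)
        ultimately have "1\<^sup>2 \<le> (dist \<xi> (dirn z))\<^sup>2" by simp
        then have "1 \<le> dist \<xi> (dirn z)" by (rule power2_le_imp_le) simp
        then have "1 \<le> dist \<xi> (dirn z) ^ n" by (rule one_le_power)
        then have "(1 - t\<^sup>2) / dist \<xi> (dirn z) ^ n \<le> 1 - t\<^sup>2" using t2 by (simp add: divide_le_eq mult_le_cancel_left1)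
        then show ?thesis using True n\<xi> by (simp add: poisson_kernel_def n_def)
      qed (use t2 in simp)
    qed (use t2 in auto)
    finally show ?thesis by simp
  qed
  have "1 \<le> measure ?\<mu> A + measure ?\<mu> B"
  proof -
    have "1 = measure ?\<mu> (frontier (ball 0 1))" using H.measure_\<mu> by simp
    also have "\<dots> \<le> measure ?\<mu> (A \<union> B)"
      using AB As Bs by (intro H.finite_measure_mono) auto
    also have "\<dots> \<le> measure ?\<mu> A + measure ?\<mu> B" by (rule measure_Un_le[OF As Bs])
    finally show ?thesis .
  qed
  then have mA: "t\<^sup>2 \<le> measure ?\<mu> A" using mB by simp
  have "l * q = (l powr p * t\<^sup>2) powr (1 / p)"
    using l p by (simp add: powr_mult powr_powr tq)
  also have "\<dots> \<le> (l powr p * measure ?\<mu> A) powr (1 / p)"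
    using mA p by (intro powr_mono2 mult_left_mono) auto
  finally have "ennreal (l * q) \<le> ennreal ((l powr p * measure ?\<mu> A) powr (1 / p))" by (rule ennreal_leI)
  also have "\<dots> \<le> weak_norm p D \<xi> v"
    unfolding weak_norm_def A_def using adm hm l
    by (intro SUP_upper2[of "(l, ball 0 1, ?\<mu>)"]) auto
  finally have low: "ennreal (l * q) \<le> weak_norm p D \<xi> v" .
  have "c' * u \<xi> < l * q"
  proof -
    have "c' = (2 - \<eta>) * q0" using c' by (simp add: \<eta>_def q0_def field_simps)
    also have "\<dots> < (2 - \<eta>) * q" using \<eta> q by (intro mult_strict_left_mono) auto
    finally have "c' * u \<xi> < (2 - \<eta>) * q * u \<xi>" using u\<xi>0 by (intro mult_strict_right_mono)
    then show ?thesis by (simp add: l_def ac_simps)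
  qed
  have "ennreal c * strong_norm p D \<xi> u \<le> ennreal c' * ennreal (u \<xi>)"
    using c' by (intro mult_mono ennreal_leI P.strong_norm_le p u\<xi>0) auto
  also have "\<dots> = ennreal (c' * u \<xi>)" using c' u\<xi>0 by (simp add: ennreal_mult)
  also have "\<dots> < ennreal (l * q)" by (intro ennreal_lessI mult_pos_pos l q(1)) fact
  also have "\<dots> \<le> weak_norm p D \<xi> v" by (rule low)
  finally have "\<not> weak_norm p D \<xi> v \<le> ennreal c * strong_norm p D \<xi> u" by simp
  then show ?thesis
    using \<open>open D\<close> \<open>connected D\<close> \<open>\<xi> \<in> D\<close> harm u_nn sub by blast
qed

theorem theorem8p1:
  fixes D :: "'a::euclidean_space set" and \<xi> :: 'a and u v :: "'a \<Rightarrow> real"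
  assumes "open D" and "connected D" and "\<xi> \<in> D"
    and "harmonic_on D u" and "harmonic_on D v"
    and "\<forall>x\<in>D. 0 \<le> u x"
    and "diff_subordinate D \<xi> v u"
  shows "(\<forall>p. 0 < p \<and> p < 1 \<longrightarrow>
            weak_norm p D \<xi> v \<le> ennreal 2 * strong_norm p D \<xi> u \<and>
            (\<forall>c<2. \<exists>(D'::'a set) \<xi>' u' v'. open D' \<and> connected D' \<and> \<xi>' \<in> D' \<and>
                harmonic_on D' u' \<and> harmonic_on D' v' \<and> (\<forall>x\<in>D'. 0 \<le> u' x) \<and>
                diff_subordinate D' \<xi>' v' u' \<and>
                \<not> weak_norm p D' \<xi>' v' \<le> ennreal c * strong_norm p D' \<xi>' u'))
       \<and> (\<forall>p. 2 \<le> p \<longrightarrow>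
            weak_norm p D \<xi> v \<le> ennreal (p / 2 * (p - 1) powr (- 1 / p)) * strong_norm p D \<xi> u)"
proof -
  interpret subordinate_pair D \<xi> u v
    by (rule subordinate_pairI) (use assms in auto)
  show ?thesis
    using weak_norm_le_small[OF _ _ assms(3)] weak_norm_le_large[OF _ assms(3)] weak_type_sharp by blast
qed

end
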